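(* Let $X_1,\ldots,X_n$ be a stationary, reversible, time homogeneous, $\phi$-irreducible, aperiodic Markov chain with Polish state space $\Omega$ and unique stationary distribution $\pi$ (so $X_1\sim\pi$), with spectral gap $\gamma$ and absolute spectral gap $\gamma^*$. Let $f\in L^2(\pi)$ be real valued with $|f(x)-\mathbb{E}_\pi(f)|\le C$ for every $x\in\Omega$. Let $V_f:=\mathrm{Var}_\pi(f)$ and $$\sigma_{\mathrm{as}}^2:=\left\langle \bar f,\left(2(\boldsymbol{I}-(\boldsymbol{P}-\boldsymbol{\pi}))^{-1}-\boldsymbol{I}\right)\bar f\right\rangle_\pi,\qquad \bar f:=f-\mathbb{E}_\pi(f).$$ Let $S:=\sum_{i=1}^nf(X_i)$. Suppose that $n$ is even, or $\Omega$ is finite. Then for every $t\ge0$, $$\mathbb{P}_\pi(|S-\mathbb{E}_\pi(S)|\ge t)\le2\exp\left(-\frac{t^2}{2n(\sigma_{\mathrm{as}}^2+0.8V_f)+10tC/\gamma}\right),$$ and also $$\mathbb{P}_\pi(|S-\mathbb{E}_\pi(S)|\ge t)\le2\exp\left(-\frac{t^2\gamma}{4nV_f+10tC}\right).$$ More generally, let $f_1,\ldots,f_n$ be real valued $L^2(\pi)$ functions satisfying $|f_i(x)-\mathbb{E}_\pi(f_i)|\le C$ for every $x\in\Omega$. Let $S':=\sum_{i=1}^nf_i(X_i)$ and $V_{S'}:=\sum_{i=1}^n\mathrm{Var}_\pi(f_i)$. Then for every $n\ge1$ and $t\ge0$, $$\mathbb{P}_\pi(|S'-\mathbb{E}_\pi(S')|\ge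 t)\le2\exp\left(-\frac{t^2\cdot(2\gamma^*-(\gamma^* )^2)}{8V_{S'}+20tC}\right).$$
   Context: $\mathbb{P}_\pi$, $\mathbb{E}_\pi$, $\mathrm{Var}_\pi$ refer to the chain started from $X_1\sim\pi$. $L^2(\pi)$ is the Hilbert space of square integrable functions on $\Omega$ with $\langle f,g\rangle_\pi=\int f g^*\,d\pi$. For the Markov kernel $P(x,dy)$, $(\boldsymbol{P}f)(x)=\int f(y)P(x,dy)$; $\boldsymbol{I}$ is the identity and $\boldsymbol{\pi}$ the projection $\boldsymbol{\pi}(f)(x)=\mathbb{E}_\pi(f)$. Reversible: $\pi(dx)P(x,dy)=\pi(dy)P(y,dx)$, i.e. $\boldsymbol{P}$ is self-adjoint. With $S_2\subset\mathbb{R}$ the spectrum of $\boldsymbol{P}$ on (complex) $L^2(\pi)$: $\gamma:=1-\sup\{\lambda\in S_2:\lambda\ne1\}$ and $\gamma^*:=1-\sup\{|\lambda|:\lambda\in S_2,\lambda\ne1\}$ if the eigenvalue $1$ has multiplicity $1$; both are $0$ otherwise. The quantity $\sigma_{\mathrm{as}}^2$, and hence the first inequality, is considered for $\gamma>0$. $\phi$-irreducible: there is a non-zero $\sigma$-finite measure $\phi$ on $\Omega$ such that for all $A$ with $\phi(A)>0$ and all $x\in\Omega$ there is $n\ge1$ with $P^n(x,A)>0$. Aperiodic: there are no $d\ge2$ and disjoint $\Omega_1,\ldots,\Omega_d\subset\Omega$ with $\pi(\Omega_1)>0$, $P(x,\Omega_{i+1})=1$ for $x\in\Omega_i$ ($i\le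 d-1$), and $P(x,\Omega_1)=1$ for $x\in\Omega_d$. *)

theory Defs
  imports "HOL-Probability.Probability"
begin

text \<open>
  Elements of complex $L^2(\pi)$ are represented by square integrable functions, and equality
  in $L^2(\pi)$ is almost everywhere equality; operators act on representatives.
\<close>

definition L2 :: "'a measure \<Rightarrow> ('a \<Rightarrow> complex) set" where
  "L2 M = {f \<in> borel_measurable M. integrable M (\<lambda>x. (cmod (f x))\<^sup>2)}"

definition L2_inner :: "'a measure \<Rightarrow> ('a \<Rightarrow> complex) \<Rightarrow> ('a \<Rightarrow> complex) \<Rightarrow> complex" where
  "L2_inner M f g = (\<integral>x. f x * cnj (g x) \<partial>M)"

definition L2_norm :: "'a measure \<Rightarrow> ('a \<Rightarrow> complex) \<Rightarrow> real" where
  "L2_norm M f = sqrt (\<integral>x. (cmod (f x))\<^sup>2 \<partial>M)"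

text \<open>
  Compatibility with almost everywhere equality need not be required separately: it follows from
  linearity and boundedness.
\<close>

definition L2_bounded_linear ::
    "'a measure \<Rightarrow> (('a \<Rightarrow> complex) \<Rightarrow> ('a \<Rightarrow> complex)) \<Rightarrow> bool" where
  "L2_bounded_linear M T \<longleftrightarrow>
     (\<forall>f\<in>L2 M. T f \<in> L2 M) \<and>
     (\<forall>f\<in>L2 M. \<forall>g\<in>L2 M. AE x in M. T (\<lambda>x. f x + g x) x = T f x + T g x) \<and>
     (\<forall>c. \<forall>f\<in>L2 M. AE x in M. T (\<lambda>x. c * f x) x = c * T f x) \<and>
     (\<exists>K. \<forall>f\<in>L2 M. L2_norm M (T f) \<le> K * L2_norm M f)"

definition L2_is_inverse ::
    "'a measure \<Rightarrow> (('a \<Rightarrow> complex) \<Rightarrow> ('a \<Rightarrow> complex))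
       \<Rightarrow> (('a \<Rightarrow> complex) \<Rightarrow> ('a \<Rightarrow> complex)) \<Rightarrow> bool" where
  "L2_is_inverse M A B \<longleftrightarrow>
     L2_bounded_linear M B \<and>
     (\<forall>f\<in>L2 M. (AE x in M. B (A f) x = f x) \<and> (AE x in M. A (B f) x = f x))"

text \<open>
  For a bounded operator \<open>A\<close> on $L^2$ the inverse, if there is one, is unique up to almost
  everywhere equality.
\<close>

definition L2_inv ::
    "'a measure \<Rightarrow> (('a \<Rightarrow> complex) \<Rightarrow> ('a \<Rightarrow> complex))
       \<Rightarrow> (('a \<Rightarrow> complex) \<Rightarrow> ('a \<Rightarrow> complex))" where
  "L2_inv M A = (SOME B. L2_is_inverse M A B)"

definition L2_spectrum ::
    "'a measure \<Rightarrow> (('a \<Rightarrow> complex) \<Rightarrow> ('a \<Rightarrow> complex)) \<Rightarrow> complex set" where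
  "L2_spectrum M A = {c. \<not> (\<exists>B. L2_is_inverse M (\<lambda>f x. c * f x - A f x) B)}"

definition L2_eigenspace ::
    "'a measure \<Rightarrow> (('a \<Rightarrow> complex) \<Rightarrow> ('a \<Rightarrow> complex)) \<Rightarrow> complex \<Rightarrow> ('a \<Rightarrow> complex) set" where
  "L2_eigenspace M A c = {f \<in> L2 M. AE x in M. A f x = c * f x}"

text \<open>The eigenspace, as a subspace of $L^2$, has dimension one.\<close>

definition L2_multiplicity_one ::
    "'a measure \<Rightarrow> (('a \<Rightarrow> complex) \<Rightarrow> ('a \<Rightarrow> complex)) \<Rightarrow> complex \<Rightarrow> bool" where
  "L2_multiplicity_one M A c \<longleftrightarrow>
     (\<exists>g\<in>L2_eigenspace M A c. \<not> (AE x in M. g x = 0) \<and>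
        (\<forall>f\<in>L2_eigenspace M A c. \<exists>a. AE x in M. f x = a * g x))"

definition markov_op :: "('a \<Rightarrow> 'a measure) \<Rightarrow> ('a \<Rightarrow> complex) \<Rightarrow> ('a \<Rightarrow> complex)" where
  "markov_op P f = (\<lambda>x. \<integral>y. f y \<partial>P x)"

definition mean_op :: "'a measure \<Rightarrow> ('a \<Rightarrow> complex) \<Rightarrow> ('a \<Rightarrow> complex)" where
  "mean_op \<pi> f = (\<lambda>x. \<integral>y. f y \<partial>\<pi>)"

text \<open>
  The spectrum without $1$ is empty only if $L^2(\pi)$ is one-dimensional, i.e. every
  $L^2$ function is almost everywhere constant. The supremum is then taken to be $0$, so that both
  gaps are $1$.
\<close>

definition gap_Sup :: "real set \<Rightarrow> real" where
  "gap_Sup A = (if A = {} then 0 else Sup A)"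

definition spectral_gap :: "('a \<Rightarrow> 'a measure) \<Rightarrow> 'a measure \<Rightarrow> real" where
  "spectral_gap P \<pi> =
     (if L2_multiplicity_one \<pi> (markov_op P) 1
      then 1 - gap_Sup {l::real. complex_of_real l \<in> L2_spectrum \<pi> (markov_op P) \<and> l \<noteq> 1}
      else 0)"

definition abs_spectral_gap :: "('a \<Rightarrow> 'a measure) \<Rightarrow> 'a measure \<Rightarrow> real" where
  "abs_spectral_gap P \<pi> =
     (if L2_multiplicity_one \<pi> (markov_op P) 1
      then 1 - gap_Sup {cmod l | l. l \<in> L2_spectrum \<pi> (markov_op P) \<and> l \<noteq> 1}
      else 0)"

text \<open>
  The operator is invertible when the spectral gap is positive. For a reversible kernel it is then
  self-adjoint, so the inner product is real and \<open>Re\<close> only changes the type.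
\<close>

definition asymptotic_variance :: "('a \<Rightarrow> 'a measure) \<Rightarrow> 'a measure \<Rightarrow> ('a \<Rightarrow> real) \<Rightarrow> real" where
  "asymptotic_variance P \<pi> f =
     (let fbar = (\<lambda>x. complex_of_real (f x - (\<integral>y. f y \<partial>\<pi>)));
          R = L2_inv \<pi> (\<lambda>g x. g x - (markov_op P g x - mean_op \<pi> g x))
      in Re (L2_inner \<pi> fbar (\<lambda>x. 2 * R fbar x - fbar x)))"

definition stationary_distribution ::
    "('a::topological_space \<Rightarrow> 'a measure) \<Rightarrow> 'a measure \<Rightarrow> bool" where
  "stationary_distribution P \<pi> \<longleftrightarrow> \<pi> \<in> space (prob_algebra borel) \<and> \<pi> \<bind> P = \<pi>"

definition reversible_kernel ::
    "('a::topological_space \<Rightarrow> 'a measure) \<Rightarrow> 'a measure \<Rightarrow> bool" where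
  "reversible_kernel P \<pi> \<longleftrightarrow>
     (\<forall>A\<in>sets borel. \<forall>B\<in>sets borel.
        (\<integral>\<^sup>+x\<in>A. emeasure (P x) B \<partial>\<pi>) = (\<integral>\<^sup>+x\<in>B. emeasure (P x) A \<partial>\<pi>))"

definition kernel_power ::
    "('a::topological_space \<Rightarrow> 'a measure) \<Rightarrow> nat \<Rightarrow> 'a \<Rightarrow> 'a measure" where
  "kernel_power P m x = ((\<lambda>\<mu>. \<mu> \<bind> P) ^^ m) (return borel x)"

definition phi_irreducible :: "('a::topological_space \<Rightarrow> 'a measure) \<Rightarrow> bool" where
  "phi_irreducible P \<longleftrightarrow>
     (\<exists>\<phi>. sets \<phi> = sets borel \<and> sigma_finite_measure \<phi> \<and> emeasure \<phi> UNIV \<noteq> 0 \<and>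
        (\<forall>A\<in>sets borel. emeasure \<phi> A > 0 \<longrightarrow>
           (\<forall>x. \<exists>m\<ge>1. emeasure (kernel_power P m x) A > 0)))"

definition aperiodic_kernel ::
    "('a::topological_space \<Rightarrow> 'a measure) \<Rightarrow> 'a measure \<Rightarrow> bool" where
  "aperiodic_kernel P \<pi> \<longleftrightarrow>
     \<not> (\<exists>d\<ge>2. \<exists>D :: nat \<Rightarrow> 'a set.
          (\<forall>i\<in>{1..d}. D i \<in> sets borel) \<and> disjoint_family_on D {1..d} \<and>
          emeasure \<pi> (D 1) > 0 \<and>
          (\<forall>i\<in>{1..<d}. \<forall>x\<in>D i. emeasure (P x) (D (Suc i)) = 1) \<and>
          (\<forall>x\<in>D d. emeasure (P x) (D 1) = 1))"

text \<open>
  $X_1,\dots,X_n$ on the probability space \<open>N\<close>: the conditional law of $X_{i+1}$ given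
  $\sigma(X_1,\dots,X_i)$ is $P(X_i,\cdot)$, for the same kernel at every time.
\<close>

definition markov_chain ::
    "'w measure \<Rightarrow> ('a::topological_space \<Rightarrow> 'a measure) \<Rightarrow> nat \<Rightarrow> (nat \<Rightarrow> 'w \<Rightarrow> 'a) \<Rightarrow> bool" where
  "markov_chain N P n X \<longleftrightarrow>
     prob_space N \<and>
     (\<forall>i\<in>{1..n}. X i \<in> borel_measurable N) \<and>
     (\<forall>i\<in>{1..<n}. \<forall>A\<in>sets borel. AE \<omega> in N.
        real_cond_exp N
          (vimage_algebra (space N) (\<lambda>\<omega>. \<lambda>j\<in>{1..i}. X j \<omega>) (\<Pi>\<^sub>M j\<in>{1..i}. borel))
          (\<lambda>\<omega>. indicator A (X (Suc i) \<omega>)) \<omega> = measure (P (X i \<omega>)) A)"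

end

theory Submission
  imports Defs
begin

text \<open>
  By Chernoff's method everything reduces to $E\, e^{\theta S}$, which is a product of operators
  $e^{u/2} P e^{u/2}$ with $u = \theta (f - E f)$. Substituting $h = e^{u/2} g$, the norm of such an
  operator is at most $\rho$ once $\langle h, P h\rangle \le \rho\, \langle h, e^{-u} h\rangle$ for all $h$:
  it preserves positivity, so its norm is the supremum of its quadratic form.
  Splitting $h = E h + h_0$ and using the Poincare inequality
  $\gamma \| h_0 \|^2 \le \langle h_0, (I - P) h_0\rangle$ together with
  $\langle u, h_0\rangle^2 \le s\, \langle h_0, (I - P) h_0\rangle$, where
  $s = \theta^2 (\sigma_{\mathrm{as}}^2 + V_f) / 2$ comes from the Poisson equation, this becomes the
  nonnegativity of a binary quadratic form. For different functions $f_i$ the bilinear form of $P$ is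
  dominated by that of $(1 - \gamma^*) I + \gamma^* \pi$, and $s = \theta^2 V / \gamma^*$.

  The Poincare inequality follows from the definition of the gap by resolvents only: if the spectrum of $B = I - P$
  avoids $(0, \gamma)$ then $B^2 \ge \gamma B$, hence $B \ge \gamma$ on the range of $B$, which is dense in the
  mean zero functions when the eigenvalue $1$ is simple.
\<close>

text \<open>Origin of the constants. Let x = \<theta> C / \<gamma> and let v be the variance of u.
  Chernoff's method is used only for x < 1/5, and the gap is at most 2 as soon as some function has
  positive variance, so |u| <= 2/5 throughout. One transition costs a factor exp p with p = (s -
  v/10) (1 + 5x + 25x^2) - v/10. Since 1 + 5x + 25x^2 <= 1 / (1 - 5x), the first part has
  Bernstein's shape: 4 (s - v/10) = 2 \<theta>^2 (\<sigma>^2 + 0.8 V), with \<sigma>^2 the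
  asymptotic variance, explains 0.8, and 2 * 5 C / \<gamma> explains 10. The v/10 held back at each
  transition pays for the two end factors.

  The obstacle is that P need not be positive: its spectrum may reach -1, while the first two bounds
  see only the distance from 1. So only upper bounds on the form of P are available. The passage
  from forms to bilinear bounds therefore goes through |a - b|, and the proof of the Poincare
  inequality iterates (I + P) / 2 instead of P.\<close>

section \<open>Inequalities for real numbers\<close>

text \<open>The Lagrange remainder is \<open>exp t / 6 * z ^ 3\<close>, and
  \<open>exp (2/5) \<le> 3/2\<close> because its fifth power \<open>exp 1 ^ 2\<close> is below
  \<open>(3/2) ^ 5\<close>. The range 2/5 is a gap of at most 2 times x at most 1/5.\<close>

lemma exp_cubic_bound:
  fixes z :: real
  assumes "\<bar>z\<bar> \<le> 2/5"
  shows "\<bar>exp z - 1 - z - z\<^sup>2 / 2\<bar> \<le> \<bar>z\<bar> ^ 3 / 4"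
proof -
  obtain t where t: "\<bar>t\<bar> \<le> \<bar>z\<bar>" "exp z = (\<Sum>m<3. z ^ m / fact m) + exp t / fact 3 * z ^ 3"
    using Maclaurin_exp_le by blast
  have eq: "exp z - 1 - z - z\<^sup>2 / 2 = exp t / 6 * z ^ 3"
    using t(2) by (simp add: eval_nat_numeral)
  have "exp 1 ^ 2 \<le> (272/100::real) ^ 2"
    by (intro power_mono less_imp_le[OF e_less_272]) auto
  moreover have "exp (2/5) ^ 5 = (exp 1 ^ 2 :: real)"
    using exp_of_nat_mult[of 5 "2/5 :: real"] exp_of_nat_mult[of 2 "1 :: real"] by simp
  ultimately have "exp (2/5) ^ 5 \<le> (3/2::real) ^ 5"
    by (simp add: power_divide)
  then have "exp (2/5) \<le> (3/2::real)"
    by (subst (asm) power_mono_iff) auto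
  moreover have "exp t \<le> exp (2/5)"
    using t(1) assms by auto
  ultimately have "exp t / 6 \<le> 1/4" by linarith
  then have "exp t / 6 * \<bar>z\<bar> ^ 3 \<le> 1/4 * \<bar>z\<bar> ^ 3"
    by (intro mult_right_mono) auto
  then show ?thesis by (simp add: eq abs_mult power_abs)
qed

text \<open>3/5 is 1/2 + (1/4) (2/5): the cubic error is folded into the quadratic term.\<close>

lemma exp_minus_linear_bound:
  fixes z :: real
  assumes "\<bar>z\<bar> \<le> 2/5"
  shows "\<bar>exp z - 1 - z\<bar> \<le> 3/5 * z\<^sup>2"
proof -
  have "\<bar>z\<bar> ^ 3 = \<bar>z\<bar> * z\<^sup>2" by (simp add: power3_eq_cube power2_eq_square)
  also have "\<dots> \<le> 2/5 * z\<^sup>2" using assms by (intro mult_right_mono) auto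
  finally show ?thesis using exp_cubic_bound[OF assms] zero_le_power2[of z] by linarith
qed

text \<open>
  Here \<open>x = \<theta> C / \<gamma>\<close> and \<open>\<sigma>\<close> is the ratio of \<open>s\<close> to the variance of \<open>\<theta> f\<close>.
\<close>

lemma growth_rate_polynomial_bound:
  fixes g x v \<sigma> p :: real
  assumes g: "0 < g" "g \<le> 2" and x: "0 \<le> x" "x \<le> 1/5" and v: "0 \<le> v" "v \<le> (g * x)\<^sup>2"
    and \<sigma>: "1/2 \<le> \<sigma>" "g * \<sigma> \<le> 1"
  defines "p \<equiv> v * (\<sigma> - 1/5 + (5 * x + 25 * x\<^sup>2) * (\<sigma> - 1/10))"
  shows "0 \<le> p"
    and "(1 + p)\<^sup>2 * (\<sigma> + 27/20 * x) \<le> (\<sigma> + 3/10 + (5 * x + 25 * x\<^sup>2) * (\<sigma> - 1/10) - x / 2) * (1 - x)"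
proof -
  have a0: "0 \<le> \<sigma> - 1/5 + (5 * x + 25 * x\<^sup>2) * (\<sigma> - 1/10)"
    using \<sigma> x by (intro add_nonneg_nonneg mult_nonneg_nonneg) auto
  show p0: "0 \<le> p" unfolding p_def using v a0 by simp
  \<comment> \<open>One factor g of \<open>(g * x)\<^sup>2\<close> is spent on
    \<open>g * \<sigma> \<le> 1\<close>, which frees the bound on p from \<sigma>. The quadratics in
    g that remain increase on (0, 2], so they are largest at g = 2.\<close>
  have gs: "g * (g * \<sigma> - g / 5) \<le> g * (1 - g/5)" "g * (g * \<sigma> - g / 10) \<le> g * (1 - g/10)"
    using \<sigma> g by (intro mult_left_mono; simp)+
  have e1: "g * (1 - g/5) \<le> 6/5"
  proof -
    have "6/5 - g * (1 - g/5) = (2 - g) * (3 - g) / 5" by (simp add: field_simps)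
    also have "\<dots> \<ge> 0" using g by simp
    finally show ?thesis by simp
  qed
  have e2: "g * (1 - g/10) \<le> 8/5"
  proof -
    have "8/5 - g * (1 - g/10) = (2 - g) * (8 - g) / 10" by (simp add: field_simps)
    also have "\<dots> \<ge> 0" using g by simp
    finally show ?thesis by simp
  qed
  have "p \<le> (g * x)\<^sup>2 * (\<sigma> - 1/5 + (5 * x + 25 * x\<^sup>2) * (\<sigma> - 1/10))"
    unfolding p_def using v a0 by (intro mult_right_mono)
  also have "\<dots> = x\<^sup>2 * (g * (g * \<sigma> - g / 5) + (5 * x + 25 * x\<^sup>2) * (g * (g * \<sigma> - g / 10)))"
    by (simp add: power2_eq_square algebra_simps)
  also have "\<dots> \<le> x\<^sup>2 * (6/5 + (5 * x + 25 * x\<^sup>2) * (8/5))"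
    using gs e1 e2 x by (intro mult_left_mono add_mono) auto
  also have "\<dots> \<le> x\<^sup>2 * (6/5 + (5 * (1/5) + 25 * (1/5)\<^sup>2) * (8/5))"
    using x by (intro mult_left_mono mult_right_mono add_mono power_mono) auto
  also have "\<dots> = x * (x * (22/5))" by (simp add: power2_eq_square)
  also have "\<dots> \<le> x * (1/5 * (22/5))" using x by (intro mult_left_mono mult_right_mono) auto
  finally have px: "p \<le> 22/25 * x" by simp
  have "(1 + p)\<^sup>2 = 1 + p * (2 + p)" by (simp add: power2_eq_square algebra_simps)
  also have "\<dots> \<le> 1 + 22/25 * x * (2 + 22/25 * (1/5))"
    using px p0 x by (intro add_left_mono mult_mono) auto
  also have "\<dots> \<le> 1 + 48/25 * x" using x by simp
  finally have "(1 + p)\<^sup>2 * (\<sigma> + 27/20 * x) \<le> (1 + 48/25 * x) * (\<sigma> + 27/20 * x)"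
    using \<sigma> x by (intro mult_right_mono) auto
  also have "\<dots> \<le> (\<sigma> + 3/10 + (5 * x + 25 * x\<^sup>2) * (\<sigma> - 1/10) - x / 2) * (1 - x)"
  proof -
    \<comment> \<open>The difference of the two sides is affine in \<sigma>. Written in d >= 0, both
      its slope and its value at d = 0 are polynomials in x that are nonnegative on
      [0, 1/5].\<close>
    define d where "d = \<sigma> - 1/2"
    have d0: "0 \<le> d" using \<sigma> by (simp add: d_def)
    have \<sigma>d: "\<sigma> = d + 1/2" by (simp add: d_def)
    have "(\<sigma> + 3/10 + (5 * x + 25 * x\<^sup>2) * (\<sigma> - 1/10) - x / 2) * (1 - x)
        - (1 + 48/25 * x) * (\<sigma> + 27/20 * x)
      = d * x * (52/25 + 20 * x - 25 * x\<^sup>2) + (3/10 - 161/100 * x + 1477/250 * x\<^sup>2 - 10 * x ^ 3)"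
      by (simp add: \<sigma>d power2_eq_square power3_eq_cube field_simps)
    moreover have "0 \<le> d * x * (52/25 + 20 * x - 25 * x\<^sup>2)"
    proof (intro mult_nonneg_nonneg d0 x)
      have "x\<^sup>2 \<le> (1/5)\<^sup>2" using x by (intro power_mono) auto
      then show "0 \<le> 52/25 + 20 * x - 25 * x\<^sup>2" using x by (simp add: power_divide)
    qed
    moreover have "0 \<le> 3/10 - 161/100 * x + 1477/250 * x\<^sup>2 - 10 * x ^ 3"
    proof -
      have "10 * x ^ 3 \<le> 2 * x\<^sup>2"
        using mult_right_mono[OF x(2), of "x\<^sup>2"] by (simp add: power3_eq_cube power2_eq_square)
      moreover have "0 \<le> (x - 1/5)\<^sup>2" by simp
      ultimately show ?thesis using x by (simp add: power2_eq_square algebra_simps)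
    qed
    ultimately show ?thesis by linarith
  qed
  finally show "(1 + p)\<^sup>2 * (\<sigma> + 27/20 * x) \<le> (\<sigma> + 3/10 + (5 * x + 25 * x\<^sup>2) * (\<sigma> - 1/10) - x / 2) * (1 - x)" .
qed

section \<open>Binary quadratic forms and log-convexity\<close>

lemma discriminant_nonpos:
  fixes a b c :: real
  assumes "\<And>t. 0 \<le> a + 2 * t * b + t\<^sup>2 * c"
  shows "b\<^sup>2 \<le> a * c"
proof (cases "c = 0")
  case True
  have "b = 0"
  proof (rule ccontr)
    assume "b \<noteq> 0"
    define t where "t = - (a + 1) / (2 * b)"
    from \<open>b \<noteq> 0\<close> have "2 * t * b = - (a + 1)" by (simp add: t_def)
    with assms[of t] True show False by simp
  qed
  with True show ?thesis by simp
next
  case False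
  have "c \<ge> 0"
  proof (rule ccontr)
    assume n: "\<not> c \<ge> 0"
    have "0 \<le> 2 * a + 2 * t\<^sup>2 * c" for t using assms[of t] assms[of "- t"] by simp
    note this[of "sqrt ((\<bar>a\<bar> + 1) / (- c))"]
    also have "(sqrt ((\<bar>a\<bar> + 1) / (- c)))\<^sup>2 = (\<bar>a\<bar> + 1) / (- c)"
      using n by (intro real_sqrt_pow2 divide_nonneg_nonneg) auto
    also have "2 * \<dots> * c = - 2 * (\<bar>a\<bar> + 1)" using n by (simp add: field_simps)
    finally show False using abs_ge_self[of a] by (simp add: abs_if split: if_splits)
  qed
  with False have c: "c > 0" by simp
  have "0 \<le> a + 2 * (- b / c) * b + (- b / c)\<^sup>2 * c" by (rule assms)
  also have "\<dots> = a - b\<^sup>2 / c" using c by (simp add: power2_eq_square field_simps)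
  finally show ?thesis using c by (simp add: field_simps)
qed

lemma quadratic_form_nonneg:
  fixes a b c \<alpha> y :: real
  assumes "0 \<le> a" "0 \<le> c" "b\<^sup>2 \<le> a * c"
  shows "0 \<le> a * \<alpha>\<^sup>2 + 2 * b * (\<alpha> * y) + c * y\<^sup>2"
proof (cases "a = 0")
  case True
  with assms show ?thesis by simp
next
  case False
  have "a * (a * \<alpha>\<^sup>2 + 2 * b * (\<alpha> * y) + c * y\<^sup>2) = (a * \<alpha> + b * y)\<^sup>2 + (a * c - b\<^sup>2) * y\<^sup>2"
    by (simp add: power2_eq_square algebra_simps)
  also have "\<dots> \<ge> 0" using assms by simp
  finally show ?thesis using False assms(1) by (simp add: zero_le_mult_iff)
qed

text \<open>Ratios of successive terms of a log-convex sequence increase, so a lower bound on the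
  first ratio passes to the second. The form without division admits vanishing terms.\<close>

lemma log_convex_ratio:
  fixes a\<^sub>1 a\<^sub>2 a\<^sub>3 \<delta> :: real
  assumes "a\<^sub>2 * a\<^sub>2 \<le> a\<^sub>1 * a\<^sub>3" "\<delta> * a\<^sub>1 \<le> a\<^sub>2" "0 \<le> a\<^sub>1" "0 \<le> a\<^sub>3" "0 \<le> a\<^sub>2" "0 \<le> \<delta>"
  shows "\<delta> * a\<^sub>2 \<le> a\<^sub>3"
proof (cases "a\<^sub>2 = 0")
  case False
  with assms(5) have "0 < a\<^sub>2" by simp
  have "\<delta> * (a\<^sub>2 * a\<^sub>2) \<le> \<delta> * (a\<^sub>1 * a\<^sub>3)" using assms(1,6) by (rule mult_left_mono)
  also have "\<dots> = \<delta> * a\<^sub>1 * a\<^sub>3" by simp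
  also have "\<dots> \<le> a\<^sub>2 * a\<^sub>3" using assms(2,4) by (rule mult_right_mono)
  finally have "a\<^sub>2 * (\<delta> * a\<^sub>2) \<le> a\<^sub>2 * a\<^sub>3" by (simp only: mult.left_commute)
  with \<open>0 < a\<^sub>2\<close> show ?thesis by (rule mult_left_le_imp_le[rotated])
qed (use assms in simp)

section \<open>Self-adjoint operators on semi-inner product spaces\<close>

text \<open>Vectors are compared only through inner products. Square integrable functions themselves
  are then a model, without passing to classes modulo null sets, and \<open>ip\<close> is only
  semidefinite.\<close>

locale semi_inner_space =
  fixes V :: "'v set" and add :: "'v \<Rightarrow> 'v \<Rightarrow> 'v" and scl :: "real \<Rightarrow> 'v \<Rightarrow> 'v"
    and ip :: "'v \<Rightarrow> 'v \<Rightarrow> real"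
  assumes add_closed [simp]: "f \<in> V \<Longrightarrow> g \<in> V \<Longrightarrow> add f g \<in> V"
    and scl_closed [simp]: "f \<in> V \<Longrightarrow> scl c f \<in> V"
    and ip_sym: "f \<in> V \<Longrightarrow> g \<in> V \<Longrightarrow> ip f g = ip g f"
    and ip_add_left [simp]: "f \<in> V \<Longrightarrow> g \<in> V \<Longrightarrow> h \<in> V \<Longrightarrow> ip (add f g) h = ip f h + ip g h"
    and ip_scl_left [simp]: "f \<in> V \<Longrightarrow> h \<in> V \<Longrightarrow> ip (scl c f) h = c * ip f h"
    and ip_nonneg [simp]: "f \<in> V \<Longrightarrow> 0 \<le> ip f f"
begin

lemma ip_add_right [simp]: "f \<in> V \<Longrightarrow> g \<in> V \<Longrightarrow> h \<in> V \<Longrightarrow> ip h (add f g) = ip h f + ip h g"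
  using ip_sym[of h "add f g"] by (simp add: ip_sym[of f] ip_sym[of g])

lemma ip_scl_right [simp]: "f \<in> V \<Longrightarrow> h \<in> V \<Longrightarrow> ip h (scl c f) = c * ip h f"
  using ip_sym[of h "scl c f"] by (simp add: ip_sym[of f])

definition self_adjoint :: "('v \<Rightarrow> 'v) \<Rightarrow> bool" where
  "self_adjoint T \<longleftrightarrow> (\<forall>f\<in>V. T f \<in> V) \<and> (\<forall>f\<in>V. \<forall>g\<in>V. ip (T f) g = ip f (T g))"

lemma self_adjoint_closed: "self_adjoint T \<Longrightarrow> f \<in> V \<Longrightarrow> T f \<in> V"
  by (simp add: self_adjoint_def)

lemma self_adjoint_swap: "self_adjoint T \<Longrightarrow> f \<in> V \<Longrightarrow> g \<in> V \<Longrightarrow> ip (T f) g = ip f (T g)"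
  by (simp add: self_adjoint_def)

text \<open>Self-adjointness makes an operator linear up to vectors of norm zero.\<close>

lemma self_adjoint_ip_linear:
  assumes "self_adjoint T" "f \<in> V" "g \<in> V" "h \<in> V"
  shows "ip (T (add f g)) h = ip (T f) h + ip (T g) h" "ip (T (scl c f)) h = c * ip (T f) h"
    "ip h (T (add f g)) = ip h (T f) + ip h (T g)" "ip h (T (scl c f)) = c * ip h (T f)"
  using assms by (simp_all add: self_adjoint_def ip_sym)
     (simp_all add: self_adjoint_def flip: self_adjoint_swap[OF assms(1)])

section \<open>Norm bounds and quadratic forms of self-adjoint operators\<close>

lemma Cauchy_Schwarz_form:
  assumes T: "self_adjoint T" and pos: "\<And>f. f \<in> V \<Longrightarrow> 0 \<le> ip (T f) f" and f: "f \<in> V" and g: "g \<in> V"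
  shows "(ip (T f) g)\<^sup>2 \<le> ip (T f) f * ip (T g) g"
proof (rule discriminant_nonpos)
  fix t :: real
  have "0 \<le> ip (T (add f (scl t g))) (add f (scl t g))" using f g by (intro pos) simp
  also have "\<dots> = ip (T f) f + t * (ip (T f) g + ip (T g) f) + t\<^sup>2 * ip (T g) g"
    using f g T by (simp add: self_adjoint_ip_linear self_adjoint_closed algebra_simps power2_eq_square)
  also have "ip (T g) f = ip (T f) g"
    using f g T by (metis ip_sym self_adjoint_closed self_adjoint_swap)
  finally show "0 \<le> ip (T f) f + 2 * t * ip (T f) g + t\<^sup>2 * ip (T g) g" by (simp add: algebra_simps)
qed

lemma Cauchy_Schwarz: "f \<in> V \<Longrightarrow> g \<in> V \<Longrightarrow> (ip f g)\<^sup>2 \<le> ip f f * ip g g"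
  using Cauchy_Schwarz_form[of "\<lambda>f. f"] by (simp add: self_adjoint_def)

text \<open>Cauchy-Schwarz for the form of \<open>T\<close> at the pair \<open>f\<close>,
  \<open>T f\<close>. The form bound is assumed at \<open>T f\<close> alone, so the lemma applies
  when the bound is known only on a set that \<open>T\<close> maps to itself.\<close>

lemma psd_norm_bound:
  assumes T: "self_adjoint T" and pos: "\<And>f. f \<in> V \<Longrightarrow> 0 \<le> ip (T f) f"
    and f: "f \<in> V" and M0: "0 \<le> M" and M: "ip (T (T f)) (T f) \<le> M * ip (T f) (T f)"
  shows "ip (T f) (T f) \<le> M * ip (T f) f"
proof (cases "ip (T f) (T f) = 0")
  case True
  with M0 pos[OF f] show ?thesis by simp
next
  case False
  have Tf: "T f \<in> V" using T f by (simp add: self_adjoint_closed)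
  with False have p: "ip (T f) (T f) > 0" using ip_nonneg[OF Tf] by linarith
  have "ip (T f) (T f) * ip (T f) (T f) \<le> ip (T f) f * ip (T (T f)) (T f)"
    using Cauchy_Schwarz_form[OF T pos f Tf] by (simp add: power2_eq_square)
  also have "\<dots> \<le> ip (T f) f * (M * ip (T f) (T f))"
    using M pos[OF f] by (intro mult_left_mono)
  also have "\<dots> = M * ip (T f) f * ip (T f) (T f)" by simp
  finally show ?thesis using p by (rule mult_right_le_imp_le)
qed

text \<open>Stands in for the spectral theorem. Let k be the best constant with k |g|^2 <= |L g|^2
  and let s = sqrt k. If s < d, then L - s and L + s are both bounded below, hence so is their
  product L^2 - k. That product is positive semidefinite, so its form is bounded below as well, and
  k was not the best constant.\<close>

lemma bounded_below_imp_norm_ge: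
  assumes L: "self_adjoint L" and M: "\<And>g. g \<in> V \<Longrightarrow> ip (L g) (L g) \<le> M * ip g g" and d: "d \<ge> 0"
    and below: "\<And>t. \<bar>t\<bar> < d \<Longrightarrow> \<exists>e>0. \<forall>g\<in>V. e * ip g g \<le> ip (add (L g) (scl t g)) (add (L g) (scl t g))"
    and g: "g \<in> V"
  shows "d\<^sup>2 * ip g g \<le> ip (L g) (L g)"
proof (rule ccontr)
  assume neg: "\<not> ?thesis"
  note Lc [simp] = self_adjoint_closed[OF L]
  note Ll [simp] = self_adjoint_ip_linear[OF L]
  define I where "I = {k. 0 \<le> k \<and> (\<forall>g\<in>V. k * ip g g \<le> ip (L g) (L g))}"
  have I0: "0 \<in> I" by (simp add: I_def)
  have Id: "k < d\<^sup>2" if "k \<in> I" for k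
  proof (rule ccontr)
    assume "\<not> k < d\<^sup>2"
    then have "d\<^sup>2 * ip g g \<le> k * ip g g" using g by (intro mult_right_mono) auto
    also have "\<dots> \<le> ip (L g) (L g)" using that g by (simp add: I_def)
    finally show False using neg by simp
  qed
  have bdd: "bdd_above I" using Id by (auto intro!: bdd_aboveI[of _ "d\<^sup>2"] less_imp_le)
  define k where "k = Sup I"
  have k0: "0 \<le> k" unfolding k_def using I0 bdd by (rule cSup_upper)
  have kI: "k \<in> I"
    unfolding I_def
  proof (intro CollectI conjI ballI k0)
    fix h assume h: "h \<in> V"
    show "k * ip h h \<le> ip (L h) (L h)"
    proof (cases "ip h h = 0")
      case False
      then have p: "ip h h > 0" using ip_nonneg[OF h] by linarith
      have "k \<le> ip (L h) (L h) / ip h h"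
        unfolding k_def using I0 h p by (intro cSup_least) (auto simp: I_def field_simps)
      then show ?thesis using p by (simp add: field_simps)
    qed (use h in simp)
  qed
  define s where "s = sqrt k"
  have s2: "s * s = k" using k0 by (simp add: s_def)
  have "s\<^sup>2 < d\<^sup>2" using Id[OF kI] k0 by (simp add: s_def)
  then have sd: "s < d" using d power2_less_imp_less by blast
  have s0: "0 \<le> s" using k0 by (simp add: s_def)
  obtain e1 where e1: "e1 > 0" "\<And>g. g \<in> V \<Longrightarrow> e1 * ip g g \<le> ip (add (L g) (scl s g)) (add (L g) (scl s g))"
    using below[of s] sd s0 by auto
  obtain e2 where e2: "e2 > 0" "\<And>g. g \<in> V \<Longrightarrow> e2 * ip g g \<le> ip (add (L g) (scl (- s) g)) (add (L g) (scl (- s) g))"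
    using below[of "- s"] sd s0 by auto
  \<comment> \<open>C is L^2 - k: semidefinite because k is admissible, and equal to (L - s) (L + s)
    in norm.\<close>
  define C where "C h = add (L (L h)) (scl (- k) h)" for h
  have C: "self_adjoint C"
    by (auto simp: C_def self_adjoint_def self_adjoint_swap[OF L])
  have Cpos: "0 \<le> ip (C h) h" if "h \<in> V" for h
    using kI that by (auto simp: C_def I_def self_adjoint_swap[OF L])
  have Cle: "ip (C h) h \<le> max M 1 * ip h h" if h: "h \<in> V" for h
  proof -
    have "ip (C h) h \<le> ip (L h) (L h)" using h k0 by (simp add: C_def self_adjoint_swap[OF L])
    also have "\<dots> \<le> M * ip h h" using M h by simp
    also have "\<dots> \<le> max M 1 * ip h h" using h by (intro mult_right_mono) auto
    finally show ?thesis .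
  qed
  have M1: "0 \<le> max M 1" by simp
  have Cge: "e2 * e1 * ip h h \<le> ip (C h) (C h)" if h: "h \<in> V" for h
  proof -
    let ?k = "add (L h) (scl s h)"
    have "e2 * e1 * ip h h \<le> e2 * ip ?k ?k" using e1(2)[OF h] e2(1) by simp
    also have "\<dots> \<le> ip (add (L ?k) (scl (- s) ?k)) (add (L ?k) (scl (- s) ?k))"
      using h by (intro e2(2)) simp
    also have "\<dots> = ip (C h) (C h)"
      using h by (simp add: C_def s2[symmetric] self_adjoint_swap[OF L] algebra_simps)
    finally show ?thesis .
  qed
  \<comment> \<open>By \<open>psd_norm_bound\<close>, |C h|^2 is at most \<open>max M 1\<close>
    times the form of C at h, so this quotient bounds that form from below.\<close>
  define \<eta> where "\<eta> = e2 * e1 / max M 1"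
  have \<eta>: "\<eta> > 0" using e1 e2 by (simp add: \<eta>_def)
  have "k + \<eta> \<in> I"
    unfolding I_def
  proof (intro CollectI conjI ballI)
    fix h assume h: "h \<in> V"
    have "e2 * e1 * ip h h \<le> ip (C h) (C h)" by (rule Cge[OF h])
    also have "\<dots> \<le> max M 1 * ip (C h) h"
      using C h by (intro psd_norm_bound C Cpos Cle M1) (auto simp: self_adjoint_closed)
    finally have "\<eta> * ip h h \<le> ip (C h) h" by (simp add: \<eta>_def field_simps)
    then show "(k + \<eta>) * ip h h \<le> ip (L h) (L h)"
      using h by (simp add: C_def self_adjoint_swap[OF L] algebra_simps)
  qed (use k0 \<eta> in auto)
  then have "k + \<eta> \<le> k" unfolding k_def using bdd by (rule cSup_upper)
  with \<eta> show False by simp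
qed

text \<open>
  The vectors that agree with an element of the range of \<open>I - T\<close> up to norm zero; on them the
  quadratic form of \<open>I - T\<close> is bounded below, by log-convexity of
  \<open>k \<mapsto> \<langle>(I - T)\<^sup>k g, g\<rangle>\<close>.
\<close>

definition in_range_of_complement :: "('v \<Rightarrow> 'v) \<Rightarrow> 'v \<Rightarrow> bool" where
  "in_range_of_complement T z \<longleftrightarrow>
     z \<in> V \<and> (\<exists>w\<in>V. \<forall>h\<in>V. ip z h = ip w h - ip (T w) h)"

section \<open>Self-adjoint contractions: from lower bounds on T - l to inequalities between
  forms\<close>

context
  fixes T :: "'v \<Rightarrow> 'v" and \<delta> :: real
  assumes T: "self_adjoint T" and contraction: "\<And>g. g \<in> V \<Longrightarrow> ip (T g) (T g) \<le> ip g g"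
begin

lemma contraction_form_bound: "g \<in> V \<Longrightarrow> \<bar>ip (T g) g\<bar> \<le> ip g g"
proof -
  assume g: "g \<in> V"
  have "(ip (T g) g)\<^sup>2 \<le> ip (T g) (T g) * ip g g"
    using g T by (intro Cauchy_Schwarz) (auto simp: self_adjoint_closed)
  also have "\<dots> \<le> ip g g * ip g g" using contraction[OF g] g by (intro mult_right_mono) auto
  finally have "\<bar>ip (T g) g\<bar> \<le> \<bar>ip g g\<bar>" by (simp add: abs_le_square_iff power2_eq_square)
  with g show ?thesis by simp
qed

lemma shift_norm_le:
  assumes h: "h \<in> V"
  shows "ip (add (T h) (scl c h)) (add (T h) (scl c h)) \<le> (1 + \<bar>c\<bar>)\<^sup>2 * ip h h"
proof -
  have "c * ip (T h) h \<le> \<bar>c\<bar> * \<bar>ip (T h) h\<bar>" using abs_ge_self[of "c * ip (T h) h"] by (simp add: abs_mult)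
  also have "\<dots> \<le> \<bar>c\<bar> * ip h h" using contraction_form_bound[OF h] by (intro mult_left_mono) auto
  finally have "c * ip (T h) h \<le> \<bar>c\<bar> * ip h h" .
  moreover have "ip (add (T h) (scl c h)) (add (T h) (scl c h)) = ip (T h) (T h) + 2 * (c * ip (T h) h) + c\<^sup>2 * ip h h"
    using h T by (simp add: self_adjoint_closed ip_sym[of h "T h"] power2_eq_square algebra_simps)
  moreover have "(1 + \<bar>c\<bar>)\<^sup>2 * ip h h = ip h h + 2 * (\<bar>c\<bar> * ip h h) + c\<^sup>2 * ip h h"
    by (simp add: power2_sum algebra_simps)
  ultimately show ?thesis using contraction[OF h] by linarith
qed

text \<open>The interval (1 - \<delta>, 1) has centre 1 - \<delta>/2 and radius \<delta>/2. With B =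
  I - T, expanding |(B - \<delta>/2) g|^2 >= (\<delta>/2)^2 |g|^2 cancels the squares of \<delta>/2
  and leaves |B g|^2 >= \<delta> <B g, g>.\<close>

lemma complement_norm_ge_form:
  assumes \<delta>: "0 \<le> \<delta>"
    and below: "\<And>l. 1 - \<delta> < l \<Longrightarrow> l < 1 \<Longrightarrow>
      \<exists>e>0. \<forall>g\<in>V. e * ip g g \<le> ip (add (T g) (scl (- l) g)) (add (T g) (scl (- l) g))"
    and g: "g \<in> V"
  shows "\<delta> * (ip g g - ip (T g) g) \<le> ip g g - 2 * ip (T g) g + ip (T g) (T g)"
proof -
  note Tc [simp] = self_adjoint_closed[OF T] and Tl [simp] = self_adjoint_ip_linear[OF T]
  define L where "L h = add (T h) (scl (- (1 - \<delta> / 2)) h)" for h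
  have L: "self_adjoint L" by (auto simp: L_def self_adjoint_def self_adjoint_swap[OF T])
  have "ip (L h) (L h) \<le> (1 + \<bar>- (1 - \<delta> / 2)\<bar>)\<^sup>2 * ip h h" if "h \<in> V" for h
    unfolding L_def by (rule shift_norm_le[OF that])
  then have "(\<delta> / 2)\<^sup>2 * ip g g \<le> ip (L g) (L g)"
  proof (rule bounded_below_imp_norm_ge[OF L])
    fix t :: real assume "\<bar>t\<bar> < \<delta> / 2"
    then obtain e where e: "e > 0"
      "\<And>g. g \<in> V \<Longrightarrow> e * ip g g \<le> ip (add (T g) (scl (- (1 - \<delta> / 2 - t)) g)) (add (T g) (scl (- (1 - \<delta> / 2 - t)) g))"
      using below[of "1 - \<delta> / 2 - t"] by (auto simp: abs_if split: if_splits)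
    have "ip (add (T g) (scl (- (1 - \<delta> / 2 - t)) g)) (add (T g) (scl (- (1 - \<delta> / 2 - t)) g))
      = ip (add (L g) (scl t g)) (add (L g) (scl t g))" if "g \<in> V" for g
      using that by (simp add: L_def self_adjoint_swap[OF T] algebra_simps) (simp add: field_simps)
    with e show "\<exists>e>0. \<forall>g\<in>V. e * ip g g \<le> ip (add (L g) (scl t g)) (add (L g) (scl t g))" by auto
  qed (use \<delta> g in auto)
  moreover have "ip (L g) (L g) = ip g g - 2 * ip (T g) g + ip (T g) (T g) - \<delta> * (ip g g - ip (T g) g) + (\<delta> / 2)\<^sup>2 * ip g g"
    using g by (simp add: L_def ip_sym[of g "T g"] power2_eq_square algebra_simps) (simp add: field_simps)
  ultimately show ?thesis by linarith
qed

text \<open>The half-line below -\<mu> is exhausted by intervals with centre -(\<mu> + d) and radius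
  d. The norm inequality for each of them becomes linear in d once the d^2 terms cancel, and letting
  d grow leaves the form bound.\<close>

lemma form_ge_of_bounded_below:
  assumes below: "\<And>l. l < - \<mu> \<Longrightarrow>
      \<exists>e>0. \<forall>g\<in>V. e * ip g g \<le> ip (add (T g) (scl (- l) g)) (add (T g) (scl (- l) g))"
    and g: "g \<in> V"
  shows "- \<mu> * ip g g \<le> ip (T g) g"
proof -
  note Tc [simp] = self_adjoint_closed[OF T] and Tl [simp] = self_adjoint_ip_linear[OF T]
  have ge: "d\<^sup>2 * ip g g \<le> ip (T g) (T g) + 2 * (\<mu> + d) * ip (T g) g + (\<mu> + d)\<^sup>2 * ip g g" if d: "d \<ge> 0" for d
  proof -
    define L where "L h = add (T h) (scl (\<mu> + d) h)" for h
    have L: "self_adjoint L" by (auto simp: L_def self_adjoint_def self_adjoint_swap[OF T])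
    have "ip (L h) (L h) \<le> (1 + \<bar>\<mu> + d\<bar>)\<^sup>2 * ip h h" if "h \<in> V" for h
      unfolding L_def by (rule shift_norm_le[OF that])
    then have "d\<^sup>2 * ip g g \<le> ip (L g) (L g)"
    proof (rule bounded_below_imp_norm_ge[OF L])
      fix t :: real assume "\<bar>t\<bar> < d"
      then obtain e where e: "e > 0"
        "\<And>g. g \<in> V \<Longrightarrow> e * ip g g \<le> ip (add (T g) (scl (\<mu> + d + t) g)) (add (T g) (scl (\<mu> + d + t) g))"
        using below[of "- (\<mu> + d + t)"] \<open>\<bar>t\<bar> < d\<close> unfolding minus_minus abs_less_iff by auto
      have "ip (add (T g) (scl (\<mu> + d + t) g)) (add (T g) (scl (\<mu> + d + t) g))
        = ip (add (L g) (scl t g)) (add (L g) (scl t g))" if "g \<in> V" for g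
        using that by (simp add: L_def self_adjoint_swap[OF T] algebra_simps)
      with e show "\<exists>e>0. \<forall>g\<in>V. e * ip g g \<le> ip (add (L g) (scl t g)) (add (L g) (scl t g))" by auto
    qed (use d g in auto)
    also have "ip (L g) (L g) = ip (T g) (T g) + 2 * (\<mu> + d) * ip (T g) g + (\<mu> + d)\<^sup>2 * ip g g"
      using g by (simp add: L_def ip_sym[of g "T g"] power2_eq_square algebra_simps)
    finally show ?thesis .
  qed
  define a where "a = ip (T g) g + \<mu> * ip g g"
  define b where "b = ip (T g) (T g) + 2 * \<mu> * ip (T g) g + \<mu>\<^sup>2 * ip g g"
  \<comment> \<open>A function that is affine in d and nonnegative for all d >= 0 has nonnegative
    slope.\<close>
  have lin: "0 \<le> b + d * (2 * a)" if "d \<ge> 0" for d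
    using ge[OF that] by (simp add: a_def b_def power2_eq_square algebra_simps)
  have "0 \<le> a"
  proof (rule ccontr)
    assume "\<not> 0 \<le> a"
    then have n: "a < 0" by simp
    have "0 \<le> b + ((\<bar>b\<bar> + 1) / (- 2 * a)) * (2 * a)" using n by (intro lin divide_nonneg_pos) auto
    also have "\<dots> = b - (\<bar>b\<bar> + 1)" using n by (simp add: field_simps)
    finally show False by simp
  qed
  then show ?thesis by (simp add: a_def)
qed

context
  assumes \<delta>: "0 \<le> \<delta>" and gap: "\<And>g. g \<in> V \<Longrightarrow>
    \<delta> * (ip g g - ip (T g) g) \<le> ip g g - 2 * ip (T g) g + ip (T g) (T g)"
begin

lemma form_ge_on_range:
  assumes "in_range_of_complement T z"
  shows "\<delta> * ip z z \<le> ip z z - ip (T z) z"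
proof -
  note Tc [simp] = self_adjoint_closed[OF T] and Tl [simp] = self_adjoint_ip_linear[OF T]
  obtain w where z: "z \<in> V" and w: "w \<in> V" and zw: "\<And>h. h \<in> V \<Longrightarrow> ip z h = ip w h - ip (T w) h"
    using assms by (auto simp: in_range_of_complement_def)
  define B where "B h = add h (scl (- 1) (T h))" for h
  have B: "self_adjoint B" by (auto simp: B_def self_adjoint_def self_adjoint_swap[OF T])
  note Bc [simp] = self_adjoint_closed[OF B]
  have Bpos: "0 \<le> ip (B h) h" if "h \<in> V" for h
    using that contraction_form_bound[OF that] by (simp add: B_def)
  \<comment> \<open>z and B w agree only in pairings, so z is replaced by B w in one argument of the
    form at a time.\<close>
  have zB: "ip z h = ip (B w) h" if "h \<in> V" for h using zw[OF that] w that by (simp add: B_def)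
  have a2: "ip z z = ip (B w) (B w)" using zB[of z] zB[of "B w"] ip_sym[of "B w" z] z w by simp
  have "ip (B z) z = ip z (B z)" using z by (intro ip_sym) auto
  also have "\<dots> = ip (B (B w)) z" using zB[of "B z"] z w by (simp add: self_adjoint_swap[OF B])
  also have "\<dots> = ip (B (B w)) (B w)" using zB[of "B (B w)"] ip_sym[of z "B (B w)"] ip_sym[of "B w" "B (B w)"] z w by simp
  finally have a3: "ip (B z) z = ip (B (B w)) (B w)" .
  have "ip (B w) (B w) * ip (B w) (B w) \<le> ip (B w) w * ip (B (B w)) (B w)"
    using Cauchy_Schwarz_form[OF B Bpos, of w "B w"] w by (simp add: power2_eq_square)
  moreover have "\<delta> * ip (B w) w \<le> ip (B w) (B w)"
    using gap[OF w] w by (simp add: B_def ip_sym[of w "T w"] algebra_simps)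
  moreover have "0 \<le> ip (B w) w" "0 \<le> ip (B (B w)) (B w)" using w by (auto intro: Bpos)
  moreover have "0 \<le> ip (B w) (B w)" using w by simp
  ultimately have "\<delta> * ip (B w) (B w) \<le> ip (B (B w)) (B w)"
    using \<delta> by (rule log_convex_ratio)
  with a2 a3 z show ?thesis by (simp add: B_def)
qed

text \<open>The lazy version of a kernel. Averaging with the identity makes the form nonnegative, as
  \<open>psd_norm_bound\<close> requires, so that spectrum of T near -1 cannot spoil geometric
  convergence.\<close>

definition lazy :: "'v \<Rightarrow> 'v" where
  "lazy g = add (scl (1/2) g) (scl (1/2) (T g))"

lemma lazy_closed [simp]: "g \<in> V \<Longrightarrow> lazy g \<in> V"
  using T by (simp add: lazy_def self_adjoint_closed)

lemma self_adjoint_lazy: "self_adjoint lazy"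
  using T by (auto simp: lazy_def self_adjoint_closed self_adjoint_swap[OF T] self_adjoint_def[of lazy])

lemma lazy_form_nonneg: "g \<in> V \<Longrightarrow> 0 \<le> ip (lazy g) g"
  using contraction_form_bound[of g] T by (simp add: lazy_def self_adjoint_closed)

lemma in_range_lazy:
  assumes "in_range_of_complement T z"
  shows "in_range_of_complement T (lazy z)"
proof -
  note Tc [simp] = self_adjoint_closed[OF T] and Tl [simp] = self_adjoint_ip_linear[OF T]
  obtain w where z: "z \<in> V" and w: "w \<in> V" and zw: "\<And>h. h \<in> V \<Longrightarrow> ip z h = ip w h - ip (T w) h"
    using assms by (auto simp: in_range_of_complement_def)
  have "ip (lazy z) h = ip (lazy w) h - ip (T (lazy w)) h" if h: "h \<in> V" for h
    using h z w by (simp add: lazy_def zw self_adjoint_swap[OF T] algebra_simps)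
  then show ?thesis using z w by (auto simp: in_range_of_complement_def)
qed

text \<open>On the range the form of I - T is at least \<delta>, so the form of \<open>lazy\<close>
  is at most 1 - \<delta>/2. The range is invariant under \<open>lazy\<close>, hence
  \<open>psd_norm_bound\<close> turns this into a bound on the norm.\<close>

lemma lazy_contracts_range:
  assumes z: "in_range_of_complement T z" and \<delta>1: "\<delta> \<le> 1"
  shows "ip (lazy z) (lazy z) \<le> (1 - \<delta> / 2)\<^sup>2 * ip z z"
proof -
  note Tc [simp] = self_adjoint_closed[OF T] and Tl [simp] = self_adjoint_ip_linear[OF T]
  have le: "ip (lazy y) y \<le> (1 - \<delta> / 2) * ip y y" if y: "in_range_of_complement T y" for y
    using form_ge_on_range[OF y] y by (simp add: lazy_def in_range_of_complement_def algebra_simps)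
  have zV: "z \<in> V" using z by (simp add: in_range_of_complement_def)
  have "ip (lazy z) (lazy z) \<le> (1 - \<delta> / 2) * ip (lazy z) z"
    using \<delta>1 zV by (intro psd_norm_bound self_adjoint_lazy lazy_form_nonneg le in_range_lazy z) auto
  also have "\<dots> \<le> (1 - \<delta> / 2) * ((1 - \<delta> / 2) * ip z z)"
    using \<delta>1 by (intro mult_left_mono le z) auto
  finally show ?thesis by (simp add: power2_eq_square)
qed

end
end
end

section \<open>Real square integrable functions and reversible kernels\<close>

text \<open>Forms and order arguments live on real functions; complex \<open>L2\<close> is entered
  only for resolvents, eigenspaces and the inverse that defines the asymptotic variance.\<close>

definition real_L2 :: "'a measure \<Rightarrow> ('a \<Rightarrow> real) set" where
  "real_L2 M = {f \<in> borel_measurable M. integrable M (\<lambda>x. (f x)\<^sup>2)}"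

definition real_ip :: "'a measure \<Rightarrow> ('a \<Rightarrow> real) \<Rightarrow> ('a \<Rightarrow> real) \<Rightarrow> real" where
  "real_ip M f g = (\<integral>x. f x * g x \<partial>M)"

lemma real_L2_measurable [measurable_dest]: "f \<in> real_L2 M \<Longrightarrow> f \<in> borel_measurable M"
  by (simp add: real_L2_def)

lemma real_L2_integrable_power2: "f \<in> real_L2 M \<Longrightarrow> integrable M (\<lambda>x. (f x)\<^sup>2)"
  by (simp add: real_L2_def)

lemma real_L2_integrable_mult:
  assumes f: "f \<in> real_L2 M" and g: "g \<in> real_L2 M"
  shows "integrable M (\<lambda>x. f x * g x)"
proof (rule Bochner_Integration.integrable_bound)
  show "integrable M (\<lambda>x. (f x)\<^sup>2 + (g x)\<^sup>2)" using f g by (simp add: real_L2_def)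
  show "(\<lambda>x. f x * g x) \<in> borel_measurable M" using f g by measurable
  have "\<bar>a * b\<bar> \<le> a\<^sup>2 + b\<^sup>2" for a b :: real
  proof -
    have "2 * (\<bar>a\<bar> * \<bar>b\<bar>) \<le> \<bar>a\<bar>\<^sup>2 + \<bar>b\<bar>\<^sup>2" using sum_squares_bound[of "\<bar>a\<bar>" "\<bar>b\<bar>"] by simp
    moreover have "0 \<le> \<bar>a\<bar> * \<bar>b\<bar>" by simp
    ultimately show ?thesis unfolding abs_mult power2_abs by linarith
  qed
  then show "AE x in M. norm (f x * g x) \<le> norm ((f x)\<^sup>2 + (g x)\<^sup>2)" by simp
qed

lemma real_L2_scale: "f \<in> real_L2 M \<Longrightarrow> (\<lambda>x. c * f x) \<in> real_L2 M"
  by (auto simp: real_L2_def power_mult_distrib)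

lemma real_L2_add: "f \<in> real_L2 M \<Longrightarrow> g \<in> real_L2 M \<Longrightarrow> (\<lambda>x. f x + g x) \<in> real_L2 M"
  using real_L2_integrable_mult[of f M g] by (auto simp: real_L2_def power2_sum mult.assoc)

lemma real_L2_diff: "f \<in> real_L2 M \<Longrightarrow> g \<in> real_L2 M \<Longrightarrow> (\<lambda>x. f x - g x) \<in> real_L2 M"
  using real_L2_add[of f M "\<lambda>x. (-1) * g x"] real_L2_scale[of g M "-1"] by simp

lemma real_L2_abs: "f \<in> real_L2 M \<Longrightarrow> (\<lambda>x. \<bar>f x\<bar>) \<in> real_L2 M"
  by (auto simp: real_L2_def)

lemma real_L2_bound:
  assumes "g \<in> real_L2 M" "f \<in> borel_measurable M" "\<And>x. \<bar>f x\<bar> \<le> \<bar>g x\<bar>"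
  shows "f \<in> real_L2 M"
proof -
  have "integrable M (\<lambda>x. (f x)\<^sup>2)"
    by (rule Bochner_Integration.integrable_bound[OF real_L2_integrable_power2[OF assms(1)]])
       (use assms in \<open>auto simp: abs_le_square_iff\<close>)
  then show ?thesis using assms by (simp add: real_L2_def)
qed

lemma real_ip_commute: "real_ip M f g = real_ip M g f"
  by (simp add: real_ip_def mult.commute)

lemma semi_inner_space_real_L2:
  "semi_inner_space (real_L2 M) (\<lambda>f g x. f x + g x) (\<lambda>c f x. c * f x) (real_ip M)"
proof
  fix f g h assume "f \<in> real_L2 M" "g \<in> real_L2 M" "h \<in> real_L2 M"
  then show "real_ip M (\<lambda>x. f x + g x) h = real_ip M f h + real_ip M g h"
    by (simp add: real_ip_def ring_distribs real_L2_integrable_mult)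
next
  fix f g :: "'a \<Rightarrow> real"
  show "real_ip M f g = real_ip M g f" by (rule real_ip_commute)
qed (auto simp: real_L2_add real_L2_scale real_ip_def mult.assoc)

interpretation real_L2: semi_inner_space "real_L2 M" "\<lambda>f g x. f x + g x" "\<lambda>c f x. c * f x" "real_ip M" for M
  by (rule semi_inner_space_real_L2)

lemma real_ip_diff_left:
  "f \<in> real_L2 M \<Longrightarrow> g \<in> real_L2 M \<Longrightarrow> h \<in> real_L2 M \<Longrightarrow> real_ip M (\<lambda>x. f x - g x) h = real_ip M f h - real_ip M g h"
  by (simp add: real_ip_def left_diff_distrib real_L2_integrable_mult)

lemma real_ip_diff_right:
  "f \<in> real_L2 M \<Longrightarrow> g \<in> real_L2 M \<Longrightarrow> h \<in> real_L2 M \<Longrightarrow> real_ip M h (\<lambda>x. f x - g x) = real_ip M h f - real_ip M h g"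
  by (simp add: real_ip_def right_diff_distrib real_L2_integrable_mult)

lemma real_ip_cong_AE:
  assumes "AE x in M. f x = f' x" "AE x in M. g x = g' x"
    "f \<in> borel_measurable M" "f' \<in> borel_measurable M" "g \<in> borel_measurable M" "g' \<in> borel_measurable M"
  shows "real_ip M f g = real_ip M f' g'"
  unfolding real_ip_def by (rule integral_cong_AE) (use assms in \<open>auto elim: AE_mp\<close>)

lemma (in prob_space) real_L2_const: "(\<lambda>x. c) \<in> real_L2 M"
  by (simp add: real_L2_def)

lemma (in prob_space) real_L2_integrable: "f \<in> real_L2 M \<Longrightarrow> integrable M f"
  using real_L2_integrable_mult[OF _ real_L2_const, of f 1] by simp

lemma (in prob_space) expectation_power2_le:
  assumes "f \<in> real_L2 M"
  shows "(expectation f)\<^sup>2 \<le> expectation (\<lambda>x. (f x)\<^sup>2)"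
  using real_L2.Cauchy_Schwarz[OF assms real_L2_const, of 1]
  by (simp add: real_ip_def power2_eq_square prob_space)

section \<open>A reversible kernel as a self-adjoint contraction of real L2\<close>

locale reversible_chain =
  fixes P :: "'a::topological_space \<Rightarrow> 'a measure" and \<pi> :: "'a measure"
  assumes kernel: "P \<in> borel \<rightarrow>\<^sub>M prob_algebra borel"
    and stationary: "stationary_distribution P \<pi>"
    and reversible: "reversible_kernel P \<pi>"
begin

lemma sets_pi [measurable_cong, simp]: "sets \<pi> = sets borel"
  using stationary by (simp add: stationary_distribution_def space_prob_algebra)

lemma space_pi [simp]: "space \<pi> = UNIV"
  using sets_eq_imp_space_eq[OF sets_pi] by simp

sublocale pi: prob_space \<pi>
  using stationary by (simp add: stationary_distribution_def space_prob_algebra)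

lemma kernel_in: "P x \<in> space (prob_algebra borel)"
  using kernel by (rule measurable_space) simp

lemma sets_kernel [measurable_cong, simp]: "sets (P x) = sets borel"
  using kernel_in[of x] by (simp add: space_prob_algebra)

lemma space_kernel [simp]: "space (P x) = UNIV"
  using sets_eq_imp_space_eq[OF sets_kernel] by simp

lemma prob_space_kernel: "prob_space (P x)"
  using kernel_in[of x] by (simp add: space_prob_algebra)

lemma kernel_subprob [measurable]: "P \<in> borel \<rightarrow>\<^sub>M subprob_algebra borel"
  using kernel by (rule measurable_prob_algebraD)

lemma kernel_subprob' : "sets M = sets borel \<Longrightarrow> P \<in> M \<rightarrow>\<^sub>M subprob_algebra borel"
  using kernel_subprob by (simp cong: measurable_cong_sets)

lemma nn_integral_kernel_measurable [measurable]:
  "f \<in> borel_measurable borel \<Longrightarrow> (\<lambda>x. \<integral>\<^sup>+y. f y \<partial>P x) \<in> borel_measurable borel"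
  by (rule measurable_compose[OF kernel_subprob nn_integral_measurable_subprob_algebra])

lemma integral_kernel_measurable [measurable]:
  fixes f :: "'a \<Rightarrow> 'b::{banach, second_countable_topology}"
  shows "f \<in> borel_measurable borel \<Longrightarrow> (\<lambda>x. \<integral>y. f y \<partial>P x) \<in> borel_measurable borel"
  by (rule measurable_compose[OF kernel_subprob integral_measurable_subprob_algebra])

lemma nn_integral_stationary:
  assumes [measurable]: "f \<in> borel_measurable borel"
  shows "(\<integral>\<^sup>+x. (\<integral>\<^sup>+y. f y \<partial>P x) \<partial>\<pi>) = (\<integral>\<^sup>+x. f x \<partial>\<pi>)"
  using nn_integral_bind[OF assms kernel_subprob'[OF sets_pi]] stationary
  by (simp add: stationary_distribution_def)

text \<open>Detailed balance is given for pairs of sets. It is extended to functions one argument at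
  a time, each time as an equality of two measures against which the next function can be
  integrated.\<close>

lemma nn_integral_kernel_swap:
  assumes f [measurable]: "f \<in> borel_measurable borel" and g [measurable]: "g \<in> borel_measurable borel"
  shows "(\<integral>\<^sup>+x. f x * (\<integral>\<^sup>+y. g y \<partial>P x) \<partial>\<pi>) = (\<integral>\<^sup>+x. g x * (\<integral>\<^sup>+y. f y \<partial>P x) \<partial>\<pi>)"
proof -
  have swap1: "(\<integral>\<^sup>+x. indicator A x * (\<integral>\<^sup>+y. h y \<partial>P x) \<partial>\<pi>) = (\<integral>\<^sup>+x. h x * emeasure (P x) A \<partial>\<pi>)"
    if A [measurable]: "A \<in> sets borel" and h [measurable]: "h \<in> borel_measurable borel" for A h
  proof -
    have eq: "density \<pi> (indicator A) \<bind> P = density \<pi> (\<lambda>x. emeasure (P x) A)"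
    proof (rule measure_eqI)
      show s: "sets (density \<pi> (indicator A) \<bind> P) = sets (density \<pi> (\<lambda>x. emeasure (P x) A))"
        by (subst sets_bind) auto
      fix B assume "B \<in> sets (density \<pi> (indicator A) \<bind> P)"
      then have B [measurable]: "B \<in> sets borel" by (simp add: s)
      have "emeasure (density \<pi> (indicator A) \<bind> P) B = (\<integral>\<^sup>+x. emeasure (P x) B \<partial>density \<pi> (indicator A))"
        by (rule emeasure_bind) (auto intro: kernel_subprob')
      also have "\<dots> = (\<integral>\<^sup>+x. indicator A x * emeasure (P x) B \<partial>\<pi>)"
        by (subst nn_integral_density) auto
      also have "\<dots> = (\<integral>\<^sup>+x. emeasure (P x) A * indicator B x \<partial>\<pi>)"
        using reversible A B by (simp add: reversible_kernel_def mult.commute)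
      also have "\<dots> = emeasure (density \<pi> (\<lambda>x. emeasure (P x) A)) B"
        by (subst emeasure_density) auto
      finally show "emeasure (density \<pi> (indicator A) \<bind> P) B = emeasure (density \<pi> (\<lambda>x. emeasure (P x) A)) B" .
    qed
    have "(\<integral>\<^sup>+x. indicator A x * (\<integral>\<^sup>+y. h y \<partial>P x) \<partial>\<pi>) = (\<integral>\<^sup>+x. (\<integral>\<^sup>+y. h y \<partial>P x) \<partial>density \<pi> (indicator A))"
      by (subst nn_integral_density) auto
    also have "\<dots> = (\<integral>\<^sup>+x. h x \<partial>(density \<pi> (indicator A) \<bind> P))"
      by (rule nn_integral_bind[symmetric]) (auto intro: kernel_subprob')
    also have "\<dots> = (\<integral>\<^sup>+x. h x * emeasure (P x) A \<partial>\<pi>)"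
      unfolding eq by (subst nn_integral_density) (auto simp: mult.commute)
    finally show ?thesis .
  qed
  \<comment> \<open>Second extension: \<open>swap1\<close> has a set in one slot and a function in
    the other, so it identifies these two measures on every set.\<close>
  have eq: "density \<pi> (\<lambda>x. \<integral>\<^sup>+y. g y \<partial>P x) = density \<pi> g \<bind> P"
  proof (rule measure_eqI)
    show s: "sets (density \<pi> (\<lambda>x. \<integral>\<^sup>+y. g y \<partial>P x)) = sets (density \<pi> g \<bind> P)"
      by (subst sets_bind) auto
    fix A assume "A \<in> sets (density \<pi> (\<lambda>x. \<integral>\<^sup>+y. g y \<partial>P x))"
    then have A [measurable]: "A \<in> sets borel" by simp
    have "emeasure (density \<pi> g \<bind> P) A = (\<integral>\<^sup>+x. emeasure (P x) A \<partial>density \<pi> g)"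
      by (rule emeasure_bind) (auto intro: kernel_subprob')
    also have "\<dots> = (\<integral>\<^sup>+x. g x * emeasure (P x) A \<partial>\<pi>)"
      by (subst nn_integral_density) auto
    also have "\<dots> = (\<integral>\<^sup>+x. indicator A x * (\<integral>\<^sup>+y. g y \<partial>P x) \<partial>\<pi>)" by (rule swap1[symmetric]) auto
    also have "\<dots> = emeasure (density \<pi> (\<lambda>x. \<integral>\<^sup>+y. g y \<partial>P x)) A"
      by (subst emeasure_density) (auto simp: mult.commute)
    finally show "emeasure (density \<pi> (\<lambda>x. \<integral>\<^sup>+y. g y \<partial>P x)) A = emeasure (density \<pi> g \<bind> P) A" by simp
  qed
  have "(\<integral>\<^sup>+x. f x * (\<integral>\<^sup>+y. g y \<partial>P x) \<partial>\<pi>) = (\<integral>\<^sup>+x. f x \<partial>density \<pi> (\<lambda>x. \<integral>\<^sup>+y. g y \<partial>P x))"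
    by (subst nn_integral_density) (auto simp: mult.commute)
  also have "\<dots> = (\<integral>\<^sup>+x. (\<integral>\<^sup>+y. f y \<partial>P x) \<partial>density \<pi> g)"
    unfolding eq by (rule nn_integral_bind) (auto intro: kernel_subprob')
  also have "\<dots> = (\<integral>\<^sup>+x. g x * (\<integral>\<^sup>+y. f y \<partial>P x) \<partial>\<pi>)"
    by (subst nn_integral_density) auto
  finally show ?thesis .
qed

definition transition :: "('a \<Rightarrow> real) \<Rightarrow> 'a \<Rightarrow> real" where
  "transition f x = (\<integral>y. f y \<partial>P x)"

lemma transition_measurable [measurable]:
  "f \<in> borel_measurable borel \<Longrightarrow> transition f \<in> borel_measurable borel"
  unfolding transition_def[abs_def] by measurable

lemma real_L2_borel [measurable_dest]: "f \<in> real_L2 \<pi> \<Longrightarrow> f \<in> borel_measurable borel"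
  using real_L2_measurable[of f \<pi>] by (simp cong: measurable_cong_sets)

text \<open>The Bochner integral is 0 for functions that are not integrable, so
  \<open>transition\<close> is additive only at points x where the functions are integrable under
  \<open>P x\<close>. Stationarity confines the exceptional points to a null set.\<close>

lemma AE_real_L2_kernel:
  assumes f: "f \<in> real_L2 \<pi>"
  shows "AE x in \<pi>. f \<in> real_L2 (P x)"
proof -
  have [measurable]: "f \<in> borel_measurable borel" using f by measurable
  have "(\<integral>\<^sup>+x. (\<integral>\<^sup>+y. ennreal ((f y)\<^sup>2) \<partial>P x) \<partial>\<pi>) = (\<integral>\<^sup>+x. ennreal ((f x)\<^sup>2) \<partial>\<pi>)"
    by (rule nn_integral_stationary) simp
  also have "\<dots> \<noteq> \<infinity>" using f by (simp add: real_L2_def nn_integral_eq_integral)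
  finally have "AE x in \<pi>. (\<integral>\<^sup>+y. ennreal ((f y)\<^sup>2) \<partial>P x) \<noteq> \<infinity>"
    by (intro nn_integral_PInf_AE) auto
  then show ?thesis
    by eventually_elim (auto simp: real_L2_def integrable_iff_bounded less_top)
qed

text \<open>Jensen's inequality under each \<open>P x\<close>, then stationarity.\<close>

lemma transition_real_L2:
  assumes f: "f \<in> real_L2 \<pi>"
  shows "transition f \<in> real_L2 \<pi>" "real_ip \<pi> (transition f) (transition f) \<le> real_ip \<pi> f f"
proof -
  have [measurable]: "f \<in> borel_measurable borel" using f by measurable
  have "(\<integral>\<^sup>+x. ennreal ((transition f x)\<^sup>2) \<partial>\<pi>) \<le> (\<integral>\<^sup>+x. (\<integral>\<^sup>+y. ennreal ((f y)\<^sup>2) \<partial>P x) \<partial>\<pi>)"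
  proof (rule nn_integral_mono_AE)
    show "AE x in \<pi>. ennreal ((transition f x)\<^sup>2) \<le> (\<integral>\<^sup>+y. ennreal ((f y)\<^sup>2) \<partial>P x)"
      using AE_real_L2_kernel[OF f]
    proof eventually_elim
      case (elim x)
      then show ?case
        using prob_space.expectation_power2_le[OF prob_space_kernel elim]
        by (simp add: transition_def nn_integral_eq_integral real_L2_integrable_power2 ennreal_leI)
    qed
  qed
  also have "\<dots> = (\<integral>\<^sup>+x. ennreal ((f x)\<^sup>2) \<partial>\<pi>)" by (rule nn_integral_stationary) simp
  also have "\<dots> = ennreal (\<integral>x. (f x)\<^sup>2 \<partial>\<pi>)"
    using f by (simp add: nn_integral_eq_integral real_L2_integrable_power2)
  finally have le: "(\<integral>\<^sup>+x. ennreal ((transition f x)\<^sup>2) \<partial>\<pi>) \<le> ennreal (\<integral>x. (f x)\<^sup>2 \<partial>\<pi>)" .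
  then have "integrable \<pi> (\<lambda>x. (transition f x)\<^sup>2)"
    by (intro integrableI_bounded) (auto simp: le_less_trans)
  then show "transition f \<in> real_L2 \<pi>" by (simp add: real_L2_def)
  have "(\<integral>x. (transition f x)\<^sup>2 \<partial>\<pi>) \<le> (\<integral>x. (f x)\<^sup>2 \<partial>\<pi>)"
    using le by (subst integral_eq_nn_integral) (auto intro!: enn2real_leI)
  then show "real_ip \<pi> (transition f) (transition f) \<le> real_ip \<pi> f f"
    by (simp add: real_ip_def power2_eq_square)
qed

lemma transition_swap_nonneg:
  assumes f: "f \<in> real_L2 \<pi>" "\<And>x. 0 \<le> f x" and g: "g \<in> real_L2 \<pi>" "\<And>x. 0 \<le> g x"
  shows "real_ip \<pi> (transition f) g = real_ip \<pi> f (transition g)"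
proof -
  have [measurable]: "f \<in> borel_measurable borel" "g \<in> borel_measurable borel" using f g by measurable
  have *: "(\<integral>\<^sup>+x. ennreal (a x * transition b x) \<partial>\<pi>) = (\<integral>\<^sup>+x. ennreal (a x) * (\<integral>\<^sup>+y. ennreal (b y) \<partial>P x) \<partial>\<pi>)"
    if "b \<in> real_L2 \<pi>" "\<And>x. 0 \<le> a x" "\<And>x. 0 \<le> b x" for a b
  proof (rule nn_integral_cong_AE)
    show "AE x in \<pi>. ennreal (a x * transition b x) = ennreal (a x) * (\<integral>\<^sup>+y. ennreal (b y) \<partial>P x)"
      using AE_real_L2_kernel[OF that(1)]
    proof eventually_elim
      case (elim x)
      then show ?case
        using that prob_space.real_L2_integrable[OF prob_space_kernel elim]
        by (simp add: transition_def nn_integral_eq_integral ennreal_mult integral_nonneg_AE)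
    qed
  qed
  have pos: "0 \<le> transition a x" if "\<And>x. 0 \<le> a x" for a x
    using that by (simp add: transition_def)
  have "real_ip \<pi> f (transition g) = enn2real (\<integral>\<^sup>+x. ennreal (f x * transition g x) \<partial>\<pi>)"
    unfolding real_ip_def using f g pos by (intro integral_eq_nn_integral) auto
  also have "\<dots> = enn2real (\<integral>\<^sup>+x. ennreal (g x * transition f x) \<partial>\<pi>)"
    using f g by (simp add: * nn_integral_kernel_swap[of "\<lambda>x. ennreal (f x)"])
  also have "\<dots> = real_ip \<pi> g (transition f)"
    unfolding real_ip_def using f g pos by (intro integral_eq_nn_integral[symmetric]) auto
  finally show ?thesis by (simp add: real_ip_commute)
qed

lemma AE_transition_diff:
  assumes "f \<in> real_L2 \<pi>" "g \<in> real_L2 \<pi>"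
  shows "AE x in \<pi>. transition (\<lambda>x. f x - g x) x = transition f x - transition g x"
  using AE_real_L2_kernel[OF assms(1)] AE_real_L2_kernel[OF assms(2)]
  by eventually_elim (simp add: transition_def prob_space.real_L2_integrable[OF prob_space_kernel])

lemma transition_scale: "transition (\<lambda>x. c * f x) = (\<lambda>x. c * transition f x)"
  by (simp add: transition_def[abs_def])

lemma transition_const [simp]: "transition (\<lambda>x. c) = (\<lambda>x. c)"
  using prob_space.prob_space[OF prob_space_kernel] by (simp add: transition_def[abs_def])

text \<open>The symmetry of nonnegative integrals covers nonnegative functions; splitting both
  arguments into positive part \<open>p\<close> and negative part \<open>m\<close> gives four such
  cases.\<close>

lemma self_adjoint_transition: "real_L2.self_adjoint \<pi> transition"
  unfolding real_L2.self_adjoint_def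
proof (intro conjI ballI transition_real_L2)
  fix f g assume f: "f \<in> real_L2 \<pi>" and g: "g \<in> real_L2 \<pi>"
  define p where "p h x = (\<bar>h x\<bar> + h x) / 2" for h :: "'a \<Rightarrow> real" and x
  define m where "m h x = (\<bar>h x\<bar> - h x) / 2" for h :: "'a \<Rightarrow> real" and x
  have pm: "p h \<in> real_L2 \<pi>" "m h \<in> real_L2 \<pi>" "\<And>x. 0 \<le> p h x" "\<And>x. 0 \<le> m h x" "(\<lambda>x. p h x - m h x) = h"
    if "h \<in> real_L2 \<pi>" for h
  proof -
    have "(\<lambda>x. (1/2) * (\<bar>h x\<bar> + h x)) \<in> real_L2 \<pi>" "(\<lambda>x. (1/2) * (\<bar>h x\<bar> - h x)) \<in> real_L2 \<pi>"
      using that by (intro real_L2_scale real_L2_add real_L2_diff real_L2_abs; simp)+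
    then show "p h \<in> real_L2 \<pi>" "m h \<in> real_L2 \<pi>" by (simp_all add: p_def[abs_def] m_def[abs_def])
  qed (auto simp: p_def m_def field_simps)
  have split: "real_ip \<pi> (transition a) b =
      real_ip \<pi> (transition (p a)) (p b) - real_ip \<pi> (transition (p a)) (m b)
      - real_ip \<pi> (transition (m a)) (p b) + real_ip \<pi> (transition (m a)) (m b)"
    if a: "a \<in> real_L2 \<pi>" and b: "b \<in> real_L2 \<pi>" for a b
  proof -
    have "real_ip \<pi> (transition a) b = real_ip \<pi> (\<lambda>x. transition (p a) x - transition (m a) x) b"
      using AE_transition_diff[OF pm(1,2)[OF a]] pm(1,2,5)[OF a] a b transition_real_L2
      by (intro real_ip_cong_AE) auto
    also have "\<dots> = real_ip \<pi> (\<lambda>x. transition (p a) x - transition (m a) x) (\<lambda>x. p b x - m b x)"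
      using pm(5)[OF b] by simp
    also have "\<dots> = real_ip \<pi> (transition (p a)) (p b) - real_ip \<pi> (transition (p a)) (m b)
      - real_ip \<pi> (transition (m a)) (p b) + real_ip \<pi> (transition (m a)) (m b)"
      using pm(1,2)[OF a] pm(1,2)[OF b]
      by (simp add: real_ip_diff_left real_ip_diff_right real_L2_diff transition_real_L2)
    finally show ?thesis .
  qed
  show "real_ip \<pi> (transition f) g = real_ip \<pi> f (transition g)"
    unfolding real_ip_commute[of \<pi> f] split[OF f g] split[OF g f]
    by (simp add: transition_swap_nonneg[OF pm(1)[OF f] pm(3)[OF f] pm(1)[OF g] pm(3)[OF g]]
        transition_swap_nonneg[OF pm(1)[OF f] pm(3)[OF f] pm(2)[OF g] pm(4)[OF g]]
        transition_swap_nonneg[OF pm(2)[OF f] pm(4)[OF f] pm(1)[OF g] pm(3)[OF g]]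
        transition_swap_nonneg[OF pm(2)[OF f] pm(4)[OF f] pm(2)[OF g] pm(4)[OF g]]
        real_ip_commute[of \<pi> "p f"] real_ip_commute[of \<pi> "m f"])
qed

end

section \<open>Complex square integrable functions\<close>

lemma (in semi_inner_space) norm_triangle:
  assumes f: "f \<in> V" and g: "g \<in> V"
  shows "sqrt (ip (add f g) (add f g)) \<le> sqrt (ip f f) + sqrt (ip g g)"
proof (rule real_le_lsqrt)
  have "ip f g \<le> sqrt (ip f f * ip g g)"
    using Cauchy_Schwarz[OF f g] by (rule real_le_rsqrt)
  then show "ip (add f g) (add f g) \<le> (sqrt (ip f f) + sqrt (ip g g))\<^sup>2"
    using f g by (simp add: power2_sum real_sqrt_mult ip_sym[of g f])
qed (use f g in auto)

text \<open>The weight \<open>W = (\<Sum>k. \<parallel>u\<^sub>k\<parallel>\<^sup>2 / q\<^sup>k)\<close> is integrable and dominates the series pointwise.\<close>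

lemma L2_geometric_series_converges:
  fixes u :: "nat \<Rightarrow> 'a \<Rightarrow> 'b::{banach, second_countable_topology}"
  assumes u [measurable]: "\<And>k. u k \<in> borel_measurable M"
    and int: "\<And>k. integrable M (\<lambda>x. (norm (u k x))\<^sup>2)"
    and q: "0 < q" "q < 1" and bound: "\<And>k. (\<integral>x. (norm (u k x))\<^sup>2 \<partial>M) \<le> K * (q ^ k)\<^sup>2"
  shows "\<exists>g\<in>borel_measurable M. integrable M (\<lambda>x. (norm (g x))\<^sup>2) \<and>
    (\<lambda>n. \<integral>x. (norm (g x - (\<Sum>k<n. u k x)))\<^sup>2 \<partial>M) \<longlonglongrightarrow> 0"
proof -
  \<comment> \<open>The squares decay like q^(2k) in mean. Dividing by q^k spends half of this decay
    on a pointwise bound and keeps the other half for summing the integrals.\<close>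
  define w where "w k x = (norm (u k x))\<^sup>2 / q ^ k" for k x
  have w0: "0 \<le> w k x" for k x using q by (simp add: w_def)
  have wm [measurable]: "w k \<in> borel_measurable M" for k unfolding w_def by measurable
  have wi: "integrable M (w k)" for k unfolding w_def using int by simp
  have K: "0 \<le> K" using order_trans[OF _ bound[of 0]] by simp
  have "(\<integral>\<^sup>+x. (\<Sum>k. ennreal (w k x)) \<partial>M) = (\<Sum>k. \<integral>\<^sup>+x. ennreal (w k x) \<partial>M)"
    by (intro nn_integral_suminf) simp
  also have "\<dots> = (\<Sum>k. ennreal (\<integral>x. w k x \<partial>M))"
    using wi w0 by (simp add: nn_integral_eq_integral)
  also have "\<dots> \<le> (\<Sum>k. ennreal (K * q ^ k))"
  proof (intro suminf_le ennreal_leI)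
    fix k show "(\<integral>x. w k x \<partial>M) \<le> K * q ^ k"
      using bound[of k] q by (simp add: w_def power2_eq_square field_simps)
  qed auto
  also have "\<dots> < \<infinity>"
    using q K by (subst suminf_ennreal2) (auto intro: summable_mult summable_geometric)
  finally have Wfin: "(\<integral>\<^sup>+x. (\<Sum>k. ennreal (w k x)) \<partial>M) < \<infinity>" .
  define W where "W x = enn2real (\<Sum>k. ennreal (w k x))" for x
  have Wm [measurable]: "W \<in> borel_measurable M" unfolding W_def by measurable
  have Wint: "integrable M W"
  proof (intro integrableI_bounded Wm)
    have "(\<integral>\<^sup>+x. ennreal (norm (W x)) \<partial>M) \<le> (\<integral>\<^sup>+x. (\<Sum>k. ennreal (w k x)) \<partial>M)"
      by (intro nn_integral_mono) (simp add: W_def ennreal_enn2real_if)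
    then show "(\<integral>\<^sup>+x. ennreal (norm (W x)) \<partial>M) < \<infinity>" using Wfin by simp
  qed
  \<comment> \<open>A term w k x <= W x means norm (u k x) <= sqrt (W x) * p^k, a geometric series
    at almost every point.\<close>
  define p where "p = sqrt q"
  have p: "0 < p" "p < 1" using q by (auto simp: p_def)
  have AE_W: "AE x in M. (\<Sum>k. ennreal (w k x)) \<noteq> \<infinity>"
    using Wfin by (intro nn_integral_PInf_AE) auto
  have ub: "norm (u k x) \<le> sqrt (W x) * p ^ k" if "(\<Sum>k. ennreal (w k x)) \<noteq> \<infinity>" for k x
  proof -
    have "ennreal (w k x) = (\<Sum>j\<in>{k}. ennreal (w j x))" by simp
    also have "\<dots> \<le> (\<Sum>k. ennreal (w k x))" by (intro sum_le_suminf) auto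
    also have "\<dots> = ennreal (W x)" using that by (simp add: W_def less_top)
    finally have "w k x \<le> W x" by (simp add: W_def)
    then have "(norm (u k x))\<^sup>2 \<le> W x * q ^ k" using q by (simp add: w_def field_simps)
    then have "norm (u k x) \<le> sqrt (W x * q ^ k)" by (rule real_le_rsqrt)
    then show ?thesis by (simp add: real_sqrt_mult p_def real_sqrt_power)
  qed
  define g where "g x = (\<Sum>k. u k x)" for x
  have gm [measurable]: "g \<in> borel_measurable M" unfolding g_def[abs_def] by measurable
  have tail: "norm (g x - (\<Sum>k<n. u k x)) \<le> sqrt (W x) * (p ^ n / (1 - p))"
    if fin: "(\<Sum>k. ennreal (w k x)) \<noteq> \<infinity>" for n x
  proof -
    have sp: "summable (\<lambda>k. sqrt (W x) * p ^ k)" using p by (intro summable_mult summable_geometric) auto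
    have su: "summable (\<lambda>k. norm (u k x))"
      by (rule summable_comparison_test'[OF sp, of 0]) (use ub[OF fin] in simp)
    have su': "summable (\<lambda>k. norm (u (k + n) x))" using summable_ignore_initial_segment[OF su, of n] by simp
    have "g x - (\<Sum>k<n. u k x) = (\<Sum>k. u (k + n) x)"
      unfolding g_def by (rule suminf_minus_initial_segment[symmetric]) (rule summable_norm_cancel[OF su])
    also have "norm \<dots> \<le> (\<Sum>k. norm (u (k + n) x))"
      using su by (intro summable_norm) (rule su')
    also have "\<dots> \<le> (\<Sum>k. sqrt (W x) * p ^ n * p ^ k)"
    proof (rule suminf_le)
      show "norm (u (k + n) x) \<le> sqrt (W x) * p ^ n * p ^ k" for k
        using ub[OF fin, of "k + n"] by (simp add: power_add mult.assoc mult.commute mult.left_commute)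
      show "summable (\<lambda>k. norm (u (k + n) x))" by (rule su')
      show "summable (\<lambda>k. sqrt (W x) * p ^ n * p ^ k)" using p by (intro summable_mult summable_geometric) auto
    qed
    also have "\<dots> = sqrt (W x) * (p ^ n / (1 - p))"
      using p by (subst suminf_mult) (auto simp: suminf_geometric intro: summable_geometric)
    finally show ?thesis .
  qed
  have W0: "0 \<le> W x" for x by (simp add: W_def)
  have tail2: "AE x in M. (norm (g x - (\<Sum>k<n. u k x)))\<^sup>2 \<le> W x * (p ^ n / (1 - p))\<^sup>2" for n
    using AE_W
  proof eventually_elim
    case (elim x)
    have "(norm (g x - (\<Sum>k<n. u k x)))\<^sup>2 \<le> (sqrt (W x) * (p ^ n / (1 - p)))\<^sup>2"
      using tail[OF elim] by (intro power_mono) auto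
    then show ?case by (simp only: power_mult_distrib real_sqrt_pow2[OF W0])
  qed
  have int2: "integrable M (\<lambda>x. (norm (g x - (\<Sum>k<n. u k x)))\<^sup>2)" for n
    by (rule Bochner_Integration.integrable_bound[of _ "\<lambda>x. W x * (p ^ n / (1 - p))\<^sup>2"])
       (use tail2[of n] Wint W0 in \<open>auto simp: abs_mult\<close>)
  have "(\<lambda>n. \<integral>x. (norm (g x - (\<Sum>k<n. u k x)))\<^sup>2 \<partial>M) \<longlonglongrightarrow> 0"
  proof (rule tendsto_sandwich)
    show "\<forall>\<^sub>F n in sequentially. 0 \<le> (\<integral>x. (norm (g x - (\<Sum>k<n. u k x)))\<^sup>2 \<partial>M)" by simp
    show "\<forall>\<^sub>F n in sequentially. (\<integral>x. (norm (g x - (\<Sum>k<n. u k x)))\<^sup>2 \<partial>M) \<le> (\<integral>x. W x \<partial>M) * (p ^ n / (1 - p))\<^sup>2"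
    proof (intro always_eventually allI)
      fix n
      have "(\<integral>x. (norm (g x - (\<Sum>k<n. u k x)))\<^sup>2 \<partial>M) \<le> (\<integral>x. W x * (p ^ n / (1 - p))\<^sup>2 \<partial>M)"
        using tail2[of n] int2[of n] Wint by (intro integral_mono_AE) auto
      then show "(\<integral>x. (norm (g x - (\<Sum>k<n. u k x)))\<^sup>2 \<partial>M) \<le> (\<integral>x. W x \<partial>M) * (p ^ n / (1 - p))\<^sup>2" by simp
    qed
    have "(\<lambda>n. (\<integral>x. W x \<partial>M) * (p ^ n / (1 - p))\<^sup>2) \<longlonglongrightarrow> (\<integral>x. W x \<partial>M) * (0 / (1 - p))\<^sup>2"
      using p by (intro tendsto_intros LIMSEQ_power_zero) auto
    then show "(\<lambda>n. (\<integral>x. W x \<partial>M) * (p ^ n / (1 - p))\<^sup>2) \<longlonglongrightarrow> 0" by simp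
  qed simp
  with int2[of 0] show ?thesis by (intro bexI[of _ g]) auto
qed

section \<open>The complex L2 norm, bounded operators and their inverses\<close>

lemma L2_measurable [measurable_dest]: "f \<in> L2 M \<Longrightarrow> f \<in> borel_measurable M"
  by (simp add: L2_def)

lemma L2_iff_cmod: "f \<in> L2 M \<longleftrightarrow> f \<in> borel_measurable M \<and> (\<lambda>x. cmod (f x)) \<in> real_L2 M"
  by (auto simp: L2_def real_L2_def)

lemma L2_cmod: "f \<in> L2 M \<Longrightarrow> (\<lambda>x. cmod (f x)) \<in> real_L2 M"
  by (simp add: L2_iff_cmod)

lemma L2_norm_eq: "L2_norm M f = sqrt (real_ip M (\<lambda>x. cmod (f x)) (\<lambda>x. cmod (f x)))"
  by (simp add: L2_norm_def real_ip_def power2_eq_square)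

lemma L2_norm_nonneg [simp]: "0 \<le> L2_norm M f"
  by (simp add: L2_norm_def)

lemma L2_norm_power2: "(L2_norm M f)\<^sup>2 = (\<integral>x. (cmod (f x))\<^sup>2 \<partial>M)"
  by (simp add: L2_norm_def)

lemma L2_add: "f \<in> L2 M \<Longrightarrow> g \<in> L2 M \<Longrightarrow> (\<lambda>x. f x + g x) \<in> L2 M"
  using real_L2_bound[of "\<lambda>x. cmod (f x) + cmod (g x)" M "\<lambda>x. cmod (f x + g x)"]
    real_L2_add[OF L2_cmod L2_cmod, of f M g]
  by (simp add: L2_iff_cmod[of "\<lambda>x. f x + g x"] norm_triangle_ineq L2_measurable)

lemma L2_scale: "f \<in> L2 M \<Longrightarrow> (\<lambda>x. c * f x) \<in> L2 M"
  by (auto simp: L2_iff_cmod norm_mult real_L2_scale)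

lemma L2_diff: "f \<in> L2 M \<Longrightarrow> g \<in> L2 M \<Longrightarrow> (\<lambda>x. f x - g x) \<in> L2 M"
  using L2_add[of f M "\<lambda>x. (-1) * g x"] L2_scale[of g M "-1"] by simp

lemma L2_sum: "finite A \<Longrightarrow> (\<And>k. k \<in> A \<Longrightarrow> f k \<in> L2 M) \<Longrightarrow> (\<lambda>x. \<Sum>k\<in>A. f k x) \<in> L2 M"
proof (induction A rule: finite_induct)
  case (insert a A)
  then show ?case using L2_add[of "f a" M "\<lambda>x. \<Sum>k\<in>A. f k x"] by simp
qed (simp add: L2_def)

lemma L2_norm_scale: "L2_norm M (\<lambda>x. c * f x) = cmod c * L2_norm M f"
  by (simp add: L2_norm_def norm_mult power_mult_distrib real_sqrt_mult)

lemma L2_norm_mono: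
  assumes "g \<in> L2 M" "f \<in> borel_measurable M" "AE x in M. cmod (f x) \<le> cmod (g x)"
  shows "L2_norm M f \<le> L2_norm M g"
  unfolding L2_norm_def
proof (intro real_sqrt_le_mono integral_mono_AE')
  show "integrable M (\<lambda>x. (cmod (g x))\<^sup>2)" using assms(1) by (simp add: L2_def)
  show "AE x in M. (cmod (f x))\<^sup>2 \<le> (cmod (g x))\<^sup>2" using assms(3) by eventually_elim (simp add: power_mono)
qed simp

lemma L2_norm_cong_AE:
  assumes "g \<in> L2 M" "f \<in> L2 M" "AE x in M. f x = g x"
  shows "L2_norm M f = L2_norm M g"
  unfolding L2_norm_def using assms by (intro arg_cong[where f = sqrt] integral_cong_AE) auto

lemma L2_norm_triangle:
  assumes f: "f \<in> L2 M" and g: "g \<in> L2 M"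
  shows "L2_norm M (\<lambda>x. f x + g x) \<le> L2_norm M f + L2_norm M g"
proof -
  have "L2_norm M (\<lambda>x. f x + g x) \<le> L2_norm M (\<lambda>x. complex_of_real (cmod (f x) + cmod (g x)))"
  proof (rule L2_norm_mono)
    have "(\<lambda>x. cmod (f x) + cmod (g x)) \<in> real_L2 M" using f g by (intro real_L2_add L2_cmod)
    then have "(\<lambda>x. cmod (complex_of_real (cmod (f x) + cmod (g x)))) \<in> real_L2 M"
      by (simp add: norm_of_real del: of_real_add)
    moreover have "(\<lambda>x. complex_of_real (cmod (f x) + cmod (g x))) \<in> borel_measurable M"
      using f g by measurable
    ultimately show "(\<lambda>x. complex_of_real (cmod (f x) + cmod (g x))) \<in> L2 M"
      unfolding L2_iff_cmod by (rule conjI[rotated])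
    show "AE x in M. cmod (f x + g x) \<le> cmod (complex_of_real (cmod (f x) + cmod (g x)))"
      by (simp add: norm_of_real norm_triangle_ineq del: of_real_add)
  qed (use f g in measurable)
  also have "\<dots> \<le> L2_norm M f + L2_norm M g"
    using real_L2.norm_triangle[OF L2_cmod[OF f] L2_cmod[OF g]] 
    by (simp add: L2_norm_eq norm_of_real del: of_real_add)
  finally show ?thesis .
qed

lemma L2_norm_triangle_diff:
  assumes f: "f \<in> L2 M" and g: "g \<in> L2 M"
  shows "L2_norm M (\<lambda>x. f x - g x) \<le> L2_norm M f + L2_norm M g"
  using L2_norm_triangle[OF f L2_scale[OF g, of "-1"]] L2_norm_scale[of M "-1" g] by simp

lemma L2_norm_eq_0_imp_AE:
  assumes "f \<in> L2 M" "L2_norm M f = 0"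
  shows "AE x in M. f x = 0"
proof -
  have "(\<integral>x. (cmod (f x))\<^sup>2 \<partial>M) = 0" using assms(2) by (simp add: L2_norm_def)
  then have "AE x in M. (cmod (f x))\<^sup>2 = 0"
    using assms(1) by (subst (asm) integral_nonneg_eq_0_iff_AE) (auto simp: L2_def)
  then show ?thesis by simp
qed

lemma L2_bounded_linear_closed: "L2_bounded_linear M T \<Longrightarrow> f \<in> L2 M \<Longrightarrow> T f \<in> L2 M"
  unfolding L2_bounded_linear_def by blast

lemma L2_bounded_linear_add:
  "L2_bounded_linear M T \<Longrightarrow> f \<in> L2 M \<Longrightarrow> g \<in> L2 M \<Longrightarrow> AE x in M. T (\<lambda>x. f x + g x) x = T f x + T g x"
  unfolding L2_bounded_linear_def by blast

lemma L2_bounded_linear_scale: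
  "L2_bounded_linear M T \<Longrightarrow> f \<in> L2 M \<Longrightarrow> AE x in M. T (\<lambda>x. c * f x) x = c * T f x"
  unfolding L2_bounded_linear_def by blast

lemma L2_bounded_linear_diff:
  assumes T: "L2_bounded_linear M T" and f: "f \<in> L2 M" and g: "g \<in> L2 M"
  shows "AE x in M. T (\<lambda>x. f x - g x) x = T f x - T g x"
proof -
  have "AE x in M. T (\<lambda>x. f x + (-1) * g x) x = T f x + T (\<lambda>x. (-1) * g x) x"
    by (rule L2_bounded_linear_add[OF T f L2_scale[OF g]])
  moreover have "AE x in M. T (\<lambda>x. (-1) * g x) x = (-1) * T g x"
    by (rule L2_bounded_linear_scale[OF T g])
  ultimately show ?thesis by eventually_elim simp
qed

lemma L2_bounded_linear_shift:
  assumes T: "L2_bounded_linear M T"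
  shows "L2_bounded_linear M (\<lambda>f x. c * f x - T f x)"
proof -
  have TL: "T f \<in> L2 M" if "f \<in> L2 M" for f using T that by (simp add: L2_bounded_linear_def)
  obtain K where K: "\<And>f. f \<in> L2 M \<Longrightarrow> L2_norm M (T f) \<le> K * L2_norm M f"
    using T unfolding L2_bounded_linear_def by blast
  have "L2_norm M (\<lambda>x. c * f x - T f x) \<le> (cmod c + K) * L2_norm M f" if f: "f \<in> L2 M" for f
    using L2_norm_triangle_diff[OF L2_scale[OF f, of c] TL[OF f]] K[OF f]
    by (simp add: L2_norm_scale algebra_simps)
  moreover have "AE x in M. c * (f x + g x) - T (\<lambda>x. f x + g x) x = c * f x - T f x + (c * g x - T g x)"
    if "f \<in> L2 M" "g \<in> L2 M" for f g
  proof -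
    have "AE x in M. T (\<lambda>x. f x + g x) x = T f x + T g x" by (rule L2_bounded_linear_add[OF T that])
    then show ?thesis by eventually_elim (simp add: algebra_simps)
  qed
  moreover have "AE x in M. c * (d * f x) - T (\<lambda>x. d * f x) x = d * (c * f x - T f x)"
    if "f \<in> L2 M" for f d
  proof -
    have "AE x in M. T (\<lambda>x. d * f x) x = d * T f x" by (rule L2_bounded_linear_scale[OF T that])
    then show ?thesis by eventually_elim (simp add: algebra_simps)
  qed
  ultimately show ?thesis
    unfolding L2_bounded_linear_def using TL by (auto intro!: L2_diff L2_scale)
qed

text \<open>Preimages are picked by choice. Coercivity makes them unique up to null sets, and this
  uniqueness makes the arbitrary choice linear and bounded.\<close>

lemma L2_is_inverse_of_surj_coercive:
  assumes A: "L2_bounded_linear M A"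
    and coercive: "\<And>f. f \<in> L2 M \<Longrightarrow> L2_norm M f \<le> K * L2_norm M (A f)"
    and surj: "\<And>f. f \<in> L2 M \<Longrightarrow> \<exists>g\<in>L2 M. AE x in M. A g x = f x"
  shows "\<exists>B. L2_is_inverse M A B"
proof -
  obtain B where B: "\<And>f. f \<in> L2 M \<Longrightarrow> B f \<in> L2 M" "\<And>f. f \<in> L2 M \<Longrightarrow> AE x in M. A (B f) x = f x"
    using surj by metis
  have AL: "A f \<in> L2 M" if "f \<in> L2 M" for f using A that by (simp add: L2_bounded_linear_def)
  have inj: "AE x in M. f x = g x" if f: "f \<in> L2 M" and g: "g \<in> L2 M" and eq: "AE x in M. A f x = A g x" for f g
  proof -
    have "AE x in M. A (\<lambda>x. f x - g x) x = 0"
      using L2_bounded_linear_diff[OF A f g] eq by eventually_elim simp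
    then have "L2_norm M (A (\<lambda>x. f x - g x)) = L2_norm M (\<lambda>x. 0)"
      using f g by (intro L2_norm_cong_AE AL L2_diff) (auto simp: L2_def)
    then have "L2_norm M (\<lambda>x. f x - g x) \<le> 0"
      using coercive[OF L2_diff[OF f g]] by (simp add: L2_norm_def)
    then have "AE x in M. f x - g x = 0"
      using f g by (intro L2_norm_eq_0_imp_AE L2_diff) (auto simp: order_antisym)
    then show ?thesis by simp
  qed
  have "AE x in M. B (\<lambda>x. f x + g x) x = B f x + B g x" if f: "f \<in> L2 M" and g: "g \<in> L2 M" for f g
  proof (rule inj)
    have "AE x in M. A (\<lambda>x. B f x + B g x) x = A (B f) x + A (B g) x"
      by (intro L2_bounded_linear_add[OF A] B f g)
    with B(2)[OF f] B(2)[OF g] B(2)[OF L2_add[OF f g]]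
    show "AE x in M. A (B (\<lambda>x. f x + g x)) x = A (\<lambda>x. B f x + B g x) x" by eventually_elim simp
  qed (use B f g in \<open>auto intro: L2_add\<close>)
  moreover have "AE x in M. B (\<lambda>x. c * f x) x = c * B f x" if f: "f \<in> L2 M" for f c
  proof (rule inj)
    have "AE x in M. A (\<lambda>x. c * B f x) x = c * A (B f) x"
      by (intro L2_bounded_linear_scale[OF A] B f)
    with B(2)[OF f] B(2)[OF L2_scale[OF f, of c]]
    show "AE x in M. A (B (\<lambda>x. c * f x)) x = A (\<lambda>x. c * B f x) x" by eventually_elim simp
  qed (use B f in \<open>auto intro: L2_scale\<close>)
  moreover have "L2_norm M (B f) \<le> K * L2_norm M f" if f: "f \<in> L2 M" for f
    using coercive[OF B(1)[OF f]] L2_norm_cong_AE[OF f AL[OF B(1)[OF f]] B(2)[OF f]] by simp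
  moreover have "AE x in M. B (A f) x = f x" if f: "f \<in> L2 M" for f
    by (rule inj) (intro B AL f)+
  ultimately show ?thesis
    unfolding L2_is_inverse_def L2_bounded_linear_def using B
    by (intro exI[of _ B] conjI ballI allI exI[of _ K]) auto
qed

text \<open>Coercivity is the triangle inequality; surjectivity is the Neumann series, whose limit
  exists by \<open>L2_geometric_series_converges\<close>.\<close>

lemma L2_Neumann_inverse:
  assumes T: "L2_bounded_linear M T" and c: "c \<noteq> 0" and q: "0 \<le> q" "q < 1"
    and bound: "\<And>f. f \<in> L2 M \<Longrightarrow> L2_norm M (T f) \<le> q * cmod c * L2_norm M f"
  shows "\<exists>B. L2_is_inverse M (\<lambda>f x. c * f x - T f x) B"
proof (rule L2_is_inverse_of_surj_coercive[OF L2_bounded_linear_shift[OF T], where K = "1 / (cmod c * (1 - q))"])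
  have TL: "T f \<in> L2 M" if "f \<in> L2 M" for f using T that by (simp add: L2_bounded_linear_def)
  let ?A = "\<lambda>f x. c * f x - T f x"
  {
    fix f assume f: "f \<in> L2 M"
    have "cmod c * L2_norm M f = L2_norm M (\<lambda>x. (c * f x - T f x) + T f x)" by (simp add: L2_norm_scale)
    also have "\<dots> \<le> L2_norm M (?A f) + L2_norm M (T f)"
      using f by (intro L2_norm_triangle L2_diff L2_scale TL)
    also have "\<dots> \<le> L2_norm M (?A f) + q * cmod c * L2_norm M f" using bound[OF f] by simp
    finally have "cmod c * (1 - q) * L2_norm M f \<le> L2_norm M (?A f)" by (simp add: algebra_simps)
    then show "L2_norm M f \<le> 1 / (cmod c * (1 - q)) * L2_norm M (?A f)"
      using c q by (simp add: field_simps)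
  }
  fix f assume f: "f \<in> L2 M"
  \<comment> \<open>The convergence lemma asks for a positive ratio, while q may be 0.\<close>
  define r where "r = max q (1/2)"
  have r: "0 < r" "r < 1" "q \<le> r" using q by (auto simp: r_def)
  define u where "u = rec_nat (\<lambda>x. (1/c) * f x) (\<lambda>_ v x. (1/c) * T v x)"
  have u0: "u 0 = (\<lambda>x. (1/c) * f x)" and uS: "u (Suc k) = (\<lambda>x. (1/c) * T (u k) x)" for k
    by (simp_all add: u_def)
  have uL: "u k \<in> L2 M" for k
    by (induction k) (auto simp only: u0 uS intro!: L2_scale f TL)
  have un: "L2_norm M (u k) \<le> L2_norm M (u 0) * r ^ k" for k
  proof (induction k)
    case (Suc k)
    have "L2_norm M (u (Suc k)) = L2_norm M (T (u k)) / cmod c"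
      by (simp only: uS L2_norm_scale) (simp add: norm_divide)
    also have "\<dots> \<le> q * L2_norm M (u k)" using bound[OF uL[of k]] c by (simp add: field_simps)
    also have "\<dots> \<le> r * (L2_norm M (u 0) * r ^ k)" using Suc r q by (intro mult_mono) auto
    finally show ?case by (simp add: algebra_simps)
  qed simp
  have "\<exists>g\<in>borel_measurable M. integrable M (\<lambda>x. (norm (g x))\<^sup>2) \<and>
    (\<lambda>n. \<integral>x. (norm (g x - (\<Sum>k<n. u k x)))\<^sup>2 \<partial>M) \<longlonglongrightarrow> 0"
  proof (rule L2_geometric_series_converges[where q = r and K = "(L2_norm M (u 0))\<^sup>2"])
    fix k
    have "(L2_norm M (u k))\<^sup>2 \<le> (L2_norm M (u 0) * r ^ k)\<^sup>2" using un by (intro power_mono) auto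
    then show "(\<integral>x. (cmod (u k x))\<^sup>2 \<partial>M) \<le> (L2_norm M (u 0))\<^sup>2 * (r ^ k)\<^sup>2"
      by (simp add: L2_norm_power2[symmetric] power_mult_distrib)
  qed (use uL r in \<open>auto simp: L2_def\<close>)
  then obtain g where g: "g \<in> L2 M"
    and lim: "(\<lambda>n. (L2_norm M (\<lambda>x. g x - (\<Sum>k<n. u k x)))\<^sup>2) \<longlonglongrightarrow> 0"
    by (auto simp: L2_def L2_norm_power2)
  have lim': "(\<lambda>n. L2_norm M (\<lambda>x. g x - (\<Sum>k<n. u k x))) \<longlonglongrightarrow> 0"
    using tendsto_real_sqrt[OF lim] by simp
  define s where "s n x = (\<Sum>k<n. u k x)" for n x
  have sL: "s n \<in> L2 M" for n unfolding s_def by (intro L2_sum uL) simp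
  have AL: "?A h \<in> L2 M" if "h \<in> L2 M" for h using that by (intro L2_diff L2_scale TL)
  \<comment> \<open>The partial sums telescope: c u (k+1) = T (u k), so only f and the last term
    survive.\<close>
  have As: "AE x in M. ?A (s n) x = f x - c * u n x" for n
  proof (induction n)
    case 0
    have "AE x in M. T (\<lambda>x. 0 * f x) x = 0 * T f x" by (rule L2_bounded_linear_scale[OF T f])
    then show ?case using c by (simp add: s_def[abs_def] u0)
  next
    case (Suc n)
    have "AE x in M. T (\<lambda>x. s n x + u n x) x = T (s n) x + T (u n) x"
      by (intro L2_bounded_linear_add[OF T] sL uL)
    moreover have "s (Suc n) = (\<lambda>x. s n x + u n x)" by (auto simp: s_def)
    ultimately show ?case using Suc.IH
      by (auto elim!: eventually_elim2 simp: uS c algebra_simps)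
  qed
  have "L2_norm M (\<lambda>x. ?A g x - f x) \<le> 0"
  proof (rule LIMSEQ_le_const)
    define e where "e n = (cmod c + q * cmod c) * L2_norm M (\<lambda>x. g x - s n x) + cmod c * (L2_norm M (u 0) * r ^ n)" for n
    have "e \<longlonglongrightarrow> (cmod c + q * cmod c) * 0 + cmod c * (L2_norm M (u 0) * 0)"
      unfolding e_def s_def using lim' r by (intro tendsto_intros LIMSEQ_power_zero) auto
    then show "e \<longlonglongrightarrow> 0" by simp
    show "\<exists>N. \<forall>n\<ge>N. L2_norm M (\<lambda>x. ?A g x - f x) \<le> e n"
    proof (intro exI[of _ 0] allI impI)
      fix n
      let ?d = "\<lambda>x. g x - s n x"
      have d: "?d \<in> L2 M" using g sL by (rule L2_diff)
      have "AE x in M. T ?d x = T g x - T (s n) x" by (rule L2_bounded_linear_diff[OF T g sL])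
      then have eq: "AE x in M. ?A g x - f x = ?A ?d x - c * u n x"
        using As[of n]
      proof eventually_elim
        case (elim x)
        then show ?case by algebra
      qed
      have "L2_norm M (\<lambda>x. ?A g x - f x) = L2_norm M (\<lambda>x. ?A ?d x - c * u n x)"
        using eq g f d uL by (intro L2_norm_cong_AE L2_diff[OF AL] L2_scale) auto
      also have "\<dots> \<le> L2_norm M (?A ?d) + L2_norm M (\<lambda>x. c * u n x)"
        using d uL by (intro L2_norm_triangle_diff AL L2_scale)
      also have "L2_norm M (?A ?d) \<le> L2_norm M (\<lambda>x. c * ?d x) + L2_norm M (T ?d)"
        using d by (intro L2_norm_triangle_diff L2_scale TL)
      also have "\<dots> \<le> (cmod c + q * cmod c) * L2_norm M ?d"
        using bound[OF d] by (simp only: L2_norm_scale) (simp add: algebra_simps)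
      also have "L2_norm M (\<lambda>x. c * u n x) \<le> cmod c * (L2_norm M (u 0) * r ^ n)"
        using un[of n] by (simp only: L2_norm_scale) (intro mult_left_mono, auto)
      finally show "L2_norm M (\<lambda>x. ?A g x - f x) \<le> e n" by (simp add: e_def)
    qed
  qed
  then have "AE x in M. ?A g x - f x = 0"
    using g f by (intro L2_norm_eq_0_imp_AE L2_diff[OF AL]) (auto simp: order_antisym)
  then show "\<exists>g\<in>L2 M. AE x in M. c * g x - T g x = f x" using g by auto
qed

section \<open>The Poincare inequality and the Poisson equation\<close>

lemma of_real_L2: "g \<in> real_L2 M \<Longrightarrow> (\<lambda>x. complex_of_real (g x)) \<in> L2 M"
  by (auto simp: L2_def real_L2_def)

lemma L2_norm_of_real: "(L2_norm M (\<lambda>x. complex_of_real (g x)))\<^sup>2 = real_ip M g g"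
  unfolding L2_norm_power2 by (simp add: real_ip_def power2_eq_square)

lemma L2_Re: "f \<in> L2 M \<Longrightarrow> (\<lambda>x. Re (f x)) \<in> real_L2 M"
  by (rule real_L2_bound[OF L2_cmod]) (auto simp: abs_Re_le_cmod)

lemma L2_Im: "f \<in> L2 M \<Longrightarrow> (\<lambda>x. Im (f x)) \<in> real_L2 M"
  by (rule real_L2_bound[OF L2_cmod]) (auto simp: abs_Im_le_cmod)

lemma L2_norm_Re_Im:
  assumes f: "f \<in> L2 M"
  shows "(L2_norm M f)\<^sup>2 = real_ip M (\<lambda>x. Re (f x)) (\<lambda>x. Re (f x)) + real_ip M (\<lambda>x. Im (f x)) (\<lambda>x. Im (f x))"
  unfolding L2_norm_power2 real_ip_def cmod_power2 power2_eq_square[of "Re _"] power2_eq_square[of "Im _"]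
  by (intro Bochner_Integration.integral_add real_L2_integrable_mult L2_Re L2_Im f)

lemma (in prob_space) L2_integrable: "f \<in> L2 M \<Longrightarrow> integrable M f"
  using real_L2_integrable[OF L2_cmod, of f] by (simp add: integrable_norm_iff L2_measurable)

lemma L2_bounded_linear_op_diff:
  assumes T: "L2_bounded_linear M T" and U: "L2_bounded_linear M U"
  shows "L2_bounded_linear M (\<lambda>f x. T f x - U f x)"
proof -
  note cl = L2_bounded_linear_closed[OF T] L2_bounded_linear_closed[OF U]
  obtain K where K: "\<And>f. f \<in> L2 M \<Longrightarrow> L2_norm M (T f) \<le> K * L2_norm M f"
    using T unfolding L2_bounded_linear_def by blast
  obtain K' where K': "\<And>f. f \<in> L2 M \<Longrightarrow> L2_norm M (U f) \<le> K' * L2_norm M f"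
    using U unfolding L2_bounded_linear_def by blast
  have "L2_norm M (\<lambda>x. T f x - U f x) \<le> (K + K') * L2_norm M f" if f: "f \<in> L2 M" for f
    using L2_norm_triangle_diff[OF cl(1)[OF f] cl(2)[OF f]] K[OF f] K'[OF f] by (simp add: algebra_simps)
  moreover have "AE x in M. T (\<lambda>x. f x + g x) x - U (\<lambda>x. f x + g x) x = T f x - U f x + (T g x - U g x)"
    if "f \<in> L2 M" "g \<in> L2 M" for f g
    using L2_bounded_linear_add[OF T that] L2_bounded_linear_add[OF U that]
    by eventually_elim (simp add: algebra_simps)
  moreover have "AE x in M. T (\<lambda>x. d * f x) x - U (\<lambda>x. d * f x) x = d * (T f x - U f x)"
    if "f \<in> L2 M" for f d
    using L2_bounded_linear_scale[OF T that, of d] L2_bounded_linear_scale[OF U that, of d]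
    by eventually_elim (simp add: algebra_simps)
  ultimately show ?thesis
    unfolding L2_bounded_linear_def using cl
    by (intro conjI ballI allI exI[of _ "K + K'"] L2_diff) auto
qed

lemma (in prob_space) L2_bounded_linear_mean_op: "L2_bounded_linear M (mean_op M)"
proof -
  have c: "(\<lambda>x. c) \<in> L2 M" for c by (simp add: L2_def)
  have "L2_norm M (mean_op M f) \<le> 1 * L2_norm M f" if f: "f \<in> L2 M" for f
  proof -
    have "cmod (\<integral>x. f x \<partial>M) \<le> expectation (\<lambda>x. cmod (f x))" by (rule integral_norm_bound)
    then have "(cmod (\<integral>x. f x \<partial>M))\<^sup>2 \<le> (expectation (\<lambda>x. cmod (f x)))\<^sup>2" by (intro power_mono) auto
    also have "\<dots> \<le> expectation (\<lambda>x. (cmod (f x))\<^sup>2)" by (rule expectation_power2_le[OF L2_cmod[OF f]])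
    finally show ?thesis by (simp add: L2_norm_def mean_op_def prob_space real_le_rsqrt)
  qed
  then show ?thesis
    unfolding L2_bounded_linear_def
    by (intro conjI ballI allI exI[of _ 1]) (auto simp: mean_op_def c L2_integrable)
qed

lemma AE_eq_0_of_real_ip:
  assumes "f \<in> real_L2 M" "real_ip M f f = 0"
  shows "AE x in M. f x = 0"
proof -
  have "(\<integral>x. (f x)\<^sup>2 \<partial>M) = 0" using assms(2) by (simp add: real_ip_def power2_eq_square)
  then have "AE x in M. (f x)\<^sup>2 = 0"
    using assms(1) by (subst (asm) integral_nonneg_eq_0_iff_AE) (auto simp: real_L2_def)
  then show ?thesis by simp
qed

lemma real_ip_tendsto:
  assumes z: "\<And>n. z n \<in> real_L2 M" and g: "g \<in> real_L2 M" and h: "h \<in> real_L2 M"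
    and lim: "(\<lambda>n. real_ip M (\<lambda>x. g x - z n x) (\<lambda>x. g x - z n x)) \<longlonglongrightarrow> 0"
  shows "(\<lambda>n. real_ip M (z n) h) \<longlonglongrightarrow> real_ip M g h"
proof -
  have d: "(\<lambda>x. g x - z n x) \<in> real_L2 M" for n by (intro real_L2_diff g z)
  have "(\<lambda>n. sqrt (real_ip M (\<lambda>x. g x - z n x) (\<lambda>x. g x - z n x) * real_ip M h h)) \<longlonglongrightarrow> sqrt (0 * real_ip M h h)"
    by (intro tendsto_intros lim)
  then have lim0: "(\<lambda>n. sqrt (real_ip M (\<lambda>x. g x - z n x) (\<lambda>x. g x - z n x) * real_ip M h h)) \<longlonglongrightarrow> 0"
    by simp
  have "(\<lambda>n. real_ip M (\<lambda>x. g x - z n x) h) \<longlonglongrightarrow> 0"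
  proof (rule Lim_null_comparison[OF _ lim0])
    have "norm (real_ip M (\<lambda>x. g x - z n x) h)
        \<le> sqrt (real_ip M (\<lambda>x. g x - z n x) (\<lambda>x. g x - z n x) * real_ip M h h)" for n
      using real_L2.Cauchy_Schwarz[OF d h, of n] by (intro real_le_rsqrt) simp
    then show "\<forall>\<^sub>F n in sequentially. norm (real_ip M (\<lambda>x. g x - z n x) h)
        \<le> sqrt (real_ip M (\<lambda>x. g x - z n x) (\<lambda>x. g x - z n x) * real_ip M h h)" by simp
  qed
  then have "(\<lambda>n. real_ip M g h - real_ip M (z n) h) \<longlonglongrightarrow> 0"
    using g z h by (simp add: real_ip_diff_left)
  from tendsto_diff[OF tendsto_const[of "real_ip M g h"] this] show ?thesis by simp
qed

section \<open>The kernel on complex L2, its spectrum and the Poincare inequality\<close>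

context reversible_chain
begin

lemma prob_UNIV [simp]: "measure \<pi> UNIV = 1"
  using pi.prob_space by simp

lemma markov_op_of_real: "markov_op P (\<lambda>x. complex_of_real (g x)) = (\<lambda>x. complex_of_real (transition g x))"
  by (simp add: markov_op_def transition_def[abs_def])

lemma L2_borel [measurable_dest]: "f \<in> L2 \<pi> \<Longrightarrow> f \<in> borel_measurable borel"
  using L2_measurable[of f \<pi>] by (simp cong: measurable_cong_sets)

lemma AE_L2_kernel:
  assumes f: "f \<in> L2 \<pi>"
  shows "AE x in \<pi>. integrable (P x) f"
  using AE_real_L2_kernel[OF L2_cmod[OF f]]
proof eventually_elim
  case (elim x)
  have [measurable]: "f \<in> borel_measurable borel" using f by measurable
  show ?case
    using prob_space.real_L2_integrable[OF prob_space_kernel elim] by (simp add: integrable_norm_iff)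
qed

lemma markov_op_L2:
  assumes f: "f \<in> L2 \<pi>"
  shows "markov_op P f \<in> L2 \<pi>" "L2_norm \<pi> (markov_op P f) \<le> L2_norm \<pi> f"
proof -
  have [measurable]: "f \<in> borel_measurable borel" using f by measurable
  let ?t = "transition (\<lambda>x. cmod (f x))"
  have m: "markov_op P f \<in> borel_measurable \<pi>" unfolding markov_op_def by measurable
  have le: "cmod (markov_op P f x) \<le> ?t x" for x
    unfolding markov_op_def transition_def by (rule integral_norm_bound)
  note t = transition_real_L2[OF L2_cmod[OF f]]
  have "(\<lambda>x. cmod (markov_op P f x)) \<in> real_L2 \<pi>"
  proof (rule real_L2_bound[OF t(1)])
    show "\<bar>cmod (markov_op P f x)\<bar> \<le> \<bar>?t x\<bar>" for x
      using order_trans[OF le[of x] abs_ge_self] by simp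
  qed (use m in simp)
  with m show L: "markov_op P f \<in> L2 \<pi>" by (simp add: L2_iff_cmod)
  have "L2_norm \<pi> (markov_op P f) \<le> L2_norm \<pi> (\<lambda>x. complex_of_real (?t x))"
  proof (intro L2_norm_mono of_real_L2 t m AE_I2)
    show "cmod (markov_op P f x) \<le> cmod (complex_of_real (?t x))" for x
      using order_trans[OF le[of x] abs_ge_self] by (simp add: norm_of_real)
  qed
  also have "\<dots> \<le> L2_norm \<pi> f"
  proof (rule power2_le_imp_le)
    have "(L2_norm \<pi> f)\<^sup>2 = real_ip \<pi> (\<lambda>x. cmod (f x)) (\<lambda>x. cmod (f x))"
      unfolding L2_norm_power2 by (simp add: real_ip_def power2_eq_square)
    then show "(L2_norm \<pi> (\<lambda>x. complex_of_real (?t x)))\<^sup>2 \<le> (L2_norm \<pi> f)\<^sup>2"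
      unfolding L2_norm_of_real using t(2) by simp
  qed simp
  finally show "L2_norm \<pi> (markov_op P f) \<le> L2_norm \<pi> f" .
qed

lemma L2_bounded_linear_markov_op: "L2_bounded_linear \<pi> (markov_op P)"
  unfolding L2_bounded_linear_def
proof (intro conjI ballI allI exI[of _ 1])
  fix f g assume f: "f \<in> L2 \<pi>" and g: "g \<in> L2 \<pi>"
  show "AE x in \<pi>. markov_op P (\<lambda>x. f x + g x) x = markov_op P f x + markov_op P g x"
    using AE_L2_kernel[OF f] AE_L2_kernel[OF g] by eventually_elim (simp add: markov_op_def)
qed (auto simp: markov_op_L2, simp add: markov_op_def)

lemma AE_Re_Im_markov_op:
  assumes f: "f \<in> L2 \<pi>"
  shows "AE x in \<pi>. Re (markov_op P f x) = transition (\<lambda>x. Re (f x)) x \<and> Im (markov_op P f x) = transition (\<lambda>x. Im (f x)) x"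
  using AE_L2_kernel[OF f] by eventually_elim (simp add: markov_op_def transition_def)

text \<open>P is a contraction, so the Neumann series inverts c - P for |c| > 1. This bounds the
  sets whose \<open>Sup\<close> defines the two gaps.\<close>

lemma spectrum_in_unit_disc:
  assumes "c \<in> L2_spectrum \<pi> (markov_op P)"
  shows "cmod c \<le> 1"
proof (rule ccontr)
  assume c: "\<not> cmod c \<le> 1"
  have "\<exists>B. L2_is_inverse \<pi> (\<lambda>f x. c * f x - markov_op P f x) B"
  proof (rule L2_Neumann_inverse[OF L2_bounded_linear_markov_op, where q = "1 / cmod c"])
    have "1 < cmod c" using c by simp
    then show "1 / cmod c < 1" by (subst divide_less_eq_1_pos) auto
    show "c \<noteq> 0" using c by auto
    then show "L2_norm \<pi> (markov_op P f) \<le> 1 / cmod c * cmod c * L2_norm \<pi> f" if "f \<in> L2 \<pi>" for f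
      using markov_op_L2(2)[OF that] by simp
  qed simp
  with assms show False by (simp add: L2_spectrum_def)
qed

text \<open>A bounded left inverse of l - P gives |g| <= K |(l - P) g|. Only this consequence of a
  point lying outside the spectrum is used.\<close>

lemma bounded_below_of_notin_spectrum:
  assumes "complex_of_real l \<notin> L2_spectrum \<pi> (markov_op P)"
  shows "\<exists>e>0. \<forall>g\<in>real_L2 \<pi>. e * real_ip \<pi> g g \<le>
    real_ip \<pi> (\<lambda>x. transition g x + - l * g x) (\<lambda>x. transition g x + - l * g x)"
proof -
  obtain B where B: "L2_is_inverse \<pi> (\<lambda>f x. complex_of_real l * f x - markov_op P f x) B"
    using assms by (auto simp: L2_spectrum_def)
  then have bl: "L2_bounded_linear \<pi> B" by (simp add: L2_is_inverse_def)
  then obtain K where K: "\<And>f. f \<in> L2 \<pi> \<Longrightarrow> L2_norm \<pi> (B f) \<le> K * L2_norm \<pi> f"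
    unfolding L2_bounded_linear_def by blast
  \<comment> \<open>The summand 1 keeps the constant positive and meaningful when K = 0.\<close>
  have "1 / (K\<^sup>2 + 1) * real_ip \<pi> g g \<le>
    real_ip \<pi> (\<lambda>x. transition g x + - l * g x) (\<lambda>x. transition g x + - l * g x)" if g: "g \<in> real_L2 \<pi>" for g
  proof -
    let ?g = "\<lambda>x. complex_of_real (g x)"
    let ?h = "\<lambda>x. transition g x + - l * g x"
    let ?A = "\<lambda>x. complex_of_real l * ?g x - markov_op P ?g x"
    have gL: "?g \<in> L2 \<pi>" by (rule of_real_L2[OF g])
    have A: "?A = (\<lambda>x. complex_of_real (- 1 * ?h x))" by (simp add: markov_op_of_real)
    have hL: "?h \<in> real_L2 \<pi>" by (intro real_L2_add real_L2_scale transition_real_L2 g)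
    have AL: "?A \<in> L2 \<pi>" unfolding A by (intro of_real_L2 real_L2_scale hL)
    have "\<And>f. f \<in> L2 \<pi> \<Longrightarrow> AE x in \<pi>. B (\<lambda>x. complex_of_real l * f x - markov_op P f x) x = f x"
      using B by (simp add: L2_is_inverse_def)
    from this[OF gL] have AE: "AE x in \<pi>. B ?A x = ?g x" .
    have "L2_norm \<pi> ?g = L2_norm \<pi> (B ?A)"
      using AE by (intro L2_norm_cong_AE[symmetric] L2_bounded_linear_closed[OF bl] AL gL)
    also have "\<dots> \<le> K * L2_norm \<pi> ?A" by (rule K[OF AL])
    finally have "(L2_norm \<pi> ?g)\<^sup>2 \<le> (K * L2_norm \<pi> ?A)\<^sup>2" by (intro power_mono) auto
    then have "real_ip \<pi> g g \<le> K\<^sup>2 * real_ip \<pi> (\<lambda>x. - 1 * ?h x) (\<lambda>x. - 1 * ?h x)"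
      unfolding A power_mult_distrib L2_norm_of_real .
    also have "\<dots> = K\<^sup>2 * real_ip \<pi> ?h ?h"
      by (subst real_L2.ip_scl_left[OF hL real_L2_scale[OF hL]], subst real_L2.ip_scl_right[OF hL hL]) simp
    also have "\<dots> \<le> (K\<^sup>2 + 1) * real_ip \<pi> ?h ?h" by (intro mult_right_mono real_L2.ip_nonneg hL) auto
    finally show ?thesis by (simp add: field_simps add_pos_nonneg)
  qed
  then show ?thesis by (intro exI[of _ "1 / (K\<^sup>2 + 1)"]) (simp add: add_nonneg_pos)
qed

text \<open>The constant 1 and g both lie in the one-dimensional eigenspace, hence are multiples of
  one function; the multiple giving 1 is nonzero, so g is a quotient of two numbers.\<close>

lemma harmonic_imp_AE_const:
  assumes mult: "L2_multiplicity_one \<pi> (markov_op P) 1"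
    and g: "g \<in> real_L2 \<pi>" and harm: "AE x in \<pi>. transition g x = g x"
  shows "\<exists>c. AE x in \<pi>. g x = c"
proof -
  obtain g0 where g0: "\<And>f. f \<in> L2_eigenspace \<pi> (markov_op P) 1 \<Longrightarrow> \<exists>a. AE x in \<pi>. f x = a * g0 x"
    using mult unfolding L2_multiplicity_one_def by blast
  have e: "(\<lambda>x. complex_of_real (h x)) \<in> L2_eigenspace \<pi> (markov_op P) 1"
    if "h \<in> real_L2 \<pi>" "AE x in \<pi>. transition h x = h x" for h
    using that by (auto simp: L2_eigenspace_def of_real_L2 markov_op_of_real)
  obtain a where a: "AE x in \<pi>. complex_of_real 1 = a * g0 x"
    using g0[OF e[OF pi.real_L2_const[of 1]]] by auto
  obtain b where b: "AE x in \<pi>. complex_of_real (g x) = b * g0 x"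
    using g0[OF e[OF g harm]] by auto
  have "AE x in \<pi>. g x = Re (b / a)"
    using a b
  proof eventually_elim
    case (elim x)
    then have "a \<noteq> 0" by auto
    with elim have "complex_of_real (g x) = b / a" by (simp add: field_simps)
    then show ?case by (metis Re_complex_of_real)
  qed
  then show ?thesis ..
qed

lemma expectation_transition:
  assumes "g \<in> real_L2 \<pi>"
  shows "(\<integral>x. transition g x \<partial>\<pi>) = (\<integral>x. g x \<partial>\<pi>)"
  using real_L2.self_adjoint_swap[OF self_adjoint_transition assms pi.real_L2_const[of 1]]
  by (simp add: real_ip_def)

lemma transition_form_bound: "g \<in> real_L2 \<pi> \<Longrightarrow> \<bar>real_ip \<pi> (transition g) g\<bar> \<le> real_ip \<pi> g g"
  by (rule real_L2.contraction_form_bound[OF self_adjoint_transition transition_real_L2(2)])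


lemma in_range_of_complement_sum:
  assumes "\<And>k. real_L2.in_range_of_complement \<pi> transition (d k)"
  shows "real_L2.in_range_of_complement \<pi> transition (\<lambda>x. \<Sum>k<(n::nat). d k x)"
proof (induction n)
  case 0
  show ?case
    using pi.real_L2_const[of 0] unfolding real_L2.in_range_of_complement_def
    by (auto simp: real_ip_def intro!: bexI[of _ "\<lambda>x. 0"])
next
  case (Suc n)
  note T = self_adjoint_transition
  obtain w where w: "w \<in> real_L2 \<pi>" "(\<lambda>x. \<Sum>k<n. d k x) \<in> real_L2 \<pi>"
    "\<And>h. h \<in> real_L2 \<pi> \<Longrightarrow> real_ip \<pi> (\<lambda>x. \<Sum>k<n. d k x) h = real_ip \<pi> w h - real_ip \<pi> (transition w) h"
    using Suc.IH unfolding real_L2.in_range_of_complement_def by blast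
  obtain v where v: "v \<in> real_L2 \<pi>" "d n \<in> real_L2 \<pi>"
    "\<And>h. h \<in> real_L2 \<pi> \<Longrightarrow> real_ip \<pi> (d n) h = real_ip \<pi> v h - real_ip \<pi> (transition v) h"
    using assms[of n] unfolding real_L2.in_range_of_complement_def by blast
  have "real_ip \<pi> (\<lambda>x. (\<Sum>k<n. d k x) + d n x) h =
    real_ip \<pi> (\<lambda>x. w x + v x) h - real_ip \<pi> (transition (\<lambda>x. w x + v x)) h" if h: "h \<in> real_L2 \<pi>" for h
    using w v h by (simp add: real_L2.self_adjoint_ip_linear(1)[OF T])
  then show ?case
    unfolding real_L2.in_range_of_complement_def sum.lessThan_Suc
    using real_L2_add[OF w(2) v(2)] real_L2_add[OF w(1) v(1)] by blast
qed

text \<open>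
  With \<open>Q = (I + T) / 2\<close>, a mean zero \<open>g\<close> is the sum of the telescoping series
  \<open>(\<Sum>k. Q\<^sup>k g - Q\<^sup>k\<^sup>+\<^sup>1 g)\<close>, whose terms lie in the range of \<open>I - T\<close>: the series converges
  geometrically, and the difference of \<open>g\<close> and its sum is fixed by \<open>T\<close>, hence constant.
\<close>

lemma Poincare_of_spectrum:
  assumes mult: "L2_multiplicity_one \<pi> (markov_op P) 1" and \<delta>: "0 < \<delta>"
    and res: "\<And>l. 1 - \<delta> < l \<Longrightarrow> l < 1 \<Longrightarrow> complex_of_real l \<notin> L2_spectrum \<pi> (markov_op P)"
    and g: "g \<in> real_L2 \<pi>" and mean: "(\<integral>x. g x \<partial>\<pi>) = 0"
  shows "\<delta> * real_ip \<pi> g g \<le> real_ip \<pi> g g - real_ip \<pi> (transition g) g"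
proof -
  note T = self_adjoint_transition
  note TL = transition_real_L2(1)
  note Tn = transition_real_L2(2)
  have gap: "\<epsilon> * (real_ip \<pi> h h - real_ip \<pi> (transition h) h)
      \<le> real_ip \<pi> h h - 2 * real_ip \<pi> (transition h) h + real_ip \<pi> (transition h) (transition h)"
    if "h \<in> real_L2 \<pi>" "0 \<le> \<epsilon>" "\<epsilon> \<le> \<delta>" for h \<epsilon>
    using that by (intro real_L2.complement_norm_ge_form[OF T Tn] bounded_below_of_notin_spectrum res) auto
  \<comment> \<open>\<open>lazy_contracts_range\<close> asks for a parameter at most 1. Only the
    rate of convergence uses \<epsilon>; the final inequality is taken with \<delta> itself.\<close>
  define \<epsilon> where "\<epsilon> = min \<delta> 1"
  have \<epsilon>: "0 < \<epsilon>" "\<epsilon> \<le> 1" "\<epsilon> \<le> \<delta>" using \<delta> by (auto simp: \<epsilon>_def)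
  define Q where "Q h = (\<lambda>x. (1/2) * h x + (1/2) * transition h x)" for h
  have lazy: "real_L2.lazy transition h = Q h" for h
    unfolding Q_def using gap \<epsilon> by (intro real_L2.lazy_def[OF T Tn, of \<epsilon>]) auto
  have QL: "Q h \<in> real_L2 \<pi>" if "h \<in> real_L2 \<pi>" for h
    unfolding Q_def using that by (intro real_L2_add real_L2_scale TL)
  have ipQ: "real_ip \<pi> (Q h) f = 1/2 * real_ip \<pi> h f + 1/2 * real_ip \<pi> (transition h) f"
    if "h \<in> real_L2 \<pi>" "f \<in> real_L2 \<pi>" for h f
    unfolding Q_def using that TL[OF that(1)] by (simp only: real_L2.ip_add_left real_L2.ip_scl_left real_L2_scale)
  \<comment> \<open>g - Q g = (g - T g) / 2 is the first telescoping difference, and Q maps each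
    difference to the next.\<close>
  define d where "d k = (Q ^^ k) (\<lambda>x. (1/2) * g x + (-1/2) * transition g x)" for k
  have dS: "d (Suc k) = Q (d k)" for k by (simp add: d_def)
  have dr: "real_L2.in_range_of_complement \<pi> transition (d k)" for k
  proof (induction k)
    case 0
    have "real_ip \<pi> (\<lambda>x. (1/2) * g x + (-1/2) * transition g x) h =
      real_ip \<pi> (\<lambda>x. (1/2) * g x) h - real_ip \<pi> (transition (\<lambda>x. (1/2) * g x)) h" if h: "h \<in> real_L2 \<pi>" for h
      unfolding transition_scale using g h TL[OF g]
      by (simp only: real_L2.ip_add_left real_L2.ip_scl_left real_L2_scale)
    moreover have "(\<lambda>x. (1/2) * g x + (-1/2) * transition g x) \<in> real_L2 \<pi>" "(\<lambda>x. (1/2) * g x) \<in> real_L2 \<pi>"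
      by (intro real_L2_add real_L2_scale TL g)+
    ultimately show ?case
      unfolding real_L2.in_range_of_complement_def d_def funpow.simps id_apply by blast
  next
    case (Suc k)
    then show ?case
      unfolding dS lazy[symmetric] using gap \<epsilon> by (intro real_L2.in_range_lazy[OF T Tn, of \<epsilon>]) auto
  qed
  have dL: "d k \<in> real_L2 \<pi>" for k using dr[of k] by (simp add: real_L2.in_range_of_complement_def)
  have d0: "real_ip \<pi> (d 0) h = 1/2 * (real_ip \<pi> g h - real_ip \<pi> (transition g) h)" if h: "h \<in> real_L2 \<pi>" for h
    unfolding d_def funpow.simps id_apply using g h TL[OF g]
    by (simp only: real_L2.ip_add_left real_L2.ip_scl_left real_L2_scale) (simp add: algebra_simps)
  define q where "q = 1 - \<epsilon> / 2"
  have q: "0 < q" "q < 1" using \<epsilon> by (auto simp: q_def)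
  have dn: "real_ip \<pi> (d k) (d k) \<le> real_ip \<pi> (d 0) (d 0) * (q ^ k)\<^sup>2" for k
  proof (induction k)
    case (Suc k)
    have "real_ip \<pi> (d (Suc k)) (d (Suc k)) \<le> q\<^sup>2 * real_ip \<pi> (d k) (d k)"
      unfolding dS lazy[symmetric] q_def using gap \<epsilon>
      by (intro real_L2.lazy_contracts_range[OF T Tn] dr) auto
    also have "\<dots> \<le> q\<^sup>2 * (real_ip \<pi> (d 0) (d 0) * (q ^ k)\<^sup>2)" using Suc by (intro mult_left_mono) auto
    finally show ?case by (simp add: power_mult_distrib mult.left_commute)
  qed simp
  have "\<exists>s\<in>borel_measurable \<pi>. integrable \<pi> (\<lambda>x. (norm (s x))\<^sup>2) \<and>
    (\<lambda>n. \<integral>x. (norm (s x - (\<Sum>k<n. d k x)))\<^sup>2 \<partial>\<pi>) \<longlonglongrightarrow> 0"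
  proof (rule L2_geometric_series_converges[OF _ _ q])
    show "(\<integral>x. (norm (d k x))\<^sup>2 \<partial>\<pi>) \<le> real_ip \<pi> (d 0) (d 0) * (q ^ k)\<^sup>2" for k
      using dn[of k] by (simp add: real_ip_def power2_eq_square)
  qed (use dL in \<open>auto simp: real_L2_def\<close>)
  then obtain s where s: "s \<in> real_L2 \<pi>"
    and "(\<lambda>n. \<integral>x. (norm (s x - (\<Sum>k<n. d k x)))\<^sup>2 \<partial>\<pi>) \<longlonglongrightarrow> 0"
    by (auto simp: real_L2_def)
  define S where "S n = (\<lambda>x. \<Sum>k<n. d k x)" for n :: nat
  have lim: "(\<lambda>n. real_ip \<pi> (\<lambda>x. s x - S n x) (\<lambda>x. s x - S n x)) \<longlonglongrightarrow> 0"
    using \<open>(\<lambda>n. \<integral>x. (norm (s x - (\<Sum>k<n. d k x)))\<^sup>2 \<partial>\<pi>) \<longlonglongrightarrow> 0\<close>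
    by (simp add: S_def real_ip_def power2_eq_square)
  have Sr: "real_L2.in_range_of_complement \<pi> transition (S n)" for n
    unfolding S_def by (rule in_range_of_complement_sum[OF dr])
  have SL: "S n \<in> real_L2 \<pi>" for n using Sr[of n] by (simp add: real_L2.in_range_of_complement_def)
  have SS: "S (Suc n) = (\<lambda>x. S n x + d n x)" for n by (simp add: S_def)
  have S0: "S 0 = (\<lambda>x. 0)" by (simp add: S_def)
  have limS: "(\<lambda>n. real_ip \<pi> (S n) h) \<longlonglongrightarrow> real_ip \<pi> s h" if "h \<in> real_L2 \<pi>" for h
    by (rule real_ip_tendsto[OF SL s that lim])
  \<comment> \<open>I - T = 2 (I - Q), so applying I - T to the partial sum telescopes.\<close>
  have SB: "real_ip \<pi> (S n) h - real_ip \<pi> (S n) (transition h) = 2 * real_ip \<pi> (d 0) h - 2 * real_ip \<pi> (d n) h"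
    if h: "h \<in> real_L2 \<pi>" for h n
  proof (induction n)
    case (Suc n)
    have "real_ip \<pi> (d n) (transition h) = real_ip \<pi> (transition (d n)) h"
      by (rule real_L2.self_adjoint_swap[OF T dL h, symmetric])
    then show ?case
      using Suc SL[of n] dL[of n] h TL[OF h] by (simp add: SS dS ipQ[OF dL h])
  qed (simp add: S0 real_ip_def)
  have dlim: "(\<lambda>n. real_ip \<pi> (d n) h) \<longlonglongrightarrow> 0" if h: "h \<in> real_L2 \<pi>" for h
  proof -
    have "(\<lambda>n. real_ip \<pi> (S (Suc n)) h - real_ip \<pi> (S n) h) \<longlonglongrightarrow> real_ip \<pi> s h - real_ip \<pi> s h"
      by (intro tendsto_diff limS[OF h] LIMSEQ_Suc[OF limS[OF h]])
    then show ?thesis using SL dL h by (simp add: SS)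
  qed
  have weak: "real_ip \<pi> s h - real_ip \<pi> (transition s) h = real_ip \<pi> g h - real_ip \<pi> (transition g) h"
    if h: "h \<in> real_L2 \<pi>" for h
  proof -
    have "(\<lambda>n. real_ip \<pi> (S n) h - real_ip \<pi> (S n) (transition h)) \<longlonglongrightarrow> real_ip \<pi> s h - real_ip \<pi> s (transition h)"
      by (intro tendsto_diff limS h TL)
    moreover have "(\<lambda>n. real_ip \<pi> (S n) h - real_ip \<pi> (S n) (transition h)) \<longlonglongrightarrow> 2 * real_ip \<pi> (d 0) h - 2 * 0"
      unfolding SB[OF h] by (intro tendsto_intros dlim h)
    ultimately have "real_ip \<pi> s h - real_ip \<pi> s (transition h) = 2 * real_ip \<pi> (d 0) h"
      using LIMSEQ_unique by fastforce
    then show ?thesis using d0[OF h] real_L2.self_adjoint_swap[OF T s h] by simp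
  qed
  \<comment> \<open>Twice \<open>d 0\<close> is (I - T) g, so \<open>weak\<close> says that I - T
    annihilates g - s in all pairings. Pairing with the residual r itself turns this into equality
    almost everywhere.\<close>
  define y where "y = (\<lambda>x. g x - s x)"
  have yL: "y \<in> real_L2 \<pi>" unfolding y_def by (intro real_L2_diff g s)
  define r where "r = (\<lambda>x. y x - transition y x)"
  have rL: "r \<in> real_L2 \<pi>" unfolding r_def by (intro real_L2_diff yL TL)
  have "real_ip \<pi> r r = real_ip \<pi> y r - real_ip \<pi> y (transition r)"
    unfolding r_def using yL TL[OF yL] rL[unfolded r_def]
    by (subst real_ip_diff_left) (auto simp: real_L2.self_adjoint_swap[OF T])
  also have "\<dots> = real_ip \<pi> g r - real_ip \<pi> (transition g) r - (real_ip \<pi> s r - real_ip \<pi> (transition s) r)"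
    unfolding y_def using g s rL TL[OF rL] by (simp add: real_ip_diff_left real_L2.self_adjoint_swap[OF T])
  also have "\<dots> = 0" using weak[OF rL] by simp
  finally have "AE x in \<pi>. r x = 0" by (rule AE_eq_0_of_real_ip[OF rL])
  then have "AE x in \<pi>. transition y x = y x" by eventually_elim (simp add: r_def)
  then obtain c where c: "AE x in \<pi>. y x = c" using harmonic_imp_AE_const[OF mult yL] by auto
  have one: "(\<lambda>x. 1) \<in> real_L2 \<pi>" by (rule pi.real_L2_const)
  \<comment> \<open>All terms have mean zero, hence so has s; this forces the constant c to be
    0.\<close>
  have d1: "real_ip \<pi> (d k) (\<lambda>x. 1) = 0" for k
  proof (induction k)
    case 0
    show ?case using d0[OF one] expectation_transition[OF g] mean by (simp add: real_ip_def)
  next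
    case (Suc k)
    then show ?case
      using expectation_transition[OF dL[of k]] by (simp add: dS ipQ[OF dL one]) (simp add: real_ip_def)
  qed
  have "real_ip \<pi> (S n) (\<lambda>x. 1) = 0" for n
  proof (induction n)
    case (Suc n)
    then show ?case unfolding SS real_L2.ip_add_left[OF SL dL one] using d1 by simp
  qed (simp add: S0 real_ip_def)
  then have "real_ip \<pi> s (\<lambda>x. 1) = 0" using limS[OF one] by (simp add: LIMSEQ_const_iff)
  moreover have "(\<integral>x. y x \<partial>\<pi>) = (\<integral>x. g x \<partial>\<pi>) - (\<integral>x. s x \<partial>\<pi>)"
    unfolding y_def using g s by (intro Bochner_Integration.integral_diff pi.real_L2_integrable)
  ultimately have "(\<integral>x. y x \<partial>\<pi>) = 0" using mean by (simp add: real_ip_def)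
  moreover have "(\<integral>x. y x \<partial>\<pi>) = (\<integral>x. c \<partial>\<pi>)" using c yL by (intro integral_cong_AE) auto
  ultimately have "c = 0" by (simp add: pi.prob_space)
  with c have gs: "AE x in \<pi>. s x = g x" by (auto simp: y_def)
  have sg: "real_ip \<pi> s h = real_ip \<pi> g h" if "h \<in> real_L2 \<pi>" for h
    using gs s g that by (intro real_ip_cong_AE) auto
  have eL: "(\<lambda>x. s x - S n x) \<in> real_L2 \<pi>" for n by (intro real_L2_diff s SL)
  \<comment> \<open>S n tends to s in norm, and s equals g almost everywhere. The errors in the two
    forms are e and e', and e' is dominated by e because P is a contraction, so the inequality known
    on the range passes to the limit.\<close>
  define e where "e n = real_ip \<pi> (\<lambda>x. s x - S n x) (\<lambda>x. s x - S n x)" for n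
  define e' where "e' n = real_ip \<pi> (transition (\<lambda>x. s x - S n x)) (\<lambda>x. s x - S n x)" for n
  have e0: "e \<longlonglongrightarrow> 0" using lim unfolding e_def .
  have e'0: "e' \<longlonglongrightarrow> 0"
    by (rule Lim_null_comparison[OF _ e0])
       (use real_L2.contraction_form_bound[OF T Tn eL] in \<open>simp add: e_def e'_def\<close>)
  have ee: "real_ip \<pi> (S n) (S n) = 2 * real_ip \<pi> (S n) s - real_ip \<pi> s s + e n" for n
    unfolding e_def using s SL[of n] eL[of n]
    by (simp add: real_ip_diff_left real_ip_diff_right real_ip_commute[of \<pi> s "S n"])
  have ee': "real_ip \<pi> (transition (S n)) (S n) = 2 * real_ip \<pi> (S n) (transition s) - real_ip \<pi> (transition s) s + e' n" for n
  proof -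
    have "e' n = real_ip \<pi> s (transition (\<lambda>x. s x - S n x)) - real_ip \<pi> (S n) (transition (\<lambda>x. s x - S n x))"
      unfolding e'_def real_ip_commute[of \<pi> "transition (\<lambda>x. s x - S n x)"]
      by (rule real_ip_diff_left[OF s SL TL[OF eL]])
    also have "\<dots> = real_ip \<pi> (transition s) (\<lambda>x. s x - S n x) - real_ip \<pi> (transition (S n)) (\<lambda>x. s x - S n x)"
      using s SL eL by (simp add: real_L2.self_adjoint_swap[OF T])
    also have "\<dots> = real_ip \<pi> (transition s) s - real_ip \<pi> (transition s) (S n)
        - (real_ip \<pi> (transition (S n)) s - real_ip \<pi> (transition (S n)) (S n))"
      by (simp only: real_ip_diff_right[OF s SL TL[OF s]] real_ip_diff_right[OF s SL TL[OF SL]])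
    also have "real_ip \<pi> (transition (S n)) s = real_ip \<pi> (S n) (transition s)"
      by (rule real_L2.self_adjoint_swap[OF T SL s])
    finally show ?thesis by (simp add: real_ip_commute[of \<pi> "transition s" "S n"])
  qed
  have "(\<lambda>n. \<delta> * real_ip \<pi> (S n) (S n)) \<longlonglongrightarrow> \<delta> * (2 * real_ip \<pi> s s - real_ip \<pi> s s + 0)"
    unfolding ee by (intro tendsto_intros limS s e0)
  moreover have "(\<lambda>n. real_ip \<pi> (S n) (S n) - real_ip \<pi> (transition (S n)) (S n)) \<longlonglongrightarrow>
      (2 * real_ip \<pi> s s - real_ip \<pi> s s + 0) - (2 * real_ip \<pi> s (transition s) - real_ip \<pi> (transition s) s + 0)"
    unfolding ee ee' by (intro tendsto_intros limS s TL e0 e'0)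
  moreover have "\<delta> * real_ip \<pi> (S n) (S n) \<le> real_ip \<pi> (S n) (S n) - real_ip \<pi> (transition (S n)) (S n)" for n
    using gap \<delta> by (intro real_L2.form_ge_on_range[OF T Tn] Sr) auto
  ultimately have "\<delta> * (2 * real_ip \<pi> s s - real_ip \<pi> s s + 0) \<le>
     (2 * real_ip \<pi> s s - real_ip \<pi> s s + 0) - (2 * real_ip \<pi> s (transition s) - real_ip \<pi> (transition s) s + 0)"
    by (intro LIMSEQ_le) auto
  moreover have "real_ip \<pi> s s = real_ip \<pi> g g" using sg[OF s] sg[OF g] by (simp add: real_ip_commute)
  moreover have "real_ip \<pi> s (transition s) = real_ip \<pi> g (transition g)"
    using sg[OF TL[OF s]] sg[OF TL[OF g]] real_L2.self_adjoint_swap[OF T s g]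
    by (simp add: real_ip_commute)
  ultimately show ?thesis by (simp add: real_ip_commute[of \<pi> "transition _"])
qed


section \<open>The two gaps, form bounds and the fundamental operator\<close>

lemma spectral_gap_resolvent:
  assumes "1 - spectral_gap P \<pi> < l" "l < 1" "L2_multiplicity_one \<pi> (markov_op P) 1"
  shows "complex_of_real l \<notin> L2_spectrum \<pi> (markov_op P)"
proof
  assume l: "complex_of_real l \<in> L2_spectrum \<pi> (markov_op P)"
  define A where "A = {l::real. complex_of_real l \<in> L2_spectrum \<pi> (markov_op P) \<and> l \<noteq> 1}"
  have lA: "l \<in> A" using l assms(2) by (simp add: A_def)
  have "bdd_above A"
    using spectrum_in_unit_disc by (intro bdd_aboveI[of _ 1]) (force simp: A_def)
  with lA have "l \<le> Sup A" by (rule cSup_upper)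
  moreover have "spectral_gap P \<pi> = 1 - Sup A"
    using lA assms(3) by (auto simp: spectral_gap_def gap_Sup_def A_def)
  ultimately show False using assms(1) by simp
qed

lemma spectral_gap_pos_imp_multiplicity_one:
  "0 < spectral_gap P \<pi> \<Longrightarrow> L2_multiplicity_one \<pi> (markov_op P) 1"
  by (auto simp: spectral_gap_def split: if_splits)

lemma abs_spectral_gap_resolvent:
  assumes "1 - abs_spectral_gap P \<pi> < \<bar>l\<bar>" "l \<noteq> 1" "L2_multiplicity_one \<pi> (markov_op P) 1"
  shows "complex_of_real l \<notin> L2_spectrum \<pi> (markov_op P)"
proof
  assume l: "complex_of_real l \<in> L2_spectrum \<pi> (markov_op P)"
  define A where "A = {cmod l | l. l \<in> L2_spectrum \<pi> (markov_op P) \<and> l \<noteq> 1}"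
  have lA: "\<bar>l\<bar> \<in> A" using l assms(2) by (auto simp: A_def intro!: exI[of _ "complex_of_real l"])
  have "bdd_above A"
    using spectrum_in_unit_disc by (intro bdd_aboveI[of _ 1]) (auto simp: A_def)
  with lA have "\<bar>l\<bar> \<le> Sup A" by (rule cSup_upper)
  moreover have "abs_spectral_gap P \<pi> = 1 - Sup A"
    using lA assms(3) by (auto simp: abs_spectral_gap_def gap_Sup_def A_def)
  ultimately show False using assms(1) by simp
qed

lemma abs_spectral_gap_pos_imp_multiplicity_one:
  "0 < abs_spectral_gap P \<pi> \<Longrightarrow> L2_multiplicity_one \<pi> (markov_op P) 1"
  by (auto simp: abs_spectral_gap_def split: if_splits)

lemma abs_spectral_gap_le_1: "abs_spectral_gap P \<pi> \<le> 1"
proof -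
  define A where "A = {cmod l | l. l \<in> L2_spectrum \<pi> (markov_op P) \<and> l \<noteq> 1}"
  have "bdd_above A"
    using spectrum_in_unit_disc by (intro bdd_aboveI[of _ 1]) (auto simp: A_def)
  have "0 \<le> gap_Sup A"
  proof (cases "A = {}")
    case False
    then obtain a where a: "a \<in> A" by auto
    then have "0 \<le> a" by (auto simp: A_def)
    also have "a \<le> Sup A" by (rule cSup_upper) fact+
    finally show ?thesis using False by (simp add: gap_Sup_def)
  qed (simp add: gap_Sup_def)
  then show ?thesis by (simp add: abs_spectral_gap_def A_def)
qed

definition Dirichlet :: "('a \<Rightarrow> real) \<Rightarrow> real" where
  "Dirichlet g = real_ip \<pi> g g - real_ip \<pi> (transition g) g"

lemma real_L2_center: "g \<in> real_L2 \<pi> \<Longrightarrow> (\<lambda>x. g x - c) \<in> real_L2 \<pi>"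
  by (intro real_L2_diff pi.real_L2_const)

lemma real_ip_center:
  assumes g: "g \<in> real_L2 \<pi>"
  defines "m \<equiv> \<integral>x. g x \<partial>\<pi>"
  shows "real_ip \<pi> (\<lambda>x. g x - m) (\<lambda>x. g x - m) = real_ip \<pi> g g - m\<^sup>2"
    and "real_ip \<pi> (transition (\<lambda>x. g x - m)) (\<lambda>x. g x - m) = real_ip \<pi> (transition g) g - m\<^sup>2"
    and "(\<integral>x. g x - m \<partial>\<pi>) = 0"
proof -
  note T = self_adjoint_transition and c = pi.real_L2_const[of m]
  have gc: "real_ip \<pi> g (\<lambda>x. m) = m\<^sup>2" "real_ip \<pi> (\<lambda>x. m) (\<lambda>x. m) = m\<^sup>2"
    by (simp_all add: real_ip_def m_def power2_eq_square pi.prob_space)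
  have tc: "real_ip \<pi> (transition g) (\<lambda>x. m) = m\<^sup>2"
    unfolding real_L2.self_adjoint_swap[OF T g c] by (simp add: gc)
  show "real_ip \<pi> (\<lambda>x. g x - m) (\<lambda>x. g x - m) = real_ip \<pi> g g - m\<^sup>2"
    using g c real_L2_diff[OF g c] gc
    by (simp add: real_ip_diff_left real_ip_diff_right real_ip_commute[of \<pi> "\<lambda>x. m" g])
  have "real_ip \<pi> (transition (\<lambda>x. g x - m)) (\<lambda>x. g x - m) =
     real_ip \<pi> (\<lambda>x. transition g x - m) (\<lambda>x. g x - m)"
    using AE_transition_diff[OF g c] g c transition_real_L2 real_L2_diff
    by (intro real_ip_cong_AE) auto
  also have "\<dots> = real_ip \<pi> (transition g) g - m\<^sup>2"
    using g c real_L2_diff[OF g c] gc tc transition_real_L2(1)[OF g]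
    by (simp add: real_ip_diff_left real_ip_diff_right real_ip_commute[of \<pi> "\<lambda>x. m" g])
  finally show "real_ip \<pi> (transition (\<lambda>x. g x - m)) (\<lambda>x. g x - m) = real_ip \<pi> (transition g) g - m\<^sup>2" .
  show "(\<integral>x. g x - m \<partial>\<pi>) = 0"
    using pi.real_L2_integrable[OF g] by (simp add: m_def pi.prob_space)
qed

lemma Dirichlet_nonneg: "g \<in> real_L2 \<pi> \<Longrightarrow> 0 \<le> Dirichlet g"
  using transition_form_bound[of g] by (simp add: Dirichlet_def abs_le_iff)

lemma Poincare_inequality:
  assumes "0 < spectral_gap P \<pi>" and g: "g \<in> real_L2 \<pi>"
  shows "spectral_gap P \<pi> * (real_ip \<pi> g g - (\<integral>x. g x \<partial>\<pi>)\<^sup>2) \<le> Dirichlet g"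
  using Poincare_of_spectrum[OF spectral_gap_pos_imp_multiplicity_one[OF assms(1)] assms(1)
      spectral_gap_resolvent real_L2_center[OF g] real_ip_center(3)[OF g]]
    spectral_gap_pos_imp_multiplicity_one[OF assms(1)]
  by (simp add: real_ip_center[OF g] Dirichlet_def)

text \<open>P >= -I makes the Dirichlet form at most twice the variance; the Poincare inequality at
  one function of positive variance then bounds the gap. It supplies the range g <= 2 of the growth
  rate estimates.\<close>

lemma spectral_gap_le_2:
  assumes \<gamma>: "0 < spectral_gap P \<pi>" and g: "g \<in> real_L2 \<pi>" and V: "(\<integral>x. g x \<partial>\<pi>)\<^sup>2 < real_ip \<pi> g g"
  shows "spectral_gap P \<pi> \<le> 2"
proof -
  let ?m = "\<integral>x. g x \<partial>\<pi>"
  have "spectral_gap P \<pi> * (real_ip \<pi> g g - ?m\<^sup>2) \<le> Dirichlet g" by (rule Poincare_inequality[OF \<gamma> g])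
  also have "\<dots> = (real_ip \<pi> g g - ?m\<^sup>2) - (real_ip \<pi> (transition g) g - ?m\<^sup>2)" by (simp add: Dirichlet_def)
  also have "\<dots> \<le> 2 * (real_ip \<pi> g g - ?m\<^sup>2)"
    using transition_form_bound[OF real_L2_center[OF g], of ?m] unfolding real_ip_center[OF g] by (simp add: abs_le_iff)
  finally show ?thesis by (rule mult_right_le_imp_le) (use V in simp)
qed

text \<open>On mean zero functions the upper half is the Poincare inequality with the absolute gap.
  The lower half is \<open>form_ge_of_bounded_below\<close>, since every l below -(1 - absolute gap)
  lies outside the spectrum.\<close>

lemma abs_gap_form_bound:
  assumes \<gamma>: "0 < abs_spectral_gap P \<pi>" and g: "g \<in> real_L2 \<pi>"
  shows "\<bar>real_ip \<pi> (transition g) g - (\<integral>x. g x \<partial>\<pi>)\<^sup>2\<bar>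
    \<le> (1 - abs_spectral_gap P \<pi>) * (real_ip \<pi> g g - (\<integral>x. g x \<partial>\<pi>)\<^sup>2)"
proof -
  let ?\<gamma> = "abs_spectral_gap P \<pi>" and ?g = "\<lambda>x. g x - (\<integral>x. g x \<partial>\<pi>)"
  note mult = abs_spectral_gap_pos_imp_multiplicity_one[OF \<gamma>]
  have "?\<gamma> * real_ip \<pi> ?g ?g \<le> real_ip \<pi> ?g ?g - real_ip \<pi> (transition ?g) ?g"
    using abs_spectral_gap_le_1
    by (intro Poincare_of_spectrum[OF mult \<gamma> abs_spectral_gap_resolvent] real_L2_center g real_ip_center mult) auto
  moreover have "- (1 - ?\<gamma>) * real_ip \<pi> ?g ?g \<le> real_ip \<pi> (transition ?g) ?g"
    using abs_spectral_gap_le_1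
    by (intro real_L2.form_ge_of_bounded_below[OF self_adjoint_transition transition_real_L2(2)]
        bounded_below_of_notin_spectrum abs_spectral_gap_resolvent real_L2_center g mult) auto
  ultimately show ?thesis by (simp add: real_ip_center[OF g] abs_le_iff algebra_simps)
qed

text \<open>
  \<open>I - P + \<pi>\<close> is \<open>2 (I - U / 2)\<close> for the positive operator \<open>U = I + P - \<pi>\<close>, whose norm is at most
  \<open>max (2 - \<gamma>) 1 < 2\<close>.
\<close>

lemma fundamental_operator_invertible:
  assumes \<gamma>: "0 < spectral_gap P \<pi>"
  shows "\<exists>B. L2_is_inverse \<pi> (\<lambda>g x. g x - (markov_op P g x - mean_op \<pi> g x)) B"
proof -
  note T = self_adjoint_transition
  define M where "M = max (2 - spectral_gap P \<pi>) 1"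
  have M: "1 \<le> M" "M < 2" using \<gamma> by (auto simp: M_def)
  define U where "U g x = g x + transition g x - (\<integral>y. g y \<partial>\<pi>)" for g x
  have UL: "U g \<in> real_L2 \<pi>" if "g \<in> real_L2 \<pi>" for g
    unfolding U_def[abs_def] using that by (intro real_L2_center real_L2_add transition_real_L2)
  have ipU: "real_ip \<pi> (U g) h = real_ip \<pi> g h + real_ip \<pi> (transition g) h - (\<integral>y. g y \<partial>\<pi>) * (\<integral>y. h y \<partial>\<pi>)"
    if "g \<in> real_L2 \<pi>" "h \<in> real_L2 \<pi>" for g h
    unfolding U_def[abs_def]
    using that real_L2_add[OF that(1) transition_real_L2(1)[OF that(1)]] transition_real_L2(1)[OF that(1)] pi.real_L2_const
    by (subst real_ip_diff_left) (auto, simp add: real_ip_def)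
  have U: "real_L2.self_adjoint \<pi> U"
    unfolding real_L2.self_adjoint_def
  proof (intro conjI ballI UL)
    fix f g assume "f \<in> real_L2 \<pi>" "g \<in> real_L2 \<pi>"
    then show "real_ip \<pi> (U f) g = real_ip \<pi> f (U g)"
      using real_L2.self_adjoint_swap[OF T] by (simp add: ipU real_ip_commute[of \<pi> f])
  qed
  have Upos: "0 \<le> real_ip \<pi> (U g) g" if g: "g \<in> real_L2 \<pi>" for g
    using transition_form_bound[OF real_L2_center[OF g], of "\<integral>y. g y \<partial>\<pi>"]
      zero_le_square[of "\<integral>y. g y \<partial>\<pi>"]
    unfolding ipU[OF g g] real_ip_center[OF g] power2_eq_square[of "pi.expectation g"] abs_le_iff by linarith
  have Ule: "real_ip \<pi> (U g) g \<le> M * real_ip \<pi> g g" if g: "g \<in> real_L2 \<pi>" for g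
  proof -
    let ?m = "\<integral>y. g y \<partial>\<pi>"
    have V: "0 \<le> real_ip \<pi> g g - ?m\<^sup>2"
      using real_L2.ip_nonneg[OF real_L2_center[OF g, of ?m]] unfolding real_ip_center[OF g] .
    have "real_ip \<pi> (U g) g = (real_ip \<pi> g g - ?m\<^sup>2) * 2 - Dirichlet g + ?m\<^sup>2"
      unfolding ipU[OF g g] by (simp add: Dirichlet_def power2_eq_square)
    also have "\<dots> \<le> (2 - spectral_gap P \<pi>) * (real_ip \<pi> g g - ?m\<^sup>2) + 1 * ?m\<^sup>2"
      using Poincare_inequality[OF \<gamma> g] by (simp add: algebra_simps)
    also have "\<dots> \<le> M * (real_ip \<pi> g g - ?m\<^sup>2) + M * ?m\<^sup>2"
      using V by (intro add_mono mult_right_mono) (auto simp: M_def)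
    finally show ?thesis by (simp add: algebra_simps)
  qed
  have Un: "real_ip \<pi> (U g) (U g) \<le> M\<^sup>2 * real_ip \<pi> g g" if g: "g \<in> real_L2 \<pi>" for g
  proof -
    have "real_ip \<pi> (U g) (U g) \<le> M * real_ip \<pi> (U g) g"
      using M by (intro real_L2.psd_norm_bound[OF U] Upos Ule UL g) auto
    also have "\<dots> \<le> M * (M * real_ip \<pi> g g)" using M Ule[OF g] by (intro mult_left_mono) auto
    finally show ?thesis by (simp add: power2_eq_square)
  qed
  let ?W = "\<lambda>f x. mean_op \<pi> f x - markov_op P f x"
  have W: "L2_bounded_linear \<pi> ?W"
    by (rule L2_bounded_linear_op_diff[OF pi.L2_bounded_linear_mean_op L2_bounded_linear_markov_op])
  note CU = L2_bounded_linear_shift[OF W, of 1]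
  \<comment> \<open>With W = \<pi> - P, \<open>1 * f x - ?W f x\<close> is U f = f + P f - \<pi> f,
    and subtracting it from 2 f gives I - P + \<pi>.\<close>
  have "\<exists>B. L2_is_inverse \<pi> (\<lambda>f x. 2 * f x - (1 * f x - ?W f x)) B"
  proof (rule L2_Neumann_inverse[OF CU, where q = "M / 2"])
    fix f assume f: "f \<in> L2 \<pi>"
    let ?h = "\<lambda>x. 1 * f x - ?W f x"
    have hL: "?h \<in> L2 \<pi>" by (rule L2_bounded_linear_closed[OF CU f])
    have mean: "Re (\<integral>x. f x \<partial>\<pi>) = (\<integral>x. Re (f x) \<partial>\<pi>)" "Im (\<integral>x. f x \<partial>\<pi>) = (\<integral>x. Im (f x) \<partial>\<pi>)"
      using pi.L2_integrable[OF f] by simp_all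
    \<comment> \<open>U commutes with taking real and imaginary parts almost everywhere, so the real
      bound \<open>Un\<close> applies to each part and the squares add up.\<close>
    have "real_ip \<pi> (\<lambda>x. Re (?h x)) (\<lambda>x. Re (?h x)) = real_ip \<pi> (U (\<lambda>x. Re (f x))) (U (\<lambda>x. Re (f x)))"
      using AE_Re_Im_markov_op[OF f] L2_Re[OF hL] UL[OF L2_Re[OF f]]
      by (intro real_ip_cong_AE) (auto simp: U_def mean_op_def mean real_L2_measurable elim!: eventually_mono)
    moreover have "real_ip \<pi> (\<lambda>x. Im (?h x)) (\<lambda>x. Im (?h x)) = real_ip \<pi> (U (\<lambda>x. Im (f x))) (U (\<lambda>x. Im (f x)))"
      using AE_Re_Im_markov_op[OF f] L2_Im[OF hL] UL[OF L2_Im[OF f]]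
      by (intro real_ip_cong_AE) (auto simp: U_def mean_op_def mean real_L2_measurable elim!: eventually_mono)
    ultimately have "(L2_norm \<pi> ?h)\<^sup>2 \<le> M\<^sup>2 * (L2_norm \<pi> f)\<^sup>2"
      using Un[OF L2_Re[OF f]] Un[OF L2_Im[OF f]]
      by (simp only: L2_norm_Re_Im[OF f] L2_norm_Re_Im[OF hL] distrib_left)
    then have "(L2_norm \<pi> ?h)\<^sup>2 \<le> (M * L2_norm \<pi> f)\<^sup>2" by (simp add: power_mult_distrib)
    then have "L2_norm \<pi> ?h \<le> M * L2_norm \<pi> f" by (rule power2_le_imp_le) (use M in simp)
    then show "L2_norm \<pi> ?h \<le> M / 2 * cmod 2 * L2_norm \<pi> f" by simp
  qed (use M in auto)
  then show ?thesis by (simp add: algebra_simps)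
qed

text \<open>\<phi> is the real part of (I - P + \<pi>)^-1 g; the inverse picked by
  \<open>SOME\<close> is a genuine one because the operator is invertible. Integrating the equation
  against \<pi> gives E \<phi> = 0, so the \<pi> term drops out and the Poisson equation
  remains.\<close>

lemma asymptotic_variance_Poisson:
  assumes \<gamma>: "0 < spectral_gap P \<pi>" and f: "f \<in> real_L2 \<pi>"
  defines "g \<equiv> \<lambda>x. f x - (\<integral>y. f y \<partial>\<pi>)"
  obtains \<phi> where "\<phi> \<in> real_L2 \<pi>" "(\<integral>x. \<phi> x \<partial>\<pi>) = 0" "AE x in \<pi>. \<phi> x - transition \<phi> x = g x"
    "asymptotic_variance P \<pi> f = 2 * real_ip \<pi> g \<phi> - real_ip \<pi> g g"
proof -
  let ?A = "\<lambda>g x. g x - (markov_op P g x - mean_op \<pi> g x)"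
  define R where "R = L2_inv \<pi> ?A"
  have R: "L2_is_inverse \<pi> ?A R"
    unfolding R_def L2_inv_def by (rule someI_ex[OF fundamental_operator_invertible[OF \<gamma>]])
  have gL: "g \<in> real_L2 \<pi>" unfolding g_def by (rule real_L2_center[OF f])
  let ?g = "\<lambda>x. complex_of_real (g x)"
  have gC: "?g \<in> L2 \<pi>" by (rule of_real_L2[OF gL])
  define h where "h = R ?g"
  have hL: "h \<in> L2 \<pi>"
    using R gC unfolding L2_is_inverse_def h_def by (blast intro: L2_bounded_linear_closed)
  have "\<And>f. f \<in> L2 \<pi> \<Longrightarrow> AE x in \<pi>. ?A (R f) x = f x" using R by (simp add: L2_is_inverse_def)
  from this[OF gC] have Ah: "AE x in \<pi>. ?A h x = ?g x" unfolding h_def .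
  define \<phi> where "\<phi> x = Re (h x)" for x
  have \<phi>L: "\<phi> \<in> real_L2 \<pi>" unfolding \<phi>_def by (rule L2_Re[OF hL])
  have mean: "Re (\<integral>x. h x \<partial>\<pi>) = (\<integral>x. \<phi> x \<partial>\<pi>)"
    using pi.L2_integrable[OF hL] by (simp add: \<phi>_def)
  have eq: "AE x in \<pi>. \<phi> x - transition \<phi> x + (\<integral>x. \<phi> x \<partial>\<pi>) = g x"
    using Ah AE_Re_Im_markov_op[OF hL]
  proof eventually_elim
    case (elim x)
    from elim(1) have "Re (?A h x) = g x" by simp
    with elim(2) show ?case by (simp add: mean_op_def mean \<phi>_def[abs_def])
  qed
  have i: "integrable \<pi> \<phi>" "integrable \<pi> (transition \<phi>)"
    by (intro pi.real_L2_integrable \<phi>L transition_real_L2)+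
  have "(\<integral>x. \<phi> x - transition \<phi> x + (\<integral>x. \<phi> x \<partial>\<pi>) \<partial>\<pi>) = (\<integral>x. g x \<partial>\<pi>)"
    using eq gL \<phi>L transition_real_L2(1)[OF \<phi>L] by (intro integral_cong_AE) auto
  then have m0: "(\<integral>x. \<phi> x \<partial>\<pi>) = 0"
    using i real_ip_center(3)[OF f] expectation_transition[OF \<phi>L] by (simp add: g_def)
  have "asymptotic_variance P \<pi> f = Re (\<integral>x. ?g x * cnj (2 * h x - ?g x) \<partial>\<pi>)"
    by (simp add: asymptotic_variance_def L2_inner_def Let_def h_def R_def g_def)
  also have "\<dots> = (\<integral>x. Re (?g x * cnj (2 * h x - ?g x)) \<partial>\<pi>)"
  proof (rule integral_Re[symmetric])
    have e: "?g x * cnj (2 * h x - ?g x) = of_real (2 * (g x * Re (h x)) - g x * g x) - \<i> * of_real (2 * (g x * Im (h x)))" for x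
      by (simp add: complex_eq_iff algebra_simps)
    show "integrable \<pi> (\<lambda>x. ?g x * cnj (2 * h x - ?g x))"
      unfolding e
      by (intro Bochner_Integration.integrable_diff integrable_of_real integrable_mult_right real_L2_integrable_mult gL L2_Re L2_Im hL)
  qed
  also have "\<dots> = (\<integral>x. 2 * (g x * \<phi> x) - g x * g x \<partial>\<pi>)" by (simp add: \<phi>_def algebra_simps)
  also have "\<dots> = 2 * real_ip \<pi> g \<phi> - real_ip \<pi> g g"
    using real_L2_integrable_mult[OF gL \<phi>L] real_L2_integrable_mult[OF gL gL] by (simp add: real_ip_def)
  finally show thesis using eq m0 \<phi>L by (intro that[of \<phi>]) auto
qed

end

section \<open>Exponential tilting\<close>

text \<open>Division by v reduces this to \<sigma> = s / v. The second inequality is the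
  discriminant condition of \<open>tilted_form_bound\<close>: p + v/2 - x v/2 and 1 - x bound the
  two diagonal coefficients from below, and s + 27/20 x v bounds the squared cross term apart from
  (1 + p)^2.\<close>

lemma growth_rate_bound:
  fixes g x v s p :: real
  assumes g: "0 < g" "g \<le> 2" and x: "0 \<le> x" "x \<le> 1/5" and v: "0 \<le> v" "v \<le> (g * x)\<^sup>2"
    and s: "v / 2 \<le> s" "g * s \<le> v"
  defines "p \<equiv> s - v / 5 + (5 * x + 25 * x\<^sup>2) * (s - v / 10)"
  shows "0 \<le> p" and "(1 + p)\<^sup>2 * (s + 27/20 * x * v) \<le> (p + v / 2 - x * v / 2) * (1 - x)"
proof -
  have "0 \<le> p \<and> (1 + p)\<^sup>2 * (s + 27/20 * x * v) \<le> (p + v / 2 - x * v / 2) * (1 - x)"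
  proof (cases "v = 0")
    case True
    with s g have "s = 0" by (simp add: mult_le_0_iff)
    with True show ?thesis by (simp add: p_def)
  next
    case False
    define \<sigma> where "\<sigma> = s / v"
    have s': "s = v * \<sigma>" using False by (simp add: \<sigma>_def)
    have \<sigma>: "1/2 \<le> \<sigma>" "g * \<sigma> \<le> 1" using False v s by (auto simp: \<sigma>_def field_simps)
    have p: "p = v * (\<sigma> - 1/5 + (5 * x + 25 * x\<^sup>2) * (\<sigma> - 1/10))"
      by (simp add: p_def s' algebra_simps)
    note bound = growth_rate_polynomial_bound[OF g x v \<sigma>, folded p]
    have "(1 + p)\<^sup>2 * (s + 27/20 * x * v) = v * ((1 + p)\<^sup>2 * (\<sigma> + 27/20 * x))"
      by (simp add: s' algebra_simps)
    also have "\<dots> \<le> v * ((\<sigma> + 3/10 + (5 * x + 25 * x\<^sup>2) * (\<sigma> - 1/10) - x / 2) * (1 - x))"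
      using bound(2) v by (intro mult_left_mono)
    also have "\<dots> = (v * (\<sigma> + 3/10 + (5 * x + 25 * x\<^sup>2) * (\<sigma> - 1/10) - x / 2)) * (1 - x)" by simp
    also have "v * (\<sigma> + 3/10 + (5 * x + 25 * x\<^sup>2) * (\<sigma> - 1/10) - x / 2) = p + v / 2 - x * v / 2"
      by (simp add: p algebra_simps)
    finally show ?thesis using bound(1) by simp
  qed
  then show "0 \<le> p" "(1 + p)\<^sup>2 * (s + 27/20 * x * v) \<le> (p + v / 2 - x * v / 2) * (1 - x)" by auto
qed

lemma (in prob_space) integrable_bounded_mult:
  fixes f w :: "'a \<Rightarrow> real"
  assumes "integrable M f" "w \<in> borel_measurable M" "\<And>x. \<bar>w x\<bar> \<le> B"
  shows "integrable M (\<lambda>x. w x * f x)"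
proof (rule Bochner_Integration.integrable_bound)
  show "integrable M (\<lambda>x. B * f x)" using assms by simp
  have "\<bar>w x * f x\<bar> \<le> \<bar>B * f x\<bar>" for x
    unfolding abs_mult using order_trans[OF assms(3)[of x] abs_ge_self] by (intro mult_right_mono) auto
  then show "AE x in M. norm (w x * f x) \<le> norm (B * f x)" by simp
qed (use assms in measurable)

lemma (in prob_space) real_L2_bounded:
  "f \<in> borel_measurable M \<Longrightarrow> (\<And>x. \<bar>f x\<bar> \<le> B) \<Longrightarrow> f \<in> real_L2 M"
  by (rule real_L2_bound[OF real_L2_const[of B]]) (auto intro: order_trans[OF _ abs_ge_self])

text \<open>
  In the decomposition \<open>h = E h + h\<^sub>0\<close> the claim is that a quadratic form in \<open>E h\<close> and \<open>sqrt y\<close> is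
  nonnegative, where \<open>y\<close> plays the role of the Dirichlet form of \<open>h\<^sub>0\<close>.
\<close>

lemma (in prob_space) tilted_form_bound:
  fixes u h :: "'a \<Rightarrow> real" and g x s y :: real
  assumes g: "0 < g" "g \<le> 2" and x: "0 \<le> x" "x \<le> 1/5"
    and u [measurable]: "u \<in> borel_measurable M" and ub: "\<And>z. \<bar>u z\<bar> \<le> g * x" and Eu: "expectation u = 0"
  defines "v \<equiv> expectation (\<lambda>z. (u z)\<^sup>2)"
  assumes s: "v / 2 \<le> s" "g * s \<le> v"
    and h: "h \<in> real_L2 M" and y: "g * (real_ip M h h - (expectation h)\<^sup>2) \<le> y"
    and uh: "(real_ip M u h)\<^sup>2 \<le> s * y"
  shows "real_ip M h h - y \<le> (1 + (s - v / 5 + (5 * x + 25 * x\<^sup>2) * (s - v / 10))) * expectation (\<lambda>z. exp (- u z) * (h z)\<^sup>2)"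
proof -
  have [measurable]: "h \<in> borel_measurable M" using h by measurable
  define c where "c = g * x"
  have c: "0 \<le> c" "c \<le> 2/5" "c \<le> 2 * x" using g x mult_mono[of g 2 x "1/5"] mult_right_mono[of g 2 x] by (auto simp: c_def)
  have uc: "\<bar>u z\<bar> \<le> c" for z using ub by (simp add: c_def)
  have u25: "\<bar>- u z\<bar> \<le> 2/5" for z using uc[of z] c by simp
  have uL: "u \<in> real_L2 M" by (rule real_L2_bounded[OF u uc])
  have ui: "integrable M u" "integrable M (\<lambda>z. (u z)\<^sup>2)"
    using uL by (auto intro: real_L2_integrable real_L2_integrable_power2)
  define e where "e z = exp (- u z)" for z
  have [measurable]: "e \<in> borel_measurable M" unfolding e_def by measurable
  have eb: "\<bar>e z\<bar> \<le> exp c" for z using uc[of z] by (simp add: e_def abs_le_iff)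
  have eL: "e \<in> real_L2 M" by (rule real_L2_bounded[OF _ eb]) simp
  have v0: "0 \<le> v" by (simp add: v_def)
  have vc: "v \<le> c\<^sup>2"
  proof -
    have "v \<le> expectation (\<lambda>z. c\<^sup>2)"
      unfolding v_def using uc c by (intro integral_mono ui) (auto simp: abs_le_square_iff[symmetric])
    then show ?thesis by (simp add: prob_space)
  qed
  have s0: "0 \<le> s" using s v0 by simp
  define p where "p = s - v / 5 + (5 * x + 25 * x\<^sup>2) * (s - v / 10)"
  note rate = growth_rate_bound[OF g x v0 vc[unfolded c_def] s, folded p_def]
  define m where "m = expectation h"
  define h0 where "h0 z = h z - m" for z
  have h0L: "h0 \<in> real_L2 M" unfolding h0_def[abs_def] by (intro real_L2_diff h real_L2_const)
  have [measurable]: "h0 \<in> borel_measurable M" using h0L by measurable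
  have hi: "integrable M h" "integrable M h0" by (intro real_L2_integrable h h0L)+
  define V where "V = real_ip M h0 h0"
  have V0: "0 \<le> V" unfolding V_def by (rule real_L2.ip_nonneg[OF h0L])
  have V: "V = real_ip M h h - m\<^sup>2"
  proof -
    have "real_ip M h (\<lambda>z. m) = m\<^sup>2" "real_ip M (\<lambda>z. m) (\<lambda>z. m) = m\<^sup>2"
      by (simp_all add: real_ip_def m_def power2_eq_square prob_space)
    then show ?thesis
      unfolding V_def h0_def[abs_def] using h real_L2_const[of m] real_L2_diff[OF h real_L2_const[of m]]
      by (simp add: real_ip_diff_left real_ip_diff_right real_ip_commute[of M "\<lambda>z. m" h])
  qed
  have y0: "0 \<le> y" and Vy: "V \<le> y / g" and gV: "g * V \<le> y"
  proof -
    show gV: "g * V \<le> y" using y by (simp add: V m_def)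
    then show "V \<le> y / g" using g by (simp add: field_simps)
    show "0 \<le> y" using gV V0 g by (meson mult_nonneg_nonneg order_trans less_imp_le)
  qed

  have Ee: "1 + v / 2 - x * v / 2 \<le> expectation e"
  proof -
    have "1 - u z + (u z)\<^sup>2 * (1 / 2 - x / 2) \<le> e z" for z
    proof -
      have "\<bar>u z\<bar> ^ 3 / 4 = \<bar>u z\<bar> * (u z)\<^sup>2 / 4" by (simp add: power3_eq_cube power2_eq_square)
      also have "\<dots> \<le> (2 * x) * (u z)\<^sup>2 / 4"
        using uc[of z] c by (intro divide_right_mono mult_right_mono) auto
      finally show ?thesis using abs_le_D2[OF exp_cubic_bound[OF u25[of z]]] by (simp add: e_def algebra_simps)
    qed
    then have "expectation (\<lambda>z. 1 - u z + (u z)\<^sup>2 * (1 / 2 - x / 2)) \<le> expectation e"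
      using ui eL by (intro integral_mono) (auto intro: real_L2_integrable)
    then show ?thesis using ui Eu by (simp add: prob_space v_def[symmetric] algebra_simps)
  qed

  \<comment> \<open>e = 1 - u + r. Paired with the mean zero part h0, the constant gives 0, u gives
    the cross term controlled by \<open>uh\<close>, and r is of second order in u.\<close>
  define r where "r z = e z - 1 + u z" for z
  have [measurable]: "r \<in> borel_measurable M" unfolding r_def by measurable
  have rb: "\<bar>r z\<bar> \<le> 3/5 * c * \<bar>u z\<bar>" for z
  proof -
    have "\<bar>r z\<bar> \<le> 3/5 * (u z)\<^sup>2" using exp_minus_linear_bound[OF u25[of z]] by (simp add: r_def e_def)
    also have "(u z)\<^sup>2 = \<bar>u z\<bar> * \<bar>u z\<bar>" by (simp add: power2_eq_square)
    also have "\<dots> \<le> c * \<bar>u z\<bar>" using uc[of z] by (intro mult_right_mono) auto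
    finally show ?thesis by simp
  qed
  have rL: "r \<in> real_L2 M"
  proof (rule real_L2_bound[OF real_L2_scale[OF uL, of "3/5 * c"]])
    show "\<bar>r z\<bar> \<le> \<bar>3/5 * c * u z\<bar>" for z using rb[of z] c by (simp add: abs_mult)
  qed simp
  have rr: "real_ip M r r \<le> (3/5 * c)\<^sup>2 * v"
  proof -
    have "(r z)\<^sup>2 \<le> (3/5 * c)\<^sup>2 * (u z)\<^sup>2" for z
      using power_mono[OF rb[of z] abs_ge_zero, of 2] by (simp only: power2_abs power_mult_distrib)
    then have "expectation (\<lambda>z. (r z)\<^sup>2) \<le> expectation (\<lambda>z. (3/5 * c)\<^sup>2 * (u z)\<^sup>2)"
      using ui rL by (intro integral_mono) (auto simp: real_L2_integrable_power2)
    then show ?thesis by (simp add: v_def real_ip_def power2_eq_square)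
  qed
  define b where "b = real_ip M e h0"
  have b: "b = real_ip M r h0 - real_ip M u h"
  proof -
    have "real_ip M u h0 = real_ip M u h"
      unfolding h0_def[abs_def] using uL h by (subst real_ip_diff_right) (auto simp: real_L2_const, simp add: real_ip_def Eu)
    moreover have "real_ip M (\<lambda>z. 1) h0 = 0" using hi by (simp add: real_ip_def h0_def m_def prob_space)
    moreover have "e = (\<lambda>z. (r z - u z) + 1)" by (auto simp: r_def)
    ultimately show ?thesis
      unfolding b_def using rL uL h0L real_L2_diff[OF rL uL] real_L2_const[of 1]
      by (simp add: real_ip_diff_left)
  qed
  \<comment> \<open>The first summand comes from \<open>uh\<close>, the second from Cauchy-Schwarz
    for r and h0 with V <= y / g.\<close>
  define W where "W = sqrt s + 3/5 * c * sqrt v / sqrt g"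
  have W0: "0 \<le> W" unfolding W_def using s0 v0 g c by (intro add_nonneg_nonneg divide_nonneg_nonneg mult_nonneg_nonneg) auto
  have bW: "\<bar>b\<bar> \<le> W * sqrt y"
  proof -
    have "\<bar>real_ip M u h\<bar> \<le> sqrt s * sqrt y"
      using uh by (simp add: real_sqrt_mult[symmetric] real_le_rsqrt)
    moreover have "\<bar>real_ip M r h0\<bar> \<le> 3/5 * c * sqrt v / sqrt g * sqrt y"
    proof -
      have "(real_ip M r h0)\<^sup>2 \<le> real_ip M r r * V" unfolding V_def by (rule real_L2.Cauchy_Schwarz[OF rL h0L])
      also have "\<dots> \<le> ((3/5 * c)\<^sup>2 * v) * (y / g)" using rr Vy V0 v0 by (intro mult_mono) auto
      finally have "\<bar>real_ip M r h0\<bar> \<le> sqrt (((3/5 * c)\<^sup>2 * v) * (y / g))" by (intro real_le_rsqrt) simp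
      also have "\<dots> = 3/5 * c * sqrt v / sqrt g * sqrt y"
        using c by (simp add: real_sqrt_mult real_sqrt_divide)
      finally show ?thesis .
    qed
    ultimately show ?thesis unfolding b W_def by (simp add: algebra_simps abs_le_iff)
  qed
  \<comment> \<open>g s <= v turns the mixed term into 6/5 x v, and g x <= 2/5 turns the last square
    into (9/25) (2/5) x v; together 1.344 <= 27/20.\<close>
  have W2: "W\<^sup>2 \<le> s + 27/20 * x * v"
  proof -
    have cg: "c / sqrt g = x * sqrt g" using g by (simp add: c_def real_div_sqrt field_simps)
    have sq: "sqrt (g * s) * sqrt v \<le> v"
    proof -
      have "sqrt (g * s) * sqrt v \<le> sqrt v * sqrt v" using s v0 by (intro mult_right_mono real_sqrt_le_mono) auto
      then show ?thesis using v0 by simp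
    qed
    have W': "W = sqrt s + 3/5 * (x * sqrt g) * sqrt v" unfolding W_def cg[symmetric] by simp
    have "W\<^sup>2 = (sqrt s)\<^sup>2 + 6/5 * x * (sqrt g * sqrt s * sqrt v) + 9/25 * x * x * ((sqrt g)\<^sup>2 * (sqrt v)\<^sup>2)"
      unfolding W' by (simp add: power2_eq_square algebra_simps)
    also have "\<dots> = s + 6/5 * x * (sqrt (g * s) * sqrt v) + (9/25 * g * x) * x * v"
      using s0 v0 g by (simp add: real_sqrt_mult)
    also have "\<dots> \<le> s + 6/5 * x * v + (9/25 * (2/5)) * x * v"
      using sq x v0 c by (intro add_mono mult_left_mono mult_right_mono) (auto simp: c_def mult.assoc)
    also have "\<dots> \<le> s + 27/20 * x * v" using mult_nonneg_nonneg[OF x(1) v0] by (simp add: algebra_simps)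
    finally show ?thesis .
  qed
  define k where "k = expectation (\<lambda>z. e z * (h0 z)\<^sup>2)"
  have h0i: "integrable M (\<lambda>z. (h0 z)\<^sup>2)" by (rule real_L2_integrable_power2[OF h0L])
  have ki: "integrable M (\<lambda>z. e z * (h0 z)\<^sup>2)" by (rule integrable_bounded_mult[OF h0i _ eb]) simp
  have k: "(1 - c) * V \<le> k"
  proof -
    have "(1 - c) * (h0 z)\<^sup>2 \<le> e z * (h0 z)\<^sup>2" for z
      using exp_ge_add_one_self[of "- u z"] uc[of z] by (intro mult_right_mono) (auto simp: e_def abs_le_iff)
    then have "expectation (\<lambda>z. (1 - c) * (h0 z)\<^sup>2) \<le> k"
      unfolding k_def using h0i ki by (intro integral_mono) auto
    then show ?thesis by (simp add: V_def real_ip_def power2_eq_square)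
  qed
  have split: "expectation (\<lambda>z. e z * (h z)\<^sup>2) = m\<^sup>2 * expectation e + 2 * m * b + k"
  proof -
    have "e z * (h z)\<^sup>2 = m\<^sup>2 * e z + 2 * m * (e z * h0 z) + e z * (h0 z)\<^sup>2" for z
      by (simp add: h0_def power2_eq_square algebra_simps)
    then show ?thesis
      using ki real_L2_integrable[OF eL] real_L2_integrable_mult[OF eL h0L] by (simp add: b_def k_def real_ip_def)
  qed
  \<comment> \<open>The coefficient of m^2, minus the nonnegative product of p and (v - x v) /
    2.\<close>
  define a where "a = p + v / 2 - x * v / 2"
  have x1: "x * v \<le> v" using x v0 by (simp add: mult_left_le_one_le)
  have a0: "0 \<le> a" using rate(1) x1 v0 by (simp add: a_def)
  have am: "a * m\<^sup>2 \<le> ((1 + p) * expectation e - 1) * m\<^sup>2"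
  proof (rule mult_right_mono)
    have "(1 + p) * (1 + v / 2 - x * v / 2) \<le> (1 + p) * expectation e"
      using Ee rate(1) by (intro mult_left_mono) auto
    moreover have "0 \<le> p * (v / 2 - x * v / 2)" using rate(1) x1 by (intro mult_nonneg_nonneg) auto
    moreover have "(1 + p) * (1 + v / 2 - x * v / 2) = 1 + a + p * (v / 2 - x * v / 2)"
      by (simp add: a_def field_simps)
    ultimately show "a \<le> (1 + p) * expectation e - 1" by linarith
  qed simp
  \<comment> \<open>Replacing e by its lower bound 1 - c loses c V = g x V, at most x y by the
    hypothesis on y. This is the x in the coefficient 1 - x.\<close>
  have kk: "(1 - x) * (sqrt y)\<^sup>2 \<le> (1 + p) * k - V + y"
  proof -
    have "0 \<le> (1 - c) * V" using c V0 by (intro mult_nonneg_nonneg) auto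
    with k have "0 \<le> k" by linarith
    then have "k \<le> (1 + p) * k" using rate(1) by (simp add: algebra_simps)
    moreover have "c * V \<le> x * y" using gV x by (simp add: c_def mult.commute[of g] mult.assoc mult_left_mono)
    ultimately show ?thesis using k y0 by (simp add: algebra_simps)
  qed
  have "0 \<le> a * \<bar>m\<bar>\<^sup>2 + 2 * (- ((1 + p) * W)) * (\<bar>m\<bar> * sqrt y) + (1 - x) * (sqrt y)\<^sup>2"
  proof (rule quadratic_form_nonneg)
    have "(- ((1 + p) * W))\<^sup>2 = (1 + p)\<^sup>2 * W\<^sup>2" by (simp add: power_mult_distrib)
    also have "\<dots> \<le> (1 + p)\<^sup>2 * (s + 27/20 * x * v)" using W2 by (intro mult_left_mono) auto
    also have "\<dots> \<le> a * (1 - x)" using rate(2) by (simp add: a_def)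
    finally show "(- ((1 + p) * W))\<^sup>2 \<le> a * (1 - x)" .
  qed (use a0 x in auto)
  moreover have "- (2 * (1 + p) * m * b) \<le> 2 * ((1 + p) * W) * (\<bar>m\<bar> * sqrt y)"
  proof -
    have "- (m * b) \<le> \<bar>m\<bar> * \<bar>b\<bar>" using abs_ge_minus_self[of "m * b"] by (simp add: abs_mult)
    also have "\<dots> \<le> \<bar>m\<bar> * (W * sqrt y)" using bW by (intro mult_left_mono) auto
    finally have "2 * (1 + p) * - (m * b) \<le> 2 * (1 + p) * (\<bar>m\<bar> * (W * sqrt y))"
      using rate(1) by (intro mult_left_mono) auto
    then show ?thesis by (simp add: algebra_simps)
  qed
  ultimately have "0 \<le> ((1 + p) * expectation e - 1) * m\<^sup>2 + 2 * (1 + p) * m * b + ((1 + p) * k - V + y)"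
    using am kk by simp
  also have "\<dots> = (1 + p) * expectation (\<lambda>z. e z * (h z)\<^sup>2) - (real_ip M h h - y)"
    unfolding split V by (simp add: algebra_simps)
  finally show ?thesis by (simp add: p_def e_def)
qed

text \<open>Bounds the factors at the two ends of the chain. The linear term has mean zero, and |u|
  <= 2x folds the cubic error |u|^3 / 4 into x u^2 / 2.\<close>

lemma (in prob_space) expectation_exp_bound:
  fixes u :: "'a \<Rightarrow> real"
  assumes x: "x \<le> 1/5" and c: "c \<le> 2 * x"
    and u [measurable]: "u \<in> borel_measurable M" and uc: "\<And>z. \<bar>u z\<bar> \<le> c" and Eu: "expectation u = 0"
  shows "expectation (\<lambda>z. exp (u z)) \<le> exp ((1 + x) / 2 * expectation (\<lambda>z. (u z)\<^sup>2))"
proof -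
  have uL: "u \<in> real_L2 M" by (rule real_L2_bounded[OF u uc])
  have ui: "integrable M u" "integrable M (\<lambda>z. (u z)\<^sup>2)"
    using uL by (auto intro: real_L2_integrable real_L2_integrable_power2)
  have "exp (u z) \<le> 1 + u z + (1 + x) / 2 * (u z)\<^sup>2" for z
  proof -
    have "\<bar>u z\<bar> ^ 3 / 4 = \<bar>u z\<bar> * (u z)\<^sup>2 / 4" by (simp add: power3_eq_cube power2_eq_square)
    also have "\<dots> \<le> (2 * x) * (u z)\<^sup>2 / 4"
      using uc[of z] c by (intro divide_right_mono mult_right_mono) auto
    finally have "\<bar>u z\<bar> ^ 3 / 4 \<le> x * (u z)\<^sup>2 / 2" by simp
    moreover have "\<bar>u z\<bar> \<le> 2/5" using uc[of z] c x by linarith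
    ultimately have "exp (u z) - 1 - u z - (u z)\<^sup>2 / 2 \<le> x * (u z)\<^sup>2 / 2"
      using abs_le_D1[OF exp_cubic_bound[of "u z"]] by linarith
    then show ?thesis by (simp add: field_simps)
  qed
  then have "expectation (\<lambda>z. exp (u z)) \<le> expectation (\<lambda>z. 1 + u z + (1 + x) / 2 * (u z)\<^sup>2)"
  proof (intro integral_mono)
    have "\<bar>exp (u z)\<bar> \<le> exp c" for z using uc[of z] by (simp add: abs_le_iff)
    then show "integrable M (\<lambda>z. exp (u z))" by (intro real_L2_integrable real_L2_bounded) auto
  qed (use ui in auto)
  also have "\<dots> = 1 + (1 + x) / 2 * expectation (\<lambda>z. (u z)\<^sup>2)" using ui Eu by (simp add: prob_space)
  also have "\<dots> \<le> exp ((1 + x) / 2 * expectation (\<lambda>z. (u z)\<^sup>2))" by (rule exp_ge_add_one_self)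
  finally show ?thesis .
qed

section \<open>Tilted norms and the product along the chain\<close>

context reversible_chain
begin

text \<open>The squared norm of exp (-u/2) h, that is, of the function before the
  substitution.\<close>

definition tilted_norm2 :: "('a \<Rightarrow> real) \<Rightarrow> ('a \<Rightarrow> real) \<Rightarrow> real" where
  "tilted_norm2 u h = (\<integral>x. exp (- u x) * (h x)\<^sup>2 \<partial>\<pi>)"

lemma transition_ip_le_abs:
  assumes k: "k \<in> real_L2 \<pi>"
  shows "- real_ip \<pi> (transition k) k \<le> real_ip \<pi> (transition (\<lambda>x. \<bar>k x\<bar>)) (\<lambda>x. \<bar>k x\<bar>)"
proof -
  note ka = real_L2_abs[OF k]
  have "- real_ip \<pi> (transition k) k = (\<integral>x. - (transition k x * k x) \<partial>\<pi>)" by (simp add: real_ip_def)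
  also have "\<dots> \<le> real_ip \<pi> (transition (\<lambda>x. \<bar>k x\<bar>)) (\<lambda>x. \<bar>k x\<bar>)"
    unfolding real_ip_def
  proof (intro integral_mono Bochner_Integration.integrable_minus real_L2_integrable_mult transition_real_L2 k ka)
    fix x
    have "\<bar>transition k x\<bar> \<le> transition (\<lambda>x. \<bar>k x\<bar>) x"
      unfolding transition_def using integral_norm_bound[of "P x" k] by simp
    then have "\<bar>transition k x * k x\<bar> \<le> transition (\<lambda>x. \<bar>k x\<bar>) x * \<bar>k x\<bar>"
      unfolding abs_mult by (rule mult_right_mono) simp
    then show "- (transition k x * k x) \<le> transition (\<lambda>x. \<bar>k x\<bar>) x * \<bar>k x\<bar>" by simp
  qed
  finally show ?thesis .
qed

lemma transition_polarization:
  assumes "a \<in> real_L2 \<pi>" "b \<in> real_L2 \<pi>"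
  shows "4 * real_ip \<pi> a (transition b) =
    real_ip \<pi> (transition (\<lambda>x. a x + b x)) (\<lambda>x. a x + b x) - real_ip \<pi> (transition (\<lambda>x. a x - b x)) (\<lambda>x. a x - b x)"
proof -
  note T = self_adjoint_transition
  have m: "(\<lambda>x. a x - b x) = (\<lambda>x. a x + (-1) * b x)" by simp
  have s: "real_ip \<pi> (transition b) a = real_ip \<pi> (transition a) b"
    using real_L2.self_adjoint_swap[OF T assms(2,1)] by (simp add: real_ip_commute)
  show ?thesis
    unfolding m using assms transition_real_L2(1)[OF assms(1)] transition_real_L2(1)[OF assms(2)]
    by (simp only: real_L2.self_adjoint_ip_linear[OF T] real_L2.ip_add_right real_L2.ip_scl_right
        real_L2_add real_L2_scale transition_scale transition_real_L2(1) real_L2.ip_scl_left s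
        real_L2.self_adjoint_swap[OF T assms, symmetric]) simp
qed

lemma tilted_norm2_integrable:
  assumes h: "h \<in> real_L2 \<pi>" and u: "u \<in> borel_measurable borel" "\<And>x. \<bar>u x\<bar> \<le> c"
  shows "integrable \<pi> (\<lambda>x. exp (- u x) * (h x)\<^sup>2)"
proof (rule pi.integrable_bounded_mult[OF real_L2_integrable_power2[OF h]])
  show "\<bar>exp (- u x)\<bar> \<le> exp c" for x using u(2)[of x] by (simp add: abs_le_iff)
qed (use u in measurable)

text \<open>
  Polarization loses nothing here: the form of \<open>a - b\<close> enters with the wrong sign, but it is
  dominated by the form of \<open>\<bar>a - b\<bar>\<close> because \<open>P\<close> preserves positivity.
\<close>

lemma tilted_bilinear_of_form:
  assumes form: "\<And>h. h \<in> real_L2 \<pi> \<Longrightarrow> real_ip \<pi> (transition h) h \<le> R * tilted_norm2 u h"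
    and u: "u \<in> borel_measurable borel" "\<And>x. \<bar>u x\<bar> \<le> c"
    and a: "a \<in> real_L2 \<pi>" and b: "b \<in> real_L2 \<pi>"
  shows "real_ip \<pi> a (transition b) \<le> (R * tilted_norm2 u a + R * tilted_norm2 u b) / 2"
proof -
  note ab = real_L2_add[OF a b] real_L2_diff[OF a b]
  have "4 * real_ip \<pi> a (transition b) \<le> R * tilted_norm2 u (\<lambda>x. a x + b x) + R * tilted_norm2 u (\<lambda>x. \<bar>a x - b x\<bar>)"
    unfolding transition_polarization[OF a b]
    using form[OF ab(1)] form[OF real_L2_abs[OF ab(2)]] transition_ip_le_abs[OF ab(2)] by linarith
  also have "\<dots> = R * (tilted_norm2 u (\<lambda>x. a x + b x) + tilted_norm2 u (\<lambda>x. a x - b x))"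
    by (simp add: tilted_norm2_def distrib_left)
  also have "tilted_norm2 u (\<lambda>x. a x + b x) + tilted_norm2 u (\<lambda>x. a x - b x) =
      (\<integral>x. exp (- u x) * (a x + b x)\<^sup>2 + exp (- u x) * (a x - b x)\<^sup>2 \<partial>\<pi>)"
    unfolding tilted_norm2_def using ab u by (intro Bochner_Integration.integral_add[symmetric] tilted_norm2_integrable) auto
  also have "\<dots> = (\<integral>x. 2 * (exp (- u x) * (a x)\<^sup>2) + 2 * (exp (- u x) * (b x)\<^sup>2) \<partial>\<pi>)"
    by (intro Bochner_Integration.integral_cong refl) (simp add: power2_eq_square algebra_simps)
  also have "\<dots> = 2 * tilted_norm2 u a + 2 * tilted_norm2 u b"
    unfolding tilted_norm2_def using tilted_norm2_integrable[OF a u] tilted_norm2_integrable[OF b u] by simp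
  finally show ?thesis by (simp add: algebra_simps)
qed

text \<open>The conditional expectation of exp (u i (X i) + ... + u (i+m) (X (i+m))) given X i = x.
  The argument m counts transitions, so n observations correspond to m = n - 1.\<close>

fun forward_weight :: "(nat \<Rightarrow> 'a \<Rightarrow> real) \<Rightarrow> nat \<Rightarrow> nat \<Rightarrow> 'a \<Rightarrow> real" where
  "forward_weight u 0 i = (\<lambda>x. exp (u i x))"
| "forward_weight u (Suc m) i = (\<lambda>x. exp (u i x) * transition (forward_weight u m (Suc i)) x)"

context
  fixes u :: "nat \<Rightarrow> 'a \<Rightarrow> real" and c :: real
  assumes u_measurable [measurable]: "\<And>i. u i \<in> borel_measurable borel" and u_bound: "\<And>i x. \<bar>u i x\<bar> \<le> c"
begin

lemma forward_weight_measurable [measurable]: "forward_weight u m i \<in> borel_measurable borel"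
  by (induction m arbitrary: i) auto

lemma forward_weight_nonneg: "0 \<le> forward_weight u m i x"
  by (induction m arbitrary: i x) (auto simp: transition_def)

lemma forward_weight_bound: "forward_weight u m i x \<le> exp c ^ Suc m"
proof (induction m arbitrary: i x)
  case 0
  show ?case using u_bound[of i x] by (simp add: abs_le_iff)
next
  case (Suc m)
  interpret Px: prob_space "P x" by (rule prob_space_kernel)
  have "transition (forward_weight u m (Suc i)) x \<le> (\<integral>y. exp c ^ Suc m \<partial>P x)"
    unfolding transition_def
    by (intro integral_mono Px.real_L2_integrable Px.real_L2_bounded[where B = "exp c ^ Suc m"])
       (use Suc.IH forward_weight_nonneg in \<open>auto simp: abs_of_nonneg\<close>)
  also have "\<dots> = exp c ^ Suc m" using Px.prob_space by simp
  finally show ?case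
    unfolding forward_weight.simps power_Suc[of _ "Suc m"] using u_bound[of i x] Suc.IH
    by (intro mult_mono) (auto simp: abs_le_iff transition_def forward_weight_nonneg)
qed

lemma forward_weight_L2: "forward_weight u m i \<in> real_L2 \<pi>"
  by (rule pi.real_L2_bounded[where B = "exp c ^ Suc m"])
     (use forward_weight_bound forward_weight_nonneg in \<open>auto simp: abs_of_nonneg\<close>)

context
  fixes R :: "nat \<Rightarrow> real" and n :: nat
  assumes R: "\<And>i. 0 < R i"
    and bilinear: "\<And>i a b. 1 \<le> i \<Longrightarrow> i < n \<Longrightarrow> a \<in> real_L2 \<pi> \<Longrightarrow> b \<in> real_L2 \<pi> \<Longrightarrow>
      real_ip \<pi> a (transition b) \<le> (R i * tilted_norm2 (u i) a + R (Suc i) * tilted_norm2 (u (Suc i)) b) / 2"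
begin

lemma tilted_norm2_scale: "tilted_norm2 w (\<lambda>x. t * h x) = t\<^sup>2 * tilted_norm2 w h"
  unfolding tilted_norm2_def by (subst integral_mult_right_zero[symmetric]) (simp add: power_mult_distrib mult.left_commute)

text \<open>The bilinear bound is applied to \<open>a\<close> and \<open>b\<close> rescaled by inverse factors.\<close>

lemma tilted_norm2_step:
  assumes i: "1 \<le> i" "i < n"
  shows "tilted_norm2 (u i) (forward_weight u (Suc m) i)
    \<le> R i * R (Suc i) * tilted_norm2 (u (Suc i)) (forward_weight u m (Suc i))"
proof -
  define a where "a = forward_weight u (Suc m) i"
  define b where "b = forward_weight u m (Suc i)"
  have aL: "a \<in> real_L2 \<pi>" and bL: "b \<in> real_L2 \<pi>" unfolding a_def b_def by (rule forward_weight_L2)+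
  define t where "t = sqrt (R i)"
  have t: "0 < t" "t\<^sup>2 = R i" using R[of i] by (auto simp: t_def)
  \<comment> \<open>The recursion says exp (-u) a = P b, so the tilted norm of a is a pairing with P
    b. After rescaling, the bilinear bound returns half of this norm, which is absorbed on the
    left.\<close>
  have "tilted_norm2 (u i) a = real_ip \<pi> a (transition b)"
    unfolding tilted_norm2_def real_ip_def
    by (intro Bochner_Integration.integral_cong refl) (simp add: a_def b_def power2_eq_square exp_minus)
  also have "\<dots> = real_ip \<pi> (\<lambda>x. (1 / t) * a x) (transition (\<lambda>x. t * b x))"
    unfolding transition_scale using t aL transition_real_L2(1)[OF bL] by (simp add: real_ip_def)
  also have "\<dots> \<le> (R i * tilted_norm2 (u i) (\<lambda>x. (1 / t) * a x) + R (Suc i) * tilted_norm2 (u (Suc i)) (\<lambda>x. t * b x)) / 2"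
    by (intro bilinear i real_L2_scale aL bL)
  also have "\<dots> = (tilted_norm2 (u i) a + R i * R (Suc i) * tilted_norm2 (u (Suc i)) b) / 2"
    unfolding tilted_norm2_scale power_divide t(2) using R[of i] by simp
  finally show ?thesis by (simp add: a_def b_def)
qed

lemma tilted_norm2_forward_weight:
  assumes "i + m \<le> n" "1 \<le> i"
  shows "tilted_norm2 (u i) (forward_weight u m i) \<le> (\<Prod>j<m. R (i + j) * R (Suc (i + j))) * (\<integral>x. exp (u (i + m) x) \<partial>\<pi>)"
  using assms
proof (induction m arbitrary: i)
  case 0
  show ?case by (simp add: tilted_norm2_def power2_eq_square exp_add[symmetric])
next
  case (Suc m)
  have "tilted_norm2 (u i) (forward_weight u (Suc m) i)
    \<le> R i * R (Suc i) * tilted_norm2 (u (Suc i)) (forward_weight u m (Suc i))"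
    using Suc.prems by (intro tilted_norm2_step) auto
  also have "\<dots> \<le> R i * R (Suc i) * ((\<Prod>j<m. R (Suc i + j) * R (Suc (Suc i + j))) * (\<integral>x. exp (u (Suc i + m) x) \<partial>\<pi>))"
    using Suc.prems R[of i] R[of "Suc i"] by (intro mult_left_mono Suc.IH) (auto simp: less_imp_le)
  also have "\<dots> = (\<Prod>j<Suc m. R (i + j) * R (Suc (i + j))) * (\<integral>x. exp (u (i + Suc m) x) \<partial>\<pi>)"
    by (subst prod.lessThan_Suc_shift) simp
  finally show ?case .
qed

text \<open>Cauchy-Schwarz for exp (u/2) and exp (-u/2) F at the first observation: one factor is an
  end factor, the other the tilted norm of F, to which the iterated step applies.\<close>

lemma expectation_forward_weight_power2:
  assumes n: "1 \<le> n"
  shows "(\<integral>x. forward_weight u (n - 1) 1 x \<partial>\<pi>)\<^sup>2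
    \<le> (\<integral>x. exp (u 1 x) \<partial>\<pi>) * ((\<Prod>j<n - 1. R (1 + j) * R (Suc (1 + j))) * (\<integral>x. exp (u n x) \<partial>\<pi>))"
proof -
  let ?F = "forward_weight u (n - 1) 1"
  let ?e = "\<lambda>x. exp (u 1 x / 2)" and ?h = "\<lambda>x. exp (- u 1 x / 2) * ?F x"
  have eb: "\<bar>?e x\<bar> \<le> exp (c / 2)" "\<bar>exp (- u 1 x / 2)\<bar> \<le> exp (c / 2)" for x
    using u_bound[of 1 x] by (auto simp: abs_le_iff)
  have eL: "?e \<in> real_L2 \<pi>" by (rule pi.real_L2_bounded[OF _ eb(1)]) simp
  have hL: "?h \<in> real_L2 \<pi>"
  proof (rule pi.real_L2_bounded)
    show "\<bar>?h x\<bar> \<le> exp (c / 2) * exp c ^ Suc (n - 1)" for x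
      unfolding abs_mult using eb(2)[of x] forward_weight_bound[of "n - 1" 1 x] forward_weight_nonneg[of "n - 1" 1 x]
      by (intro mult_mono) auto
  qed simp
  have "(\<integral>x. ?F x \<partial>\<pi>) = real_ip \<pi> ?e ?h"
    by (simp add: real_ip_def mult.assoc[symmetric] exp_add[symmetric])
  then have "(\<integral>x. ?F x \<partial>\<pi>)\<^sup>2 \<le> real_ip \<pi> ?e ?e * real_ip \<pi> ?h ?h"
    using real_L2.Cauchy_Schwarz[OF eL hL] by simp
  also have "real_ip \<pi> ?e ?e = (\<integral>x. exp (u 1 x) \<partial>\<pi>)" by (simp add: real_ip_def exp_add[symmetric])
  also have "real_ip \<pi> ?h ?h = tilted_norm2 (u 1) ?F"
    unfolding real_ip_def tilted_norm2_def
  proof (intro Bochner_Integration.integral_cong refl)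
    fix x
    have "exp (- u 1 x) = exp (- u 1 x / 2) * exp (- u 1 x / 2)" by (simp add: exp_add[symmetric])
    then show "?h x * ?h x = exp (- u 1 x) * (?F x)\<^sup>2" by (simp add: power2_eq_square)
  qed
  also have "(\<integral>x. exp (u 1 x) \<partial>\<pi>) * tilted_norm2 (u 1) ?F \<le>
     (\<integral>x. exp (u 1 x) \<partial>\<pi>) * ((\<Prod>j<n - 1. R (1 + j) * R (Suc (1 + j))) * (\<integral>x. exp (u (1 + (n - 1)) x) \<partial>\<pi>))"
    using n by (intro mult_left_mono tilted_norm2_forward_weight) auto
  finally show ?thesis using n by simp
qed

end
end
end

text \<open>In the product over adjacent pairs interior indices occur twice and the two ends once;
  the outer factors supply the missing end terms, so a perfect square results.\<close>

lemma prod_exp_adjacent: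
  fixes r :: "nat \<Rightarrow> real"
  assumes "1 \<le> n"
  shows "exp (r 1) * ((\<Prod>j<n - 1. exp (r (1 + j)) * exp (r (Suc (1 + j)))) * exp (r n)) = (exp (\<Sum>i=1..n. r i))\<^sup>2"
  using assms
proof (induction n rule: dec_induct)
  case base
  show ?case by (simp add: power2_eq_square)
next
  case (step n)
  obtain k where n: "n = Suc k" using step by (cases n) auto
  have "exp (r 1) * ((\<Prod>j<Suc n - 1. exp (r (1 + j)) * exp (r (Suc (1 + j)))) * exp (r (Suc n)))
    = exp (r 1) * ((\<Prod>j<n - 1. exp (r (1 + j)) * exp (r (Suc (1 + j)))) * exp (r n)) * (exp (r (Suc n)))\<^sup>2"
    by (simp add: n power2_eq_square)
  also have "\<dots> = (exp (\<Sum>i=1..Suc n. r i))\<^sup>2"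
    unfolding step.IH by (simp add: exp_add power_mult_distrib)
  finally show ?case .
qed

section \<open>Tail bounds\<close>

text \<open>Markov's inequality for exp (\<theta> Y) with \<theta> = t / (2a + bt), which makes the
  exponent rational in t.\<close>

lemma (in prob_space) Bernstein_tail_one_sided:
  fixes Y :: "'a \<Rightarrow> real"
  assumes Y [measurable]: "Y \<in> borel_measurable M" and bound: "\<And>w. w \<in> space M \<Longrightarrow> \<bar>Y w\<bar> \<le> B"
    and ab: "0 \<le> a" "0 \<le> b" and t: "0 \<le> t"
    and mgf: "\<And>\<theta>. 0 \<le> \<theta> \<Longrightarrow> b * \<theta> < 1 \<Longrightarrow> expectation (\<lambda>w. exp (\<theta> * Y w)) \<le> exp (a * \<theta>\<^sup>2 / (1 - b * \<theta>))"
  shows "prob {w \<in> space M. t \<le> Y w} \<le> exp (- (t\<^sup>2 / (4 * a + 2 * b * t)))"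
proof -
  have chernoff: "prob {w \<in> space M. t \<le> Y w} \<le> exp (a * \<theta>\<^sup>2 / (1 - b * \<theta>) - \<theta> * t)"
    if \<theta>: "0 \<le> \<theta>" "b * \<theta> < 1" for \<theta>
  proof -
    have eb: "\<bar>exp (\<theta> * Y w)\<bar> \<le> exp (\<theta> * B)" if "w \<in> space M" for w
    proof -
      have "\<theta> * Y w \<le> \<theta> * B" using bound[OF that] \<theta> by (intro mult_left_mono) auto
      then show ?thesis by simp
    qed
    have int: "integrable M (\<lambda>w. exp (\<theta> * Y w))"
      by (rule integrable_const_bound[of _ "exp (\<theta> * B)"]) (use eb in auto)
    have "prob {w \<in> space M. t \<le> Y w} \<le> prob {w \<in> space M. exp (\<theta> * t) \<le> exp (\<theta> * Y w)}"
      using \<theta> by (intro finite_measure_mono) (auto intro: mult_left_mono)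
    also have "\<dots> \<le> expectation (\<lambda>w. exp (\<theta> * Y w)) / exp (\<theta> * t)"
      by (rule integral_Markov_inequality_measure[OF int, where A = "{}"]) auto
    also have "\<dots> \<le> exp (a * \<theta>\<^sup>2 / (1 - b * \<theta>)) / exp (\<theta> * t)"
      using mgf[OF \<theta>] by (intro divide_right_mono) auto
    finally show ?thesis by (simp add: exp_diff)
  qed
  \<comment> \<open>Division by zero yields 0, so for a vanishing denominator the claimed bound is
    1.\<close>
  consider "4 * a + 2 * b * t = 0" | "a > 0" | "a = 0" "0 < b * t" using ab t by fastforce
  then show ?thesis
  proof cases
    case 1
    then show ?thesis by simp
  next
    case 2
    \<comment> \<open>With \<theta> = t / D one has 1 - b \<theta> = 2a / D, and the exponent
      collapses to -t^2 / (2D).\<close>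
    define D where "D = 2 * a + b * t"
    have D: "0 < D" using 2 ab t by (simp add: D_def add_pos_nonneg)
    have d: "1 - b * (t / D) = 2 * a / D" using D by (simp add: D_def field_simps)
    have "0 < 2 * a / D" using 2 D by simp
    then have "prob {w \<in> space M. t \<le> Y w} \<le> exp (a * (t / D)\<^sup>2 / (1 - b * (t / D)) - t / D * t)"
      using t D d by (intro chernoff) (simp, linarith)
    also have "a * (t / D)\<^sup>2 / (1 - b * (t / D)) - t / D * t = - (t\<^sup>2 / (2 * D))"
      unfolding d using D 2 by (simp add: power2_eq_square field_simps)
    also have "2 * D = 4 * a + 2 * b * t" by (simp add: D_def)
    finally show ?thesis .
  next
    \<comment> \<open>For a = 0 the choice t / D = 1 / b is the excluded end of the range; half of
      it already gives exp (-t / (2b)), which is the claim.\<close>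
    case 3
    then have bt: "0 < b" "0 < t" using ab t by (auto simp: zero_less_mult_iff)
    have "prob {w \<in> space M. t \<le> Y w} \<le> exp (a * (1 / (2 * b))\<^sup>2 / (1 - b * (1 / (2 * b))) - 1 / (2 * b) * t)"
      using bt by (intro chernoff) auto
    then show ?thesis using 3 bt by (simp add: power2_eq_square field_simps)
  qed
qed

lemma (in prob_space) Bernstein_tail:
  fixes Y :: "'a \<Rightarrow> real"
  assumes Y [measurable]: "Y \<in> borel_measurable M" and bound: "\<And>w. w \<in> space M \<Longrightarrow> \<bar>Y w\<bar> \<le> B"
    and ab: "0 \<le> a" "0 \<le> b" and t: "0 \<le> t"
    and mgf: "\<And>\<theta>. 0 \<le> \<theta> \<Longrightarrow> b * \<theta> < 1 \<Longrightarrow> expectation (\<lambda>w. exp (\<theta> * Y w)) \<le> exp (a * \<theta>\<^sup>2 / (1 - b * \<theta>))"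
    and mgf': "\<And>\<theta>. 0 \<le> \<theta> \<Longrightarrow> b * \<theta> < 1 \<Longrightarrow> expectation (\<lambda>w. exp (\<theta> * - Y w)) \<le> exp (a * \<theta>\<^sup>2 / (1 - b * \<theta>))"
  shows "prob {w \<in> space M. t \<le> \<bar>Y w\<bar>} \<le> 2 * exp (- (t\<^sup>2 / (4 * a + 2 * b * t)))"
proof -
  have "{w \<in> space M. t \<le> \<bar>Y w\<bar>} = {w \<in> space M. t \<le> Y w} \<union> {w \<in> space M. t \<le> - Y w}" by auto
  then have "prob {w \<in> space M. t \<le> \<bar>Y w\<bar>} \<le> prob {w \<in> space M. t \<le> Y w} + prob {w \<in> space M. t \<le> - Y w}"
    by (simp add: measure_Un_le)
  also have "\<dots> \<le> exp (- (t\<^sup>2 / (4 * a + 2 * b * t))) + exp (- (t\<^sup>2 / (4 * a + 2 * b * t)))"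
    using bound by (intro add_mono Bernstein_tail_one_sided ab t mgf mgf') auto
  finally show ?thesis by simp
qed

section \<open>The Markov property and exponential moments of the sum\<close>

context reversible_chain
begin

context
  fixes N :: "'w measure" and X :: "nat \<Rightarrow> 'w \<Rightarrow> 'a" and n :: nat
  assumes chain: "markov_chain N P n X" and initial: "distr N borel (X 1) = \<pi>" and n: "1 \<le> n"
begin

interpretation N: prob_space N
  using chain by (simp add: markov_chain_def)

lemma X_measurable: "i \<in> {1..n} \<Longrightarrow> X i \<in> borel_measurable N"
  using chain by (simp add: markov_chain_def)

text \<open>The chain is specified by conditional expectations of indicators. For a fixed bounded
  weight of the past this is an equality of two measures on the state space, so any nonnegative
  measurable G can be integrated against them.\<close>

lemma chain_step:
  assumes i: "i \<in> {1..<n}" and w: "w \<in> borel_measurable (\<Pi>\<^sub>M j\<in>{1..i}. borel)"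
    and wb: "\<And>z. 0 \<le> w z" "\<And>z. w z \<le> (B::real)" and G [measurable]: "G \<in> borel_measurable borel"
  shows "(\<integral>\<^sup>+\<omega>. ennreal (w (\<lambda>j\<in>{1..i}. X j \<omega>)) * G (X (Suc i) \<omega>) \<partial>N) =
    (\<integral>\<^sup>+\<omega>. ennreal (w (\<lambda>j\<in>{1..i}. X j \<omega>)) * (\<integral>\<^sup>+y. G y \<partial>P (X i \<omega>)) \<partial>N)"
proof -
  let ?Z = "\<lambda>\<omega>. \<lambda>j\<in>{1..i}. X j \<omega>"
  let ?F = "vimage_algebra (space N) ?Z (\<Pi>\<^sub>M j\<in>{1..i}. borel)"
  have [measurable]: "X i \<in> borel_measurable N" "X (Suc i) \<in> borel_measurable N"
    using i by (auto intro: X_measurable)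
  have Z: "?Z \<in> measurable N (\<Pi>\<^sub>M j\<in>{1..i}. borel)"
    using i by (intro measurable_restrict X_measurable) auto
  have Zs: "?Z \<in> space N \<rightarrow> space (\<Pi>\<^sub>M j\<in>{1..i}. borel)" using measurable_space[OF Z] by auto
  have sub: "subalgebra N ?F"
    using measurable_sets[OF Z] unfolding subalgebra_def sets_vimage_algebra2[OF Zs] by auto
  interpret F: finite_measure_subalgebra N ?F
    by unfold_locales (rule sub)
  define W where "W \<omega> = w (?Z \<omega>)" for \<omega>
  have WF: "W \<in> borel_measurable ?F"
    unfolding W_def by (rule measurable_compose[OF measurable_vimage_algebra1[OF Zs] w])
  have W [measurable]: "W \<in> borel_measurable N" by (rule measurable_from_subalg[OF sub WF])
  have Wb: "0 \<le> W \<omega>" "W \<omega> \<le> B" for \<omega> using wb by (auto simp: W_def)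
  have WBn: "norm (W \<omega>) \<le> B" for \<omega> using Wb[of \<omega>] by simp
  have Wi: "integrable N W" by (rule N.integrable_const_bound[of _ B]) (use WBn in auto)
  have Wc: "integrable N (\<lambda>\<omega>. W \<omega> * h \<omega>)" if [measurable]: "h \<in> borel_measurable N" and h: "\<And>\<omega>. 0 \<le> h \<omega>" "\<And>\<omega>. h \<omega> \<le> (1::real)" for h
    using h Wb by (intro Bochner_Integration.integrable_bound[OF Wi]) (auto simp: abs_mult mult_left_le)
  have step: "(\<integral>\<omega>. W \<omega> * indicator A (X (Suc i) \<omega>) \<partial>N) = (\<integral>\<omega>. W \<omega> * measure (P (X i \<omega>)) A \<partial>N)"
    if A [measurable]: "A \<in> sets borel" for A
  proof -
    let ?I = "\<lambda>\<omega>. indicator A (X (Suc i) \<omega>) :: real"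
    have I: "?I \<in> borel_measurable N" by measurable
    have "(\<integral>\<omega>. W \<omega> * ?I \<omega> \<partial>N) = (\<integral>\<omega>. W \<omega> * real_cond_exp N ?F ?I \<omega> \<partial>N)"
      by (rule F.real_cond_exp_intg(2)[symmetric, OF _ WF I]) (rule Wc[OF I], auto)
    also have "\<dots> = (\<integral>\<omega>. W \<omega> * measure (P (X i \<omega>)) A \<partial>N)"
    proof (rule integral_cong_AE)
      have "AE \<omega> in N. real_cond_exp N ?F ?I \<omega> = measure (P (X i \<omega>)) A"
        using chain i A by (simp add: markov_chain_def)
      then show "AE \<omega> in N. W \<omega> * real_cond_exp N ?F ?I \<omega> = W \<omega> * measure (P (X i \<omega>)) A"
        by eventually_elim simp
      show "(\<lambda>\<omega>. W \<omega> * measure (P (X i \<omega>)) A) \<in> borel_measurable N"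
        using measurable_compose[OF kernel_subprob measurable_measure_subprob_algebra[OF A]] by measurable
    qed measurable
    finally show ?thesis .
  qed
  have eq: "distr (density N (\<lambda>\<omega>. ennreal (W \<omega>))) borel (X (Suc i)) = distr (density N (\<lambda>\<omega>. ennreal (W \<omega>))) borel (X i) \<bind> P"
    (is "?l = ?r")
  proof (rule measure_eqI)
    show s: "sets ?l = sets ?r" by (subst sets_bind) auto
    fix A assume "A \<in> sets ?l"
    then have A [measurable]: "A \<in> sets borel" by simp
    have mP [measurable]: "(\<lambda>x. emeasure (P x) A) \<in> borel_measurable borel"
      by (rule measurable_compose[OF kernel_subprob measurable_emeasure_subprob_algebra[OF A]])
    have mP' [measurable]: "(\<lambda>x. measure (P x) A) \<in> borel_measurable borel"
      by (rule measurable_compose[OF kernel_subprob measurable_measure_subprob_algebra[OF A]])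
    have "emeasure ?l A = (\<integral>\<^sup>+x. indicator A x \<partial>?l)" by simp
    also have "\<dots> = (\<integral>\<^sup>+\<omega>. indicator A (X (Suc i) \<omega>) \<partial>density N (\<lambda>\<omega>. ennreal (W \<omega>)))"
      by (rule nn_integral_distr) auto
    also have "\<dots> = (\<integral>\<^sup>+\<omega>. ennreal (W \<omega>) * indicator A (X (Suc i) \<omega>) \<partial>N)"
      by (rule nn_integral_density) auto
    also have "\<dots> = (\<integral>\<^sup>+\<omega>. ennreal (W \<omega> * indicator A (X (Suc i) \<omega>)) \<partial>N)"
      by (intro nn_integral_cong) (auto simp: indicator_def)
    also have "\<dots> = ennreal (\<integral>\<omega>. W \<omega> * indicator A (X (Suc i) \<omega>) \<partial>N)"
      using Wb by (intro nn_integral_eq_integral Wc) auto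
    also have "\<dots> = ennreal (\<integral>\<omega>. W \<omega> * measure (P (X i \<omega>)) A \<partial>N)" by (simp add: step)
    also have "\<dots> = (\<integral>\<^sup>+\<omega>. ennreal (W \<omega> * measure (P (X i \<omega>)) A) \<partial>N)"
      using Wb prob_space.prob_le_1[OF prob_space_kernel] by (intro nn_integral_eq_integral[symmetric] Wc) auto
    also have "\<dots> = (\<integral>\<^sup>+\<omega>. ennreal (W \<omega>) * emeasure (P (X i \<omega>)) A \<partial>N)"
      using Wb by (intro nn_integral_cong)
        (simp add: ennreal_mult finite_measure.emeasure_eq_measure[OF prob_space.finite_measure[OF prob_space_kernel]])
    also have "\<dots> = (\<integral>\<^sup>+\<omega>. emeasure (P (X i \<omega>)) A \<partial>density N (\<lambda>\<omega>. ennreal (W \<omega>)))"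
      by (rule nn_integral_density[symmetric]) auto
    also have "\<dots> = (\<integral>\<^sup>+x. emeasure (P x) A \<partial>distr (density N (\<lambda>\<omega>. ennreal (W \<omega>))) borel (X i))"
      by (rule nn_integral_distr[symmetric]) auto
    also have "\<dots> = emeasure ?r A"
      by (rule emeasure_bind[symmetric]) (auto intro: kernel_subprob')
    finally show "emeasure ?l A = emeasure ?r A" .
  qed
  have "(\<integral>\<^sup>+\<omega>. ennreal (W \<omega>) * G (X (Suc i) \<omega>) \<partial>N) = (\<integral>\<^sup>+\<omega>. G (X (Suc i) \<omega>) \<partial>density N (\<lambda>\<omega>. ennreal (W \<omega>)))"
    by (rule nn_integral_density[symmetric]) auto
  also have "\<dots> = (\<integral>\<^sup>+x. G x \<partial>distr (density N (\<lambda>\<omega>. ennreal (W \<omega>))) borel (X (Suc i)))"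
    by (rule nn_integral_distr[symmetric]) auto
  also have "\<dots> = (\<integral>\<^sup>+x. (\<integral>\<^sup>+y. G y \<partial>P x) \<partial>distr (density N (\<lambda>\<omega>. ennreal (W \<omega>))) borel (X i))"
    unfolding eq by (rule nn_integral_bind[OF G]) (auto intro: kernel_subprob')
  also have "\<dots> = (\<integral>\<^sup>+\<omega>. (\<integral>\<^sup>+y. G y \<partial>P (X i \<omega>)) \<partial>density N (\<lambda>\<omega>. ennreal (W \<omega>)))"
    by (rule nn_integral_distr) auto
  also have "\<dots> = (\<integral>\<^sup>+\<omega>. ennreal (W \<omega>) * (\<integral>\<^sup>+y. G y \<partial>P (X i \<omega>)) \<partial>N)"
    by (rule nn_integral_density) auto
  finally show ?thesis by (simp add: W_def)
qed

lemma nn_integral_X: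
  assumes "i \<in> {1..n}" and G [measurable]: "G \<in> borel_measurable borel"
  shows "(\<integral>\<^sup>+\<omega>. G (X i \<omega>) \<partial>N) = (\<integral>\<^sup>+x. G x \<partial>\<pi>)"
proof -
  from assms have "1 \<le> i" "i \<le> n" by auto
  then show ?thesis using G
  proof (induction i arbitrary: G rule: dec_induct)
    case base
    then show ?case using X_measurable[of 1] n nn_integral_distr[of "X 1" N borel G] by (simp add: initial[unfolded One_nat_def])
  next
    case (step i)
    note [measurable] = step.prems(2)
    have "(\<integral>\<^sup>+\<omega>. G (X (Suc i) \<omega>) \<partial>N) = (\<integral>\<^sup>+\<omega>. (\<integral>\<^sup>+y. G y \<partial>P (X i \<omega>)) \<partial>N)"
      using chain_step[of i "\<lambda>_. 1" 1 G] step by simp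
    also have "\<dots> = (\<integral>\<^sup>+x. (\<integral>\<^sup>+y. G y \<partial>P x) \<partial>\<pi>)" using step by (intro step.IH) auto
    also have "\<dots> = (\<integral>\<^sup>+x. G x \<partial>\<pi>)" by (rule nn_integral_stationary) fact
    finally show ?case .
  qed
qed

lemma distr_X: "i \<in> {1..n} \<Longrightarrow> distr N borel (X i) = \<pi>"
proof (rule measure_eqI)
  fix A assume i: "i \<in> {1..n}" and "A \<in> sets (distr N borel (X i))"
  then have [measurable]: "A \<in> sets borel" by simp
  have "emeasure (distr N borel (X i)) A = (\<integral>\<^sup>+\<omega>. indicator A (X i \<omega>) \<partial>N)"
    using nn_integral_distr[OF X_measurable[OF i], of "indicator A"] by simp
  then show "emeasure (distr N borel (X i)) A = emeasure \<pi> A" using nn_integral_X[OF i, of "indicator A"] by simp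
qed simp

text \<open>Backward induction: in \<open>claim\<close> for k the observations after time k have
  been integrated out, and the exponentials of the others except the last form the bounded weight
  that \<open>chain_step\<close> accepts.\<close>

lemma expectation_exp_sum:
  fixes u :: "nat \<Rightarrow> 'a \<Rightarrow> real"
  assumes u [measurable]: "\<And>i. u i \<in> borel_measurable borel" and ub: "\<And>i x. \<bar>u i x\<bar> \<le> c"
  shows "(\<integral>\<omega>. exp (\<Sum>i=1..n. u i (X i \<omega>)) \<partial>N) = (\<integral>x. forward_weight u (n - 1) 1 x \<partial>\<pi>)"
proof -
  note fm [measurable] = forward_weight_measurable[OF u ub]
  note f0 = forward_weight_nonneg[OF u ub] and fb = forward_weight_bound[OF u ub]
  have claim: "(\<integral>\<^sup>+\<omega>. ennreal (\<Prod>i=1..n. exp (u i (X i \<omega>))) \<partial>N) =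
    (\<integral>\<^sup>+\<omega>. ennreal (\<Prod>i=1..<k. exp (u i (X i \<omega>))) * ennreal (forward_weight u (n - k) k (X k \<omega>)) \<partial>N)"
    if "1 \<le> k" "k \<le> n" for k
    using that(2,1)
  proof (induction k rule: inc_induct)
    case base
    have "{1..n} = insert n {1..<n}" using n by auto
    then show ?case by (simp add: ennreal_mult[symmetric] prod_nonneg mult.commute)
  next
    case (step k)
    let ?w = "\<lambda>z. \<Prod>i=1..k. exp (u i (z i))"
    have kI: "{1..<Suc k} = {1..k}" "{1..k} = insert k {1..<k}" using step by auto
    have nk: "n - k = Suc (n - Suc k)" using step by simp
    have "(\<integral>\<^sup>+\<omega>. ennreal (\<Prod>i=1..n. exp (u i (X i \<omega>))) \<partial>N) =
      (\<integral>\<^sup>+\<omega>. ennreal (?w (\<lambda>j\<in>{1..k}. X j \<omega>)) * ennreal (forward_weight u (n - Suc k) (Suc k) (X (Suc k) \<omega>)) \<partial>N)"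
    proof -
      have "?w (\<lambda>j\<in>{1..k}. X j \<omega>) = (\<Prod>i=1..<Suc k. exp (u i (X i \<omega>)))" for \<omega>
        unfolding kI(1) by (intro prod.cong) auto
      then show ?thesis using step.IH by simp
    qed
    also have "\<dots> = (\<integral>\<^sup>+\<omega>. ennreal (?w (\<lambda>j\<in>{1..k}. X j \<omega>)) * (\<integral>\<^sup>+y. ennreal (forward_weight u (n - Suc k) (Suc k) y) \<partial>P (X k \<omega>)) \<partial>N)"
    proof (rule chain_step)
      show "?w \<in> borel_measurable (\<Pi>\<^sub>M j\<in>{1..k}. borel)"
      proof (intro borel_measurable_prod)
        fix i assume "i \<in> {1..k}"
        then have [measurable]: "(\<lambda>z. z i) \<in> (\<Pi>\<^sub>M j\<in>{1..k}. borel) \<rightarrow>\<^sub>M (borel :: 'a measure)"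
          by (rule measurable_component_singleton)
        show "(\<lambda>z. exp (u i (z i))) \<in> borel_measurable (\<Pi>\<^sub>M j\<in>{1..k}. borel)" by measurable
      qed
      show "?w z \<le> (\<Prod>i=1..k. exp c)" for z
        using ub by (intro prod_mono) (auto simp: abs_le_iff)
    qed (use step in \<open>auto intro: prod_nonneg\<close>)
    also have "\<dots> = (\<integral>\<^sup>+\<omega>. ennreal (\<Prod>i=1..<k. exp (u i (X i \<omega>))) * ennreal (forward_weight u (n - k) k (X k \<omega>)) \<partial>N)"
    proof (intro nn_integral_cong)
      fix \<omega>
      interpret Pk: prob_space "P (X k \<omega>)" by (rule prob_space_kernel)
      have "integrable (P (X k \<omega>)) (forward_weight u (n - Suc k) (Suc k))"
        by (intro Pk.real_L2_integrable Pk.real_L2_bounded[where B = "exp c ^ Suc (n - Suc k)"])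
           (use f0 fb in \<open>auto simp: abs_of_nonneg\<close>)
      then have "(\<integral>\<^sup>+y. ennreal (forward_weight u (n - Suc k) (Suc k) y) \<partial>P (X k \<omega>)) =
          ennreal (transition (forward_weight u (n - Suc k) (Suc k)) (X k \<omega>))"
        unfolding transition_def using f0 by (intro nn_integral_eq_integral) auto
      moreover have "?w (\<lambda>j\<in>{1..k}. X j \<omega>) = exp (u k (X k \<omega>)) * (\<Prod>i=1..<k. exp (u i (X i \<omega>)))"
        unfolding kI(2) by simp
      moreover have "0 \<le> transition (forward_weight u (n - Suc k) (Suc k)) (X k \<omega>)"
        unfolding transition_def using f0 by (intro integral_nonneg_AE) auto
      ultimately show "ennreal (?w (\<lambda>j\<in>{1..k}. X j \<omega>)) * (\<integral>\<^sup>+y. ennreal (forward_weight u (n - Suc k) (Suc k) y) \<partial>P (X k \<omega>)) =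
        ennreal (\<Prod>i=1..<k. exp (u i (X i \<omega>))) * ennreal (forward_weight u (n - k) k (X k \<omega>))"
        unfolding nk forward_weight.simps by (simp add: ennreal_mult prod_nonneg mult_ac)
    qed
    finally show ?case .
  qed
  have [measurable]: "i \<in> {1..n} \<Longrightarrow> X i \<in> borel_measurable N" for i by (rule X_measurable)
  have "(\<integral>\<omega>. exp (\<Sum>i=1..n. u i (X i \<omega>)) \<partial>N) = enn2real (\<integral>\<^sup>+\<omega>. ennreal (exp (\<Sum>i=1..n. u i (X i \<omega>))) \<partial>N)"
  proof (rule integral_eq_nn_integral)
    have "(\<lambda>\<omega>. \<Sum>i=1..n. u i (X i \<omega>)) \<in> borel_measurable N"
      by (intro borel_measurable_sum measurable_compose[OF X_measurable u])
    then show "(\<lambda>\<omega>. exp (\<Sum>i=1..n. u i (X i \<omega>))) \<in> borel_measurable N" by measurable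
  qed simp
  also have "(\<integral>\<^sup>+\<omega>. ennreal (exp (\<Sum>i=1..n. u i (X i \<omega>))) \<partial>N) = (\<integral>\<^sup>+\<omega>. ennreal (forward_weight u (n - 1) 1 (X 1 \<omega>)) \<partial>N)"
    using claim[of 1] n by (simp add: exp_sum)
  also have "\<dots> = (\<integral>\<^sup>+x. ennreal (forward_weight u (n - 1) 1 x) \<partial>\<pi>)"
    using n by (intro nn_integral_X) auto
  also have "enn2real \<dots> = (\<integral>x. forward_weight u (n - 1) 1 x \<partial>\<pi>)"
    using f0 by (intro integral_eq_nn_integral[symmetric]) auto
  finally show ?thesis .
qed

end
end

text \<open>The growth rate carries three terms of the geometric series, so that its estimate is
  polynomial; here they become the denominator of Bernstein's form.\<close>

lemma geometric_partial_sum_bound: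
  fixes x :: real
  assumes "0 \<le> x" "x < 1/5"
  shows "1 + 5 * x + 25 * x\<^sup>2 \<le> 1 / (1 - 5 * x)"
proof -
  have "(1 + 5 * x + 25 * x\<^sup>2) * (1 - 5 * x) = 1 - 125 * x ^ 3"
    by (simp add: power2_eq_square power3_eq_cube algebra_simps)
  also have "\<dots> \<le> 1" using assms by simp
  finally show ?thesis using assms by (simp add: pos_le_divide_eq)
qed

section \<open>Moment generating functions under either gap\<close>

context reversible_chain
begin

lemma abs_gap_bilinear_bound:
  assumes \<gamma>: "0 < abs_spectral_gap P \<pi>" and a: "a \<in> real_L2 \<pi>" and b: "b \<in> real_L2 \<pi>"
  defines "Q \<equiv> \<lambda>h. real_ip \<pi> h h - abs_spectral_gap P \<pi> * (real_ip \<pi> h h - (\<integral>x. h x \<partial>\<pi>)\<^sup>2)"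
  shows "real_ip \<pi> a (transition b) \<le> (Q a + Q b) / 2"
proof -
  let ?E = "\<lambda>h. \<integral>x. h x \<partial>\<pi>" and ?\<gamma> = "abs_spectral_gap P \<pi>"
  note ab = real_L2_add[OF a b] real_L2_diff[OF a b]
  have E: "?E (\<lambda>x. a x + b x) = ?E a + ?E b" "?E (\<lambda>x. a x - b x) = ?E a - ?E b"
    using pi.real_L2_integrable[OF a] pi.real_L2_integrable[OF b] by simp_all
  have I: "real_ip \<pi> (\<lambda>x. a x + b x) (\<lambda>x. a x + b x) = real_ip \<pi> a a + 2 * real_ip \<pi> a b + real_ip \<pi> b b"
    "real_ip \<pi> (\<lambda>x. a x - b x) (\<lambda>x. a x - b x) = real_ip \<pi> a a - 2 * real_ip \<pi> a b + real_ip \<pi> b b"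
    using a b ab by (simp_all add: real_ip_diff_left real_ip_diff_right real_ip_commute[of \<pi> b a])
  have "4 * real_ip \<pi> a (transition b) \<le>
    ((?E a + ?E b)\<^sup>2 + (1 - ?\<gamma>) * (real_ip \<pi> a a + 2 * real_ip \<pi> a b + real_ip \<pi> b b - (?E a + ?E b)\<^sup>2))
    - ((?E a - ?E b)\<^sup>2 - (1 - ?\<gamma>) * (real_ip \<pi> a a - 2 * real_ip \<pi> a b + real_ip \<pi> b b - (?E a - ?E b)\<^sup>2))"
    using abs_gap_form_bound[OF \<gamma> ab(1)] abs_gap_form_bound[OF \<gamma> ab(2)]
    unfolding transition_polarization[OF a b] E I abs_le_iff by linarith
  also have "\<dots> = 4 * ?E a * ?E b + 2 * (1 - ?\<gamma>) * ((real_ip \<pi> a a - (?E a)\<^sup>2) + (real_ip \<pi> b b - (?E b)\<^sup>2))"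
    by (simp add: power2_eq_square algebra_simps)
  also have "\<dots> \<le> 2 * (?E a)\<^sup>2 + 2 * (?E b)\<^sup>2 + 2 * (1 - ?\<gamma>) * ((real_ip \<pi> a a - (?E a)\<^sup>2) + (real_ip \<pi> b b - (?E b)\<^sup>2))"
    using sum_squares_bound[of "?E a" "?E b"] by simp
  also have "\<dots> = 2 * (Q a + Q b)" unfolding Q_def by (simp add: algebra_simps)
  finally show ?thesis by simp
qed

text \<open>\<open>tilted_form_bound\<close> is applied with y = absolute gap times the variance of
  h in place of the Dirichlet form. Plain Cauchy-Schwarz then gives the cross term with s = v /
  absolute gap.\<close>

lemma mgf_bound_abs_gap:
  fixes g :: "nat \<Rightarrow> 'a \<Rightarrow> real" and \<theta> C :: real
  assumes \<gamma>: "0 < abs_spectral_gap P \<pi>" and n: "1 \<le> n"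
    and g [measurable]: "\<And>i. g i \<in> borel_measurable borel" and gC: "\<And>i x. \<bar>g i x\<bar> \<le> C"
    and mean: "\<And>i. (\<integral>x. g i x \<partial>\<pi>) = 0"
    and \<theta>: "0 \<le> \<theta>" "5 * C / abs_spectral_gap P \<pi> * \<theta> < 1"
  defines "A \<equiv> (\<Sum>i=1..n. \<integral>x. (g i x)\<^sup>2 \<partial>\<pi>) / abs_spectral_gap P \<pi>"
  shows "(\<integral>x. forward_weight (\<lambda>i x. \<theta> * g i x) (n - 1) 1 x \<partial>\<pi>)
    \<le> exp (A * \<theta>\<^sup>2 / (1 - 5 * C / abs_spectral_gap P \<pi> * \<theta>))"
proof -
  let ?\<gamma> = "abs_spectral_gap P \<pi>"
  define x where "x = \<theta> * C / ?\<gamma>"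
  have C0: "0 \<le> C" using gC[of 0 undefined] by linarith
  have x: "0 \<le> x" "x < 1/5" using \<theta> \<gamma> C0 by (auto simp: x_def field_simps)
  have \<gamma>1: "?\<gamma> \<le> 1" by (rule abs_spectral_gap_le_1)
  define u where "u i = (\<lambda>z. \<theta> * g i z)" for i
  have um [measurable]: "u i \<in> borel_measurable borel" for i unfolding u_def by measurable
  have um': "u i \<in> borel_measurable \<pi>" for i using um by (simp cong: measurable_cong_sets)
  have ub: "\<bar>u i z\<bar> \<le> ?\<gamma> * x" for i z
    using mult_left_mono[OF gC[of i z] \<theta>(1)] \<gamma> \<theta> by (simp add: u_def x_def abs_mult)
  have c2: "?\<gamma> * x \<le> 2 * x" using \<gamma>1 x by (intro mult_right_mono) auto
  have Eu: "(\<integral>z. u i z \<partial>\<pi>) = 0" for i by (simp add: u_def mean)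
  have uL: "u i \<in> real_L2 \<pi>" for i by (rule pi.real_L2_bounded[OF um' ub])
  define v where "v i = (\<integral>z. (u i z)\<^sup>2 \<partial>\<pi>)" for i
  have v0: "0 \<le> v i" for i by (simp add: v_def)
  define s where "s i = v i / ?\<gamma>" for i
  have s: "v i \<le> s i" "?\<gamma> * s i = v i" for i
    using \<gamma> \<gamma>1 v0[of i] by (auto simp: s_def pos_le_divide_eq mult_left_le)
  \<comment> \<open>Dropping the negative multiples of v leaves a rate that also bounds the
    logarithm of E exp (u i), so that the end factors complete the product to a square.\<close>
  define q where "q i = s i * (1 + 5 * x + 25 * x\<^sup>2)" for i
  have pq: "s i - v i / 5 + (5 * x + 25 * x\<^sup>2) * (s i - v i / 10) \<le> q i" for i
  proof -
    have "0 \<le> (5 * x + 25 * x\<^sup>2) * (v i / 10)" using x v0[of i] by (intro mult_nonneg_nonneg add_nonneg_nonneg) auto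
    moreover have "q i - (s i - v i / 5 + (5 * x + 25 * x\<^sup>2) * (s i - v i / 10)) = v i / 5 + (5 * x + 25 * x\<^sup>2) * (v i / 10)"
      by (simp add: q_def algebra_simps)
    ultimately show ?thesis using v0[of i] by linarith
  qed
  have tn0: "0 \<le> tilted_norm2 w h" for w h unfolding tilted_norm2_def by simp
  have Q: "real_ip \<pi> h h - ?\<gamma> * (real_ip \<pi> h h - (\<integral>x. h x \<partial>\<pi>)\<^sup>2) \<le> exp (q i) * tilted_norm2 (u i) h"
    if h: "h \<in> real_L2 \<pi>" for i h
  proof -
    let ?m = "\<integral>x. h x \<partial>\<pi>" and ?y = "?\<gamma> * (real_ip \<pi> h h - (\<integral>x. h x \<partial>\<pi>)\<^sup>2)"
    have "real_ip \<pi> (u i) h = real_ip \<pi> (u i) (\<lambda>x. h x - ?m)"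
      using Eu[of i] by (subst real_ip_diff_right[OF h pi.real_L2_const uL]) (simp add: real_ip_def)
    then have "(real_ip \<pi> (u i) h)\<^sup>2 \<le> real_ip \<pi> (u i) (u i) * (real_ip \<pi> h h - ?m\<^sup>2)"
      using real_L2.Cauchy_Schwarz[OF uL real_L2_center[OF h]] real_ip_center(1)[OF h] by metis
    also have "\<dots> = s i * ?y" using \<gamma> by (simp add: s_def v_def real_ip_def power2_eq_square)
    finally have uh: "(real_ip \<pi> (u i) h)\<^sup>2 \<le> s i * ?y" .
    have s2: "v i / 2 \<le> s i" using s(1)[of i] v0[of i] by linarith
    have "real_ip \<pi> h h - ?y \<le> (1 + (s i - v i / 5 + (5 * x + 25 * x\<^sup>2) * (s i - v i / 10))) * tilted_norm2 (u i) h"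
      unfolding tilted_norm2_def v_def
      using \<gamma> \<gamma>1 x s(2)[of i] s2 uh h
      by (intro pi.tilted_form_bound[OF _ _ _ _ um' ub Eu]) (auto simp: v_def)
    also have "\<dots> \<le> exp (q i) * tilted_norm2 (u i) h"
      using order_trans[OF add_left_mono[OF pq] exp_ge_add_one_self] by (intro mult_right_mono tn0)
    finally show ?thesis .
  qed
  have Ee: "(\<integral>z. exp (u i z) \<partial>\<pi>) \<le> exp (q i)" for i
  proof -
    have "(1 + x) / 2 * v i \<le> s i * (1 + 5 * x + 25 * x\<^sup>2)"
      unfolding mult.commute[of "(1 + x) / 2"] using s(1)[of i] x v0[of i] by (intro mult_mono) auto
    moreover have "(\<integral>z. exp (u i z) \<partial>\<pi>) \<le> exp ((1 + x) / 2 * v i)"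
      unfolding v_def using x by (intro pi.expectation_exp_bound[OF _ c2 um' ub Eu]) auto
    ultimately show ?thesis by (auto simp: q_def elim: order_trans)
  qed
  have "(\<integral>z. forward_weight u (n - 1) 1 z \<partial>\<pi>)\<^sup>2
    \<le> (\<integral>z. exp (u 1 z) \<partial>\<pi>) * ((\<Prod>j<n - 1. exp (q (1 + j)) * exp (q (Suc (1 + j)))) * (\<integral>z. exp (u n z) \<partial>\<pi>))"
  proof (rule expectation_forward_weight_power2[OF um ub])
    fix i a b assume a: "a \<in> real_L2 \<pi>" and b: "b \<in> real_L2 \<pi>"
    show "real_ip \<pi> a (transition b) \<le> (exp (q i) * tilted_norm2 (u i) a + exp (q (Suc i)) * tilted_norm2 (u (Suc i)) b) / 2"
      using abs_gap_bilinear_bound[OF \<gamma> a b] Q[OF a, of i] Q[OF b, of "Suc i"] by argo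
  qed (use n in auto)
  also have "\<dots> \<le> exp (q 1) * ((\<Prod>j<n - 1. exp (q (1 + j)) * exp (q (Suc (1 + j)))) * exp (q n))"
    using Ee by (intro mult_mono mult_left_mono mult_nonneg_nonneg prod_nonneg) auto
  also have "\<dots> = (exp (\<Sum>i=1..n. q i))\<^sup>2" by (rule prod_exp_adjacent[OF n])
  finally have "(\<integral>z. forward_weight u (n - 1) 1 z \<partial>\<pi>) \<le> exp (\<Sum>i=1..n. q i)"
    by (rule power2_le_imp_le) simp
  also have "(\<Sum>i=1..n. q i) \<le> A * \<theta>\<^sup>2 / (1 - 5 * C / ?\<gamma> * \<theta>)"
  proof -
    have "v i = \<theta>\<^sup>2 * (\<integral>x. (g i x)\<^sup>2 \<partial>\<pi>)" for i by (simp add: v_def u_def power_mult_distrib)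
    then have "(\<Sum>i=1..n. s i) = A * \<theta>\<^sup>2"
      by (simp add: s_def A_def sum_distrib_left[symmetric] sum_divide_distrib[symmetric])
    then have "(\<Sum>i=1..n. q i) = A * \<theta>\<^sup>2 * (1 + 5 * x + 25 * x\<^sup>2)"
      by (simp add: q_def sum_distrib_right[symmetric])
    also have "\<dots> \<le> A * \<theta>\<^sup>2 * (1 / (1 - 5 * x))"
    proof (intro mult_left_mono geometric_partial_sum_bound x mult_nonneg_nonneg)
      show "0 \<le> A" using \<gamma> unfolding A_def by (intro divide_nonneg_pos sum_nonneg) auto
    qed simp
    also have "5 * x = 5 * C / ?\<gamma> * \<theta>" by (simp add: x_def)
    finally show ?thesis by simp
  qed
  finally show ?thesis by (simp add: u_def[abs_def])
qed

text \<open>The rate per transition is p = q - v/10. After the square root the end factors are worth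
  (1 + x) v / 2, to be paid by the one spare q, as n factors exp q are allowed for n - 1
  transitions, and by the v/10 held back at each transition. This uses at least one
  transition.\<close>

lemma mgf_bound_gap:
  fixes g :: "'a \<Rightarrow> real" and \<theta> C S V :: real
  defines "V \<equiv> \<integral>x. (g x)\<^sup>2 \<partial>\<pi>"
  assumes \<gamma>: "0 < spectral_gap P \<pi>" "spectral_gap P \<pi> \<le> 2" and n: "2 \<le> n"
    and g [measurable]: "g \<in> borel_measurable borel" and gC: "\<And>x. \<bar>g x\<bar> \<le> C"
    and mean: "(\<integral>x. g x \<partial>\<pi>) = 0"
    and S: "V / 2 \<le> S" "spectral_gap P \<pi> * S \<le> V"
    and var: "\<And>h. h \<in> real_L2 \<pi> \<Longrightarrow> (real_ip \<pi> g h)\<^sup>2 \<le> S * Dirichlet h"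
    and \<theta>: "0 \<le> \<theta>" "5 * C / spectral_gap P \<pi> * \<theta> < 1"
  shows "(\<integral>x. forward_weight (\<lambda>i x. \<theta> * g x) (n - 1) 1 x \<partial>\<pi>)
    \<le> exp (real n * (S - V / 10) * \<theta>\<^sup>2 / (1 - 5 * C / spectral_gap P \<pi> * \<theta>))"
proof -
  let ?\<gamma> = "spectral_gap P \<pi>"
  define x where "x = \<theta> * C / ?\<gamma>"
  have C0: "0 \<le> C" using gC[of undefined] by linarith
  have x: "0 \<le> x" "x < 1/5" using \<theta> \<gamma> C0 by (auto simp: x_def field_simps)
  define u where "u = (\<lambda>z. \<theta> * g z)"
  have um [measurable]: "u \<in> borel_measurable borel" unfolding u_def by measurable
  have um': "u \<in> borel_measurable \<pi>" using um by (simp cong: measurable_cong_sets)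
  have ub: "\<bar>u z\<bar> \<le> ?\<gamma> * x" for z
    using mult_left_mono[OF gC[of z] \<theta>(1)] \<gamma> \<theta> by (simp add: u_def x_def abs_mult)
  have c2: "?\<gamma> * x \<le> 2 * x" using \<gamma> x by (intro mult_right_mono) auto
  have Eu: "(\<integral>z. u z \<partial>\<pi>) = 0" by (simp add: u_def mean)
  define v where "v = (\<integral>z. (u z)\<^sup>2 \<partial>\<pi>)"
  have v: "v = \<theta>\<^sup>2 * V" by (simp add: v_def u_def V_def power_mult_distrib)
  have v0: "0 \<le> v" by (simp add: v_def)
  define s where "s = \<theta>\<^sup>2 * S"
  have s: "v / 2 \<le> s" "?\<gamma> * s \<le> v"
    using mult_left_mono[OF S(1), of "\<theta>\<^sup>2"] mult_left_mono[OF S(2), of "\<theta>\<^sup>2"] by (auto simp: s_def v mult_ac)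
  define q where "q = (s - v / 10) * (1 + 5 * x + 25 * x\<^sup>2)"
  define p where "p = s - v / 5 + (5 * x + 25 * x\<^sup>2) * (s - v / 10)"
  have pq: "p = q - v / 10" by (simp add: p_def q_def algebra_simps)
  have tn0: "0 \<le> tilted_norm2 w h" for w h unfolding tilted_norm2_def by simp
  have form: "real_ip \<pi> (transition h) h \<le> exp p * tilted_norm2 u h" if h: "h \<in> real_L2 \<pi>" for h
  proof -
    have "real_ip \<pi> u h = \<theta> * real_ip \<pi> g h" by (simp add: u_def real_ip_def mult.assoc)
    then have uh: "(real_ip \<pi> u h)\<^sup>2 \<le> s * Dirichlet h"
      using mult_left_mono[OF var[OF h], of "\<theta>\<^sup>2"] by (simp add: power_mult_distrib s_def mult.assoc)
    have "real_ip \<pi> h h - Dirichlet h \<le> (1 + p) * tilted_norm2 u h"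
      unfolding tilted_norm2_def p_def v_def
      using \<gamma> x s uh h Poincare_inequality[OF \<gamma>(1) h]
      by (intro pi.tilted_form_bound[OF _ _ _ _ um' ub Eu]) (auto simp: v_def)
    also have "\<dots> \<le> exp p * tilted_norm2 u h" by (intro mult_right_mono tn0 exp_ge_add_one_self)
    finally show ?thesis by (simp add: Dirichlet_def)
  qed
  have Ee: "(\<integral>z. exp (u z) \<partial>\<pi>) \<le> exp ((1 + x) / 2 * v)"
    unfolding v_def using x by (intro pi.expectation_exp_bound[OF _ c2 um' ub Eu]) auto
  have "(\<integral>z. forward_weight (\<lambda>_. u) (n - 1) 1 z \<partial>\<pi>)\<^sup>2
    \<le> (\<integral>z. exp (u z) \<partial>\<pi>) * ((\<Prod>j<n - 1. exp p * exp p) * (\<integral>z. exp (u z) \<partial>\<pi>))"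
  proof (rule expectation_forward_weight_power2[where u = "\<lambda>_. u" and R = "\<lambda>_. exp p", OF um ub])
    fix i a b assume a: "a \<in> real_L2 \<pi>" and b: "b \<in> real_L2 \<pi>"
    show "real_ip \<pi> a (transition b) \<le> (exp p * tilted_norm2 u a + exp p * tilted_norm2 u b) / 2"
      by (rule tilted_bilinear_of_form[OF form um ub a b])
  qed (use n in auto)
  also have "\<dots> \<le> exp ((1 + x) / 2 * v) * ((\<Prod>j<n - 1. exp p * exp p) * exp ((1 + x) / 2 * v))"
    using Ee by (intro mult_mono mult_left_mono mult_nonneg_nonneg prod_nonneg) auto
  also have "\<dots> = (exp ((1 + x) / 2 * v + real (n - 1) * p))\<^sup>2"
    by (simp add: exp_add exp_of_nat_mult power2_eq_square power_mult_distrib)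
  finally have "(\<integral>z. forward_weight (\<lambda>_. u) (n - 1) 1 z \<partial>\<pi>) \<le> exp ((1 + x) / 2 * v + real (n - 1) * p)"
    by (rule power2_le_imp_le) simp
  also have "(1 + x) / 2 * v + real (n - 1) * p \<le> real n * q"
  proof -
    \<comment> \<open>s >= v/2 leaves 2/5 v <= s - v/10; the missing v/10 comes from a single
      transition.\<close>
    have "2 / 5 * v * (1 + 5 * x) \<le> (s - v / 10) * (1 + 5 * x + 25 * x\<^sup>2)"
      using s v0 x by (intro mult_mono) auto
    moreover have "(1 + x) / 2 * v \<le> 2 / 5 * v * (1 + 5 * x) + v / 10"
      using mult_nonneg_nonneg[OF x(1) v0] by (simp add: field_simps)
    moreover have "1 * (v / 10) \<le> real (n - 1) * (v / 10)" using n v0 by (intro mult_right_mono) auto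
    ultimately have "(1 + x) / 2 * v \<le> q + real (n - 1) * (v / 10)" unfolding q_def by linarith
    moreover have "real (n - 1) * p = real (n - 1) * q - real (n - 1) * (v / 10)" by (simp add: pq algebra_simps)
    moreover have "real n * q = q + real (n - 1) * q" using n by (simp add: of_nat_diff algebra_simps)
    ultimately show ?thesis by linarith
  qed
  also have "real n * q \<le> real n * (S - V / 10) * \<theta>\<^sup>2 / (1 - 5 * C / ?\<gamma> * \<theta>)"
  proof -
    have "q \<le> (s - v / 10) * (1 / (1 - 5 * x))"
      unfolding q_def using s v0 by (intro mult_left_mono geometric_partial_sum_bound x) auto
    also have "s - v / 10 = \<theta>\<^sup>2 * (S - V / 10)" by (simp add: s_def v algebra_simps)
    also have "5 * x = 5 * C / ?\<gamma> * \<theta>" by (simp add: x_def)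
    finally have "real n * q \<le> real n * (\<theta>\<^sup>2 * (S - V / 10) * (1 / (1 - 5 * C / ?\<gamma> * \<theta>)))"
      by (rule mult_left_mono) simp
    then show ?thesis by (simp add: mult_ac)
  qed
  finally show ?thesis by (simp add: u_def)
qed

text \<open>The Dirichlet form of the solution of the Poisson equation is \<open>(\<sigma>\<^sub>a\<^sub>s\<^sup>2 + V) / 2\<close>.\<close>

lemma asymptotic_variance_form:
  assumes \<gamma>: "0 < spectral_gap P \<pi>" and f: "f \<in> real_L2 \<pi>"
  defines "g \<equiv> \<lambda>x. f x - (\<integral>y. f y \<partial>\<pi>)"
  defines "V \<equiv> \<integral>x. (g x)\<^sup>2 \<partial>\<pi>"
  defines "S \<equiv> (asymptotic_variance P \<pi> f + V) / 2"
  assumes V: "0 < V"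
  shows "V / 2 \<le> S" "spectral_gap P \<pi> * S \<le> V" "spectral_gap P \<pi> \<le> 2"
    and "\<And>h. h \<in> real_L2 \<pi> \<Longrightarrow> (real_ip \<pi> g h)\<^sup>2 \<le> S * Dirichlet h"
proof -
  note T = self_adjoint_transition and TL = transition_real_L2(1)
  have gL: "g \<in> real_L2 \<pi>" unfolding g_def by (rule real_L2_center[OF f])
  have Vg: "V = real_ip \<pi> g g" by (simp add: V_def real_ip_def power2_eq_square)
  have mean: "(\<integral>x. g x \<partial>\<pi>) = 0" unfolding g_def by (rule real_ip_center(3)[OF f])
  show \<gamma>2: "spectral_gap P \<pi> \<le> 2"
    using V by (intro spectral_gap_le_2[OF \<gamma> gL]) (simp add: mean Vg)
  obtain \<phi> where \<phi>: "\<phi> \<in> real_L2 \<pi>" and \<phi>0: "(\<integral>x. \<phi> x \<partial>\<pi>) = 0"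
    and eq: "AE x in \<pi>. \<phi> x - transition \<phi> x = g x"
    and av: "asymptotic_variance P \<pi> f = 2 * real_ip \<pi> g \<phi> - real_ip \<pi> g g"
    using asymptotic_variance_Poisson[OF \<gamma> f] unfolding g_def by blast
  have S: "S = real_ip \<pi> g \<phi>" by (simp add: S_def av Vg)
  define B where "B h = (\<lambda>x. h x - transition h x)" for h
  have BL: "B h \<in> real_L2 \<pi>" if "h \<in> real_L2 \<pi>" for h unfolding B_def using that by (intro real_L2_diff TL)
  have Bip: "real_ip \<pi> (B h) k = real_ip \<pi> h k - real_ip \<pi> (transition h) k"
    if "h \<in> real_L2 \<pi>" "k \<in> real_L2 \<pi>" for h k
    unfolding B_def using that by (intro real_ip_diff_left TL)
  have B: "real_L2.self_adjoint \<pi> B"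
    unfolding real_L2.self_adjoint_def
  proof (intro conjI ballI BL)
    fix h k assume h: "h \<in> real_L2 \<pi>" and k: "k \<in> real_L2 \<pi>"
    have "real_ip \<pi> (B h) k = real_ip \<pi> k h - real_ip \<pi> (transition k) h"
      using Bip[OF h k] real_L2.self_adjoint_swap[OF T h k] real_ip_commute[of \<pi> h k]
        real_ip_commute[of \<pi> h "transition k"] by simp
    also have "\<dots> = real_ip \<pi> h (B k)"
      using Bip[OF k h] real_ip_commute[of \<pi> h "B k"] by simp
    finally show "real_ip \<pi> (B h) k = real_ip \<pi> h (B k)" .
  qed
  have BD: "real_ip \<pi> (B h) h = Dirichlet h" if "h \<in> real_L2 \<pi>" for h
    using Bip[OF that that] by (simp add: Dirichlet_def)
  have gB: "real_ip \<pi> g h = real_ip \<pi> (B \<phi>) h" if "h \<in> real_L2 \<pi>" for h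
    using eq that gL BL[OF \<phi>] by (intro real_ip_cong_AE) (auto simp: B_def)
  have SD: "S = Dirichlet \<phi>" using gB[OF \<phi>] BD[OF \<phi>] by (simp add: S)
  show var: "(real_ip \<pi> g h)\<^sup>2 \<le> S * Dirichlet h" if h: "h \<in> real_L2 \<pi>" for h
    using real_L2.Cauchy_Schwarz_form[OF B _ \<phi> h] Dirichlet_nonneg
    by (simp add: BD gB[OF h] SD \<phi> h)
  \<comment> \<open>Taking h = g in \<open>var\<close> gives V^2 <= S * 2 V, the lower bound on
    S.\<close>
  have "Dirichlet g \<le> 2 * V"
    using transition_form_bound[OF gL] by (simp add: Dirichlet_def Vg abs_le_iff)
  moreover have S0: "0 \<le> S" unfolding SD by (rule Dirichlet_nonneg[OF \<phi>])
  ultimately have "V * V \<le> (2 * S) * V"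
    using var[OF gL] mult_left_mono[of "Dirichlet g" "2 * V" S] by (simp add: Vg[symmetric] power2_eq_square)
  then have VS: "V \<le> 2 * S" using V by (rule mult_right_le_imp_le)
  then show "V / 2 \<le> S" by simp
  have Spos: "0 < S" using VS V by simp
  \<comment> \<open>The upper bound on S: the Poincare inequality for \<phi> gives \<gamma>
    |\<phi>|^2 <= S, while S = <g, \<phi>> gives S^2 <= V |\<phi>|^2.\<close>
  have "spectral_gap P \<pi> * real_ip \<pi> \<phi> \<phi> \<le> S"
    using Poincare_inequality[OF \<gamma> \<phi>] by (simp add: \<phi>0 SD)
  then have "V * (spectral_gap P \<pi> * real_ip \<pi> \<phi> \<phi>) \<le> V * S" using V by (intro mult_left_mono) auto
  moreover have "S * S \<le> V * real_ip \<pi> \<phi> \<phi>"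
    using real_L2.Cauchy_Schwarz[OF gL \<phi>] by (simp add: S Vg power2_eq_square)
  then have "spectral_gap P \<pi> * (S * S) \<le> spectral_gap P \<pi> * (V * real_ip \<pi> \<phi> \<phi>)"
    using \<gamma> by (intro mult_left_mono) auto
  ultimately have "spectral_gap P \<pi> * S * S \<le> V * S" by (simp add: mult_ac)
  then show "spectral_gap P \<pi> * S \<le> V" using Spos by (rule mult_right_le_imp_le)
qed

end

section \<open>Tail bounds for the chain\<close>

context reversible_chain
begin

context
  fixes N :: "'w measure" and X :: "nat \<Rightarrow> 'w \<Rightarrow> 'a" and n :: nat
  assumes chain: "markov_chain N P n X" and initial: "distr N borel (X 1) = \<pi>" and n: "1 \<le> n"
begin

interpretation N: prob_space N
  using chain by (simp add: markov_chain_def)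

lemmas chain_X_measurable = X_measurable[OF chain initial n]
lemmas chain_distr_X = distr_X[OF chain initial n]
lemmas chain_expectation_exp_sum = expectation_exp_sum[OF chain initial n]

lemma expectation_sum_X:
  assumes f: "\<And>i. i \<in> {1..n} \<Longrightarrow> f i \<in> real_L2 \<pi>"
  shows "(\<integral>\<omega>. (\<Sum>i=1..n. f i (X i \<omega>)) \<partial>N) = (\<Sum>i=1..n. \<integral>x. f i x \<partial>\<pi>)"
proof -
  have "integrable N (\<lambda>\<omega>. f i (X i \<omega>)) \<and> (\<integral>\<omega>. f i (X i \<omega>) \<partial>N) = (\<integral>x. f i x \<partial>\<pi>)" if i: "i \<in> {1..n}" for i
  proof -
    have [measurable]: "f i \<in> borel_measurable borel" using f[OF i] by measurable
    note m [measurable] = chain_X_measurable[OF i]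
    show ?thesis
      using integral_distr[OF m, of "f i"] integrable_distr_eq[OF m, of "f i"] pi.real_L2_integrable[OF f[OF i]]
      by (simp add: chain_distr_X[OF i])
  qed
  then show ?thesis by (subst Bochner_Integration.integral_sum) auto
qed

lemma tail_of_mgf:
  fixes g :: "nat \<Rightarrow> 'a \<Rightarrow> real"
  assumes g: "\<And>i. g i \<in> borel_measurable borel" and gC: "\<And>i x. \<bar>g i x\<bar> \<le> C"
    and ab: "0 \<le> a" "0 \<le> b" and t: "0 \<le> t"
    and mgf: "\<And>\<theta>. 0 \<le> \<theta> \<Longrightarrow> b * \<theta> < 1 \<Longrightarrow>
      (\<integral>x. forward_weight (\<lambda>i x. \<theta> * g i x) (n - 1) 1 x \<partial>\<pi>) \<le> exp (a * \<theta>\<^sup>2 / (1 - b * \<theta>))"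
    and mgf': "\<And>\<theta>. 0 \<le> \<theta> \<Longrightarrow> b * \<theta> < 1 \<Longrightarrow>
      (\<integral>x. forward_weight (\<lambda>i x. \<theta> * - g i x) (n - 1) 1 x \<partial>\<pi>) \<le> exp (a * \<theta>\<^sup>2 / (1 - b * \<theta>))"
  shows "measure N {\<omega> \<in> space N. t \<le> \<bar>\<Sum>i=1..n. g i (X i \<omega>)\<bar>} \<le> 2 * exp (- (t\<^sup>2 / (4 * a + 2 * b * t)))"
proof (rule N.Bernstein_tail[OF _ _ ab t])
  show "(\<lambda>\<omega>. \<Sum>i=1..n. g i (X i \<omega>)) \<in> borel_measurable N"
    by (intro borel_measurable_sum measurable_compose[OF chain_X_measurable g])
  show "\<bar>\<Sum>i=1..n. g i (X i \<omega>)\<bar> \<le> (\<Sum>i=1..n. C)" for \<omega>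
    by (rule order_trans[OF sum_abs sum_mono]) (rule gC)
  fix \<theta> assume \<theta>: "0 \<le> \<theta>" "b * \<theta> < 1"
  have b: "\<bar>\<theta> * g i x\<bar> \<le> \<theta> * C" "\<bar>\<theta> * - g i x\<bar> \<le> \<theta> * C" for i x
    using mult_left_mono[OF gC[of i x] \<theta>(1)] \<theta>(1) by (simp_all add: abs_mult)
  have m: "(\<lambda>x. \<theta> * g i x) \<in> borel_measurable borel" "(\<lambda>x. \<theta> * - g i x) \<in> borel_measurable borel" for i
    using g[of i] by measurable
  show "N.expectation (\<lambda>\<omega>. exp (\<theta> * (\<Sum>i=1..n. g i (X i \<omega>)))) \<le> exp (a * \<theta>\<^sup>2 / (1 - b * \<theta>))"
    using chain_expectation_exp_sum[OF m(1) b(1)] mgf[OF \<theta>] by (simp add: sum_distrib_left)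
  show "N.expectation (\<lambda>\<omega>. exp (\<theta> * - (\<Sum>i=1..n. g i (X i \<omega>)))) \<le> exp (a * \<theta>\<^sup>2 / (1 - b * \<theta>))"
    using chain_expectation_exp_sum[OF m(2) b(2)] mgf'[OF \<theta>]
    by (simp add: sum_distrib_left sum_negf[symmetric] del: sum_negf)
qed

lemma tail_trivial:
  assumes "0 \<le> e"
  shows "measure N A \<le> 2 * exp e"
proof -
  have "measure N A \<le> 1" by (rule N.prob_le_1)
  also have "1 \<le> 2 * exp e" using exp_ge_add_one_self[of e] assms by linarith
  finally show ?thesis .
qed

text \<open>With zero variances the centred sum vanishes almost surely, because each X i has law
  \<pi>. This settles the case V = 0, outside the reach of
  \<open>asymptotic_variance_form\<close>.\<close>

lemma tail_degenerate:
  fixes g :: "nat \<Rightarrow> 'a \<Rightarrow> real"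
  assumes g: "\<And>i. i \<in> {1..n} \<Longrightarrow> g i \<in> real_L2 \<pi>" and V: "\<And>i. i \<in> {1..n} \<Longrightarrow> (\<integral>x. (g i x)\<^sup>2 \<partial>\<pi>) = 0" and t: "0 < t"
  shows "measure N {\<omega> \<in> space N. t \<le> \<bar>\<Sum>i=1..n. g i (X i \<omega>)\<bar>} = 0"
proof -
  have "AE \<omega> in N. g i (X i \<omega>) = 0" if i: "i \<in> {1..n}" for i
  proof -
    have [measurable]: "g i \<in> borel_measurable borel" using g[OF i] by measurable
    have "AE x in \<pi>. g i x = 0"
      using V[OF i] by (intro AE_eq_0_of_real_ip g i) (simp add: real_ip_def power2_eq_square)
    then have "AE x in distr N borel (X i). g i x = 0" unfolding chain_distr_X[OF i] .
    then show ?thesis by (subst (asm) AE_distr_iff[OF chain_X_measurable[OF i]]) auto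
  qed
  then have "AE \<omega> in N. \<forall>i\<in>{1..n}. g i (X i \<omega>) = 0" by (intro AE_finite_allI) auto
  then have "AE \<omega> in N. \<not> t \<le> \<bar>\<Sum>i=1..n. g i (X i \<omega>)\<bar>"
    by eventually_elim (use t in auto)
  then show ?thesis by (rule N.prob_eq_0_AE)
qed

text \<open>With \<gamma> the absolute gap, Bernstein's bound comes out with numerator t^2 * 2
  \<gamma> over the same denominator, and 2 \<gamma> - \<gamma>^2 <= 2 \<gamma>. If the gap is not
  positive, the exponent is nonnegative and the bound exceeds 1.\<close>

lemma tail_abs_gap:
  fixes f :: "nat \<Rightarrow> 'a \<Rightarrow> real"
  assumes f: "\<And>i. i \<in> {1..n} \<Longrightarrow> f i \<in> real_L2 \<pi>"
    and fC: "\<And>i x. i \<in> {1..n} \<Longrightarrow> \<bar>f i x - (\<integral>y. f i y \<partial>\<pi>)\<bar> \<le> C" and t: "0 \<le> t"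
  defines "\<gamma> \<equiv> abs_spectral_gap P \<pi>"
  defines "S \<equiv> \<lambda>\<omega>. \<Sum>i=1..n. f i (X i \<omega>)"
  defines "V \<equiv> \<Sum>i=1..n. \<integral>x. (f i x - (\<integral>y. f i y \<partial>\<pi>))\<^sup>2 \<partial>\<pi>"
  shows "measure N {\<omega> \<in> space N. t \<le> \<bar>S \<omega> - (\<integral>\<omega>'. S \<omega>' \<partial>N)\<bar>} \<le> 2 * exp (- (t\<^sup>2 * (2 * \<gamma> - \<gamma>\<^sup>2) / (8 * V + 20 * t * C)))"
proof -
  have C0: "0 \<le> C" using fC[of 1 undefined] n by force
  have V0: "0 \<le> V" unfolding V_def by (intro sum_nonneg) auto
  have D0: "0 \<le> 8 * V + 20 * t * C" using C0 V0 t by simp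
  show ?thesis
  proof (cases "0 < \<gamma>")
    case False
    then have "2 * \<gamma> - \<gamma>\<^sup>2 \<le> 0" using zero_le_power2[of \<gamma>] by linarith
    then show ?thesis
      using D0 by (intro tail_trivial) (simp add: divide_nonpos_nonneg mult_nonneg_nonpos)
  next
    case True
    \<comment> \<open>Set to 0 outside the observed times, because the moment bounds quantify over
      all indices.\<close>
    define g where "g i = (if i \<in> {1..n} then (\<lambda>x. f i x - (\<integral>y. f i y \<partial>\<pi>)) else (\<lambda>x. 0))" for i
    have gL: "g i \<in> real_L2 \<pi>" for i
      using real_L2_center[OF f] pi.real_L2_const by (simp add: g_def)
    have gm: "g i \<in> borel_measurable borel" for i using gL[of i] by measurable
    have gC: "\<bar>g i x\<bar> \<le> C" for i x using fC C0 by (simp add: g_def)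
    have mean: "(\<integral>x. g i x \<partial>\<pi>) = 0" for i using real_ip_center(3)[OF f] by (simp add: g_def)
    have Vg: "(\<Sum>i=1..n. \<integral>x. (g i x)\<^sup>2 \<partial>\<pi>) = V" by (simp add: V_def g_def)
    have Sg: "S \<omega> - (\<integral>\<omega>'. S \<omega>' \<partial>N) = (\<Sum>i=1..n. g i (X i \<omega>))" for \<omega>
      unfolding S_def using expectation_sum_X[OF f] by (simp add: g_def sum_subtractf)
    have "measure N {\<omega> \<in> space N. t \<le> \<bar>\<Sum>i=1..n. g i (X i \<omega>)\<bar>} \<le> 2 * exp (- (t\<^sup>2 / (4 * (V / \<gamma>) + 2 * (5 * C / \<gamma>) * t)))"
    proof (rule tail_of_mgf[OF gm gC])
      fix \<theta> :: real assume \<theta>: "0 \<le> \<theta>" "5 * C / \<gamma> * \<theta> < 1"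
      show "(\<integral>x. forward_weight (\<lambda>i x. \<theta> * g i x) (n - 1) 1 x \<partial>\<pi>) \<le> exp (V / \<gamma> * \<theta>\<^sup>2 / (1 - 5 * C / \<gamma> * \<theta>))"
        using mgf_bound_abs_gap[of n g C \<theta>, OF True[unfolded \<gamma>_def] n gm gC mean \<theta>[unfolded \<gamma>_def]]
        unfolding Vg \<gamma>_def .
      have "(\<integral>x. forward_weight (\<lambda>i x. \<theta> * - g i x) (n - 1) 1 x \<partial>\<pi>) \<le>
        exp ((\<Sum>i=1..n. \<integral>x. (- g i x)\<^sup>2 \<partial>\<pi>) / \<gamma> * \<theta>\<^sup>2 / (1 - 5 * C / \<gamma> * \<theta>))"
        using True n gm gC mean \<theta> unfolding \<gamma>_def by (intro mgf_bound_abs_gap) auto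
      then show "(\<integral>x. forward_weight (\<lambda>i x. \<theta> * - g i x) (n - 1) 1 x \<partial>\<pi>) \<le> exp (V / \<gamma> * \<theta>\<^sup>2 / (1 - 5 * C / \<gamma> * \<theta>))"
        by (simp add: Vg[symmetric])
    qed (use C0 V0 True t in auto)
    also have "\<dots> \<le> 2 * exp (- (t\<^sup>2 * (2 * \<gamma> - \<gamma>\<^sup>2) / (8 * V + 20 * t * C)))"
    proof -
      have "t\<^sup>2 * (2 * \<gamma> - \<gamma>\<^sup>2) / (8 * V + 20 * t * C) \<le> t\<^sup>2 * (2 * \<gamma>) / (8 * V + 20 * t * C)"
        using D0 by (intro divide_right_mono mult_left_mono) auto
      also have "\<dots> = t\<^sup>2 / (4 * (V / \<gamma>) + 2 * (5 * C / \<gamma>) * t)"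
      proof -
        have "8 * V + 20 * t * C = (4 * (V / \<gamma>) + 2 * (5 * C / \<gamma>) * t) * (2 * \<gamma>)"
          using True by (simp add: field_simps)
        then show ?thesis using True by (simp only:) (rule mult_divide_mult_cancel_right, simp)
      qed
      finally show ?thesis by simp
    qed
    finally show ?thesis by (simp add: Sg)
  qed
qed

text \<open>
  For a single observation both bounds are trivial when \<open>t \<le> C\<close>, and the event is empty otherwise;
  for at least two observations the slack \<open>0.8 V\<close> absorbs the two boundary factors.
\<close>

lemma tail_gap:
  fixes f :: "'a \<Rightarrow> real"
  assumes f: "f \<in> real_L2 \<pi>" and fC: "\<And>x. \<bar>f x - (\<integral>y. f y \<partial>\<pi>)\<bar> \<le> C" and t: "0 \<le> t"
  defines "\<gamma> \<equiv> spectral_gap P \<pi>"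
  defines "S \<equiv> \<lambda>\<omega>. \<Sum>i=1..n. f (X i \<omega>)"
  defines "V \<equiv> \<integral>x. (f x - (\<integral>y. f y \<partial>\<pi>))\<^sup>2 \<partial>\<pi>"
  shows "0 < \<gamma> \<Longrightarrow> measure N {\<omega> \<in> space N. t \<le> \<bar>S \<omega> - (\<integral>\<omega>'. S \<omega>' \<partial>N)\<bar>}
      \<le> 2 * exp (- (t\<^sup>2 / (2 * real n * (asymptotic_variance P \<pi> f + 0.8 * V) + 10 * t * C / \<gamma>)))" (is "_ \<Longrightarrow> ?A")
    and "measure N {\<omega> \<in> space N. t \<le> \<bar>S \<omega> - (\<integral>\<omega>'. S \<omega>' \<partial>N)\<bar>}
      \<le> 2 * exp (- (t\<^sup>2 * \<gamma> / (4 * real n * V + 10 * t * C)))" (is ?B)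
proof -
  have C0: "0 \<le> C" using fC[of undefined] by linarith
  have V0: "0 \<le> V" unfolding V_def by simp
  define g where "g = (\<lambda>x. f x - (\<integral>y. f y \<partial>\<pi>))"
  have gL: "g \<in> real_L2 \<pi>" unfolding g_def by (rule real_L2_center[OF f])
  have gm: "g \<in> borel_measurable borel" using gL by measurable
  have gC: "\<bar>g x\<bar> \<le> C" for x using fC by (simp add: g_def)
  have mean: "(\<integral>x. g x \<partial>\<pi>) = 0" unfolding g_def by (rule real_ip_center(3)[OF f])
  have Vg: "V = (\<integral>x. (g x)\<^sup>2 \<partial>\<pi>)" by (simp add: V_def g_def)
  have Sg: "S \<omega> - (\<integral>\<omega>'. S \<omega>' \<partial>N) = (\<Sum>i=1..n. g (X i \<omega>))" for \<omega>
    unfolding S_def using expectation_sum_X[of "\<lambda>_. f"] f by (simp add: g_def sum_subtractf)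
  consider "t = 0" | "0 < t" "V = 0" | "0 < t" "0 < V" "\<not> 0 < \<gamma>" | "0 < t" "0 < V" "0 < \<gamma>"
    using t V0 by linarith
  then have "(0 < \<gamma> \<longrightarrow> ?A) \<and> ?B"
  proof cases
    case 1
    then show ?thesis using tail_trivial[of 0] by simp
  next
    case 2
    then show ?thesis using tail_degenerate[of "\<lambda>_. g" t] gL unfolding Sg Vg by simp
  next
    case 3
    then have "t\<^sup>2 * \<gamma> / (4 * real n * V + 10 * t * C) \<le> 0"
      using C0 by (intro divide_nonpos_nonneg mult_nonneg_nonpos add_nonneg_nonneg) auto
    then show ?thesis using 3 by (simp add: tail_trivial)
  next
    case 4
    define s where "s = (asymptotic_variance P \<pi> f + V) / 2"
    have form: "V / 2 \<le> s" "\<gamma> * s \<le> V" "\<gamma> \<le> 2" "\<And>h. h \<in> real_L2 \<pi> \<Longrightarrow> (real_ip \<pi> g h)\<^sup>2 \<le> s * Dirichlet h"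
      using asymptotic_variance_form[OF 4(3)[unfolded \<gamma>_def] f 4(2)[unfolded V_def]]
      unfolding s_def \<gamma>_def V_def g_def by blast+
    define a where "a = real n * (s - V / 10)"
    have a0: "0 < a" using n form(1) 4 by (simp add: a_def)
    \<comment> \<open>4 (s - V/10) = 2 (\<sigma>^2 + V) - 0.4 V with \<sigma>^2 the asymptotic
      variance, which is where 0.8 arises.\<close>
    have D: "4 * a + 2 * (5 * C / \<gamma>) * t = 2 * real n * (asymptotic_variance P \<pi> f + 0.8 * V) + 10 * t * C / \<gamma>"
      by (simp add: a_def s_def field_simps)
    define D1 where "D1 = 4 * a + 2 * (5 * C / \<gamma>) * t"
    have Ct: "0 \<le> 2 * (5 * C / \<gamma>) * t" using C0 4 by simp
    then have D1: "0 < D1" using a0 by (simp add: D1_def)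
    have tail: "measure N {\<omega> \<in> space N. t \<le> \<bar>\<Sum>i=1..n. g (X i \<omega>)\<bar>} \<le> 2 * exp (- (t\<^sup>2 / D1))"
    proof (cases "n = 1")
      case True
      show ?thesis
      proof (cases "t \<le> C")
        case True
        \<comment> \<open>\<gamma> <= 2 and t <= C give t <= 2 C / \<gamma>, so t^2 is at most a
          fifth of the denominator, and 2 exp (-1/5) >= 8/5 exceeds every probability.\<close>
        have "t * t \<le> 5 * C / \<gamma> * 2 * t / 5"
        proof -
          have "t * \<gamma> \<le> C * 2" using True form(3) t 4 by (intro mult_mono) auto
          then have "t \<le> 2 * C / \<gamma>" using 4 by (simp add: field_simps)
          then have "t * t \<le> 2 * C / \<gamma> * t" using t by (rule mult_right_mono)
          then show ?thesis by simp
        qed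
        also have "\<dots> \<le> D1 / 5" using a0 by (simp add: D1_def)
        finally have "t\<^sup>2 / D1 \<le> 1 / 5" using D1 by (simp add: power2_eq_square field_simps)
        then have "4 / 5 \<le> exp (- (t\<^sup>2 / D1))" using exp_ge_add_one_self[of "- (t\<^sup>2 / D1)"] by linarith
        then show ?thesis using N.prob_le_1[of "{\<omega> \<in> space N. t \<le> \<bar>\<Sum>i=1..n. g (X i \<omega>)\<bar>}"] by linarith
      next
        case False
        then have empty: "{\<omega> \<in> space N. t \<le> \<bar>\<Sum>i=1..n. g (X i \<omega>)\<bar>} = {}"
          using gC \<open>n = 1\<close> by (force simp: not_le intro: le_less_trans)
        show ?thesis unfolding empty by simp
      qed
    next
      case False
      then have n2: "2 \<le> n" using n by simp
      show ?thesis
        unfolding D1_def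
      proof (rule tail_of_mgf[of "\<lambda>_. g", OF gm gC])
        fix \<theta> :: real assume \<theta>: "0 \<le> \<theta>" "5 * C / \<gamma> * \<theta> < 1"
        show "(\<integral>x. forward_weight (\<lambda>i x. \<theta> * g x) (n - 1) 1 x \<partial>\<pi>) \<le> exp (a * \<theta>\<^sup>2 / (1 - 5 * C / \<gamma> * \<theta>))"
          unfolding a_def Vg \<gamma>_def
          by (rule mgf_bound_gap) (use 4 n2 gm gC mean \<theta> form in \<open>auto simp: \<gamma>_def Vg\<close>)
        have neg: "real_ip \<pi> (\<lambda>x. - g x) h = - real_ip \<pi> g h" for h by (simp add: real_ip_def)
        have "(\<integral>x. forward_weight (\<lambda>i x. \<theta> * - g x) (n - 1) 1 x \<partial>\<pi>)
          \<le> exp (real n * (s - (\<integral>x. (- g x)\<^sup>2 \<partial>\<pi>) / 10) * \<theta>\<^sup>2 / (1 - 5 * C / spectral_gap P \<pi> * \<theta>))"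
          by (rule mgf_bound_gap) (use 4 n2 gm gC mean \<theta> form in \<open>auto simp: \<gamma>_def Vg neg\<close>)
        then show "(\<integral>x. forward_weight (\<lambda>i x. \<theta> * - g x) (n - 1) 1 x \<partial>\<pi>) \<le> exp (a * \<theta>\<^sup>2 / (1 - 5 * C / \<gamma> * \<theta>))"
          by (simp add: a_def Vg \<gamma>_def)
      qed (use a0 C0 4 t in auto)
    qed
    \<comment> \<open>The second bound is a weakening of the first: \<gamma> s <= V bounds \<gamma>
      D1 by 4 n V + 10 t C.\<close>
    have "t\<^sup>2 * \<gamma> / (4 * real n * V + 10 * t * C) \<le> t\<^sup>2 * \<gamma> / (\<gamma> * D1)"
    proof (rule divide_left_mono)
      have "\<gamma> * D1 = 4 * real n * (\<gamma> * s) - 4 * real n * \<gamma> * V / 10 + 10 * t * C"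
        using 4 by (simp add: D1_def a_def field_simps)
      also have "\<dots> \<le> 4 * real n * V + 10 * t * C"
      proof -
        have "4 * real n * (\<gamma> * s) \<le> 4 * real n * V" using form(2) by (intro mult_left_mono) auto
        moreover have "0 \<le> 4 * real n * \<gamma> * V / 10" using 4 by simp
        ultimately show ?thesis by linarith
      qed
      finally show le: "\<gamma> * D1 \<le> 4 * real n * V + 10 * t * C" .
      have "0 < \<gamma> * D1" using 4 D1 by simp
      with le show "0 < (4 * real n * V + 10 * t * C) * (\<gamma> * D1)" by simp
    qed (use 4 in simp)
    also have "\<dots> = t\<^sup>2 / D1" using 4 by simp
    finally have "exp (- (t\<^sup>2 / D1)) \<le> exp (- (t\<^sup>2 * \<gamma> / (4 * real n * V + 10 * t * C)))" by simp
    with tail show ?thesis unfolding Sg D[symmetric] D1_def[symmetric] by linarith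
  qed
  then show "0 < \<gamma> \<Longrightarrow> ?A" ?B by auto
qed

end
end

lemma real_L2_of_L2: "(\<lambda>x. complex_of_real (f x)) \<in> L2 M \<Longrightarrow> f \<in> real_L2 M"
  using L2_Re[of "\<lambda>x. complex_of_real (f x)" M] by simp

theorem theorem3p9:
  fixes P :: "'a::polish_space \<Rightarrow> 'a measure"
    and \<pi> :: "'a measure"
    and N :: "'w measure"
    and X :: "nat \<Rightarrow> 'w \<Rightarrow> 'a"
    and n :: nat
  assumes kernel: "P \<in> borel \<rightarrow>\<^sub>M prob_algebra borel"
    and stationary: "stationary_distribution P \<pi>"
    and unique: "\<And>\<nu>. stationary_distribution P \<nu> \<Longrightarrow> \<nu> = \<pi>"
    and reversible: "reversible_kernel P \<pi>"
    and irreducible: "phi_irreducible P"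
    and aperiodic: "aperiodic_kernel P \<pi>"
    and n: "n \<ge> 1"
    and chain: "markov_chain N P n X"
    and initial: "distr N borel (X 1) = \<pi>"
  shows
    "(\<forall>(f :: 'a \<Rightarrow> real) (C :: real).
        (\<lambda>x. complex_of_real (f x)) \<in> L2 \<pi> \<and>
        (\<forall>x. \<bar>f x - (\<integral>y. f y \<partial>\<pi>)\<bar> \<le> C) \<and>
        (even n \<or> finite (UNIV :: 'a set)) \<longrightarrow>
        (let S = (\<lambda>\<omega>. \<Sum>i=1..n. f (X i \<omega>));
             V = prob_space.variance \<pi> f;
             \<gamma> = spectral_gap P \<pi>
         in (\<gamma> > 0 \<longrightarrow>
              (\<forall>t\<ge>0. measure N {\<omega> \<in> space N. \<bar>S \<omega> - (\<integral>\<omega>'. S \<omega>' \<partial>N)\<bar> \<ge> t}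
                 \<le> 2 * exp (- (t\<^sup>2 / (2 * real n * (asymptotic_variance P \<pi> f + 0.8 * V)
                                        + 10 * t * C / \<gamma>))))) \<and>
            (\<forall>t\<ge>0. measure N {\<omega> \<in> space N. \<bar>S \<omega> - (\<integral>\<omega>'. S \<omega>' \<partial>N)\<bar> \<ge> t}
                 \<le> 2 * exp (- (t\<^sup>2 * \<gamma> / (4 * real n * V + 10 * t * C)))))) \<and>
     (\<forall>(f :: nat \<Rightarrow> 'a \<Rightarrow> real) (C :: real).
        (\<forall>i\<in>{1..n}. (\<lambda>x. complex_of_real (f i x)) \<in> L2 \<pi> \<and>
                     (\<forall>x. \<bar>f i x - (\<integral>y. f i y \<partial>\<pi>)\<bar> \<le> C)) \<longrightarrow>
        (let S' = (\<lambda>\<omega>. \<Sum>i=1..n. f i (X i \<omega>));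
             V' = (\<Sum>i=1..n. prob_space.variance \<pi> (f i));
             \<gamma>' = abs_spectral_gap P \<pi>
         in (\<forall>t\<ge>0. measure N {\<omega> \<in> space N. \<bar>S' \<omega> - (\<integral>\<omega>'. S' \<omega>' \<partial>N)\<bar> \<ge> t}
                 \<le> 2 * exp (- (t\<^sup>2 * (2 * \<gamma>' - \<gamma>'\<^sup>2) / (8 * V' + 20 * t * C))))))"
proof -
  interpret reversible_chain P \<pi>
    by (rule reversible_chain.intro[OF kernel stationary reversible])
  note gap = tail_gap[OF chain initial n]
  show ?thesis
    unfolding Let_def
    by (intro conjI allI impI tail_abs_gap[OF chain initial n] gap)
       (auto intro: real_L2_of_L2)
qed

end
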